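(* Let $p$ be a prime, $n\ge 1$ an integer, and $P_n$ a Sylow $p$-subgroup of the symmetric group $S_{p^n}$. Then there is a Hall $p'$-subgroup $H$ of the normalizer $N_{S_{p^n}}(P_n)$ with the following property: if $N\trianglelefteq P_n$ is a normal subgroup (not assumed to be $H$-invariant) which has a complement in $P_n$, then $N$ has an $H$-invariant complement in $P_n$.
   Context: $H$ acts on $P_n$ by conjugation. A complement of $N\trianglelefteq P_n$ in $P_n$ is a subgroup $C\le P_n$ with $NC=P_n$ and $N\cap C=1$. A Hall $p'$-subgroup of a finite group $G$ is a subgroup whose order is prime to $p$ and whose index in $G$ is a power of $p$. *)

theory Defs
  imports "HOL-Algebra.Algebra"
begin

text \<open>Subgroups are carrier sets of an ambient group \<open>G\<close>; a subgroup \<open>K\<close> viewed as a group in its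
  own right is \<open>G\<lparr>carrier := K\<rparr>\<close>. The first two notions are meant for finite \<open>G\<close> and prime \<open>p\<close>.\<close>

definition sylow_subgroup :: "('a, 'b) monoid_scheme \<Rightarrow> nat \<Rightarrow> 'a set \<Rightarrow> bool" where
  "sylow_subgroup G p P \<longleftrightarrow>
     finite (carrier G) \<and> subgroup P G \<and> card P = p ^ multiplicity p (order G)"

definition hall_p'_subgroup :: "('a, 'b) monoid_scheme \<Rightarrow> nat \<Rightarrow> 'a set \<Rightarrow> bool" where
  "hall_p'_subgroup G p H \<longleftrightarrow>
     finite (carrier G) \<and> subgroup H G \<and> coprime (card H) p \<and>
     (\<exists>k. card (rcosets\<^bsub>G\<^esub> H) = p ^ k)"

definition is_complement :: "('a, 'b) monoid_scheme \<Rightarrow> 'a set \<Rightarrow> 'a set \<Rightarrow> bool" where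
  "is_complement G N C \<longleftrightarrow>
     subgroup C G \<and> N <#>\<^bsub>G\<^esub> C = carrier G \<and> N \<inter> C = {\<one>\<^bsub>G\<^esub>}"

definition conj_invariant :: "('a, 'b) monoid_scheme \<Rightarrow> 'a set \<Rightarrow> 'a set \<Rightarrow> bool" where
  "conj_invariant G H C \<longleftrightarrow> (\<forall>h\<in>H. h <#\<^bsub>G\<^esub> C #>\<^bsub>G\<^esub> (inv\<^bsub>G\<^esub> h) = C)"

end

theory Submission
  imports Defs
begin

text \<open>
  Write \<open>P\<^sub>n\<^sub>+\<^sub>1 = V \<rtimes> P\<^sub>n\<close>, where \<open>V\<close> consists of the functions from \<open>\<Omega> = {0..<p\<^sup>n}\<close> to \<open>\<int>/p\<close>, and let
  \<open>H\<^sub>n\<^sub>+\<^sub>1 = H\<^sub>n \<times> (\<int>/p)\<^sup>*\<close> act levelwise. Let \<open>C\<close> be a complement of \<open>N\<close>, let \<open>\<pi>\<close> be the projection to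
  \<open>P\<^sub>n\<close>, and put \<open>K = N \<inter> V\<close>, \<open>M = \<pi>(N)\<close> and \<open>D = {c \<in> C. \<pi>(c) \<in> M}\<close>. A \<open>P\<^sub>n\<close>-invariant subgroup of \<open>V\<close> that
  contains a function with nonzero sum is all of \<open>V\<close>. Comparing the \<open>V\<close>-component of an element of \<open>D\<close>
  with its class modulo \<open>N\<close> yields two such subgroups, one of which must be \<open>V\<close>. In the first case
  \<open>\<pi>(C)\<close> is a complement of \<open>N \<inter> P\<^sub>n\<close> in \<open>P\<^sub>n\<close>, and every complement of \<open>N \<inter> P\<^sub>n\<close> in \<open>P\<^sub>n\<close> is one of \<open>N\<close>, so
  induction applies. In the second case \<open>K\<close> consists of the functions whose sum over each \<open>M\<close>-orbit is
  zero, and \<open>M\<close> has a complement in \<open>P\<^sub>n\<close> with an orbit that meets every \<open>M\<close>-orbit exactly once. Carrying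
  the minimal orbit length through the induction gives an \<open>H\<close>-invariant complement \<open>R\<close> of \<open>M\<close> with such
  an orbit. Then \<open>K\<close> has an \<open>R\<close>- and \<open>H\<close>-invariant complement \<open>L\<close> in \<open>V\<close>, and \<open>L R\<close> is a complement of \<open>N\<close>
  that is invariant under \<open>H\<close>, although \<open>N\<close> need not be.
\<close>

section \<open>Finite groups written additively\<close>

text \<open>The obstacle is that \<open>H\<close> need not normalise \<open>N\<close>, so nothing
  can be averaged over \<open>H\<close> in the quotient by \<open>N\<close>. Rigidity of blocks
  replaces invariance: every equivalence relation on \<Omega> invariant under \<open>Pn n\<close> is
  given by leading base \<open>p\<close> digits, and \<open>H\<close> preserves those. Hence
  \<open>H\<close> permutes the orbits of each normal subgroup \<open>M\<close>, and in the second
  case \<open>K\<close>, which depends on these orbits alone, is \<open>H\<close>-invariant even if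
  \<open>N\<close> is not. The dichotomy rests on \<open>V\<close> being a local module: the
  functions with sum zero form its only maximal invariant subgroup. A unit vector has sum 1 and is a
  sum of members of the two invariant subgroups, so one of them is not inside that maximal one. An
  invariant complement \<open>R\<close> of \<open>M\<close> alone is too weak: \<open>L\<close>
  needs in each \<open>M\<close>-orbit a set fixed pointwise by the stabiliser of that orbit in
  \<open>R\<close>. An \<open>R\<close>-orbit no longer than the number of \<open>M\<close>-orbits
  supplies it, and lengths, unlike points, can be compared between different complements. The set
  used is an \<open>H\<close>-orbit, not a single point; its size is prime to \<open>p\<close>, so
  dividing by it is possible.\<close>

definition subgrp :: "'a::group_add set \<Rightarrow> bool" where
  "subgrp A \<longleftrightarrow> 0 \<in> A \<and> (\<forall>x\<in>A. \<forall>y\<in>A. x + y \<in> A) \<and> (\<forall>x\<in>A. - x \<in> A)"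

definition conj_stable :: "'a::group_add set \<Rightarrow> 'a set \<Rightarrow> bool" where
  "conj_stable A B \<longleftrightarrow> (\<forall>a\<in>A. \<forall>b\<in>B. a + b - a \<in> B)"

definition complements :: "'a::group_add set \<Rightarrow> 'a set \<Rightarrow> 'a set \<Rightarrow> bool" where
  "complements G N C \<longleftrightarrow>
     subgrp C \<and> C \<subseteq> G \<and> (\<forall>g\<in>G. \<exists>x\<in>N. \<exists>c\<in>C. g = x + c) \<and> N \<inter> C = {0}"

lemma subgrpI:
  assumes "0 \<in> A" "\<And>x y. x \<in> A \<Longrightarrow> y \<in> A \<Longrightarrow> x + y \<in> A" "\<And>x. x \<in> A \<Longrightarrow> - x \<in> A"
  shows "subgrp A"
  using assms by (auto simp: subgrp_def)

lemma subgrp_0: "subgrp A \<Longrightarrow> 0 \<in> A"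
  and subgrp_add: "subgrp A \<Longrightarrow> x \<in> A \<Longrightarrow> y \<in> A \<Longrightarrow> x + y \<in> A"
  and subgrp_minus: "subgrp A \<Longrightarrow> x \<in> A \<Longrightarrow> - x \<in> A"
  by (auto simp: subgrp_def)

lemma subgrp_diff: "subgrp A \<Longrightarrow> x \<in> A \<Longrightarrow> y \<in> A \<Longrightarrow> x - y \<in> A"
  by (metis diff_conv_add_uminus subgrp_add subgrp_minus)

lemma subgrp_Int: "subgrp A \<Longrightarrow> subgrp B \<Longrightarrow> subgrp (A \<inter> B)"
  by (auto simp: subgrp_def)

lemma subgrp_zero: "subgrp {0}"
  by (auto simp: subgrp_def)

lemma conj_stableI: "(\<And>a b. a \<in> A \<Longrightarrow> b \<in> B \<Longrightarrow> a + b - a \<in> B) \<Longrightarrow> conj_stable A B"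
  by (auto simp: conj_stable_def)

lemma conj_stableD: "conj_stable A B \<Longrightarrow> a \<in> A \<Longrightarrow> b \<in> B \<Longrightarrow> a + b - a \<in> B"
  by (auto simp: conj_stable_def)

lemma conj_stable_self: "subgrp A \<Longrightarrow> conj_stable A A"
  by (auto simp: conj_stable_def intro: subgrp_add subgrp_diff)

lemma conj_stableD':
  assumes "conj_stable A B" "subgrp A" "a \<in> A" "b \<in> B"
  shows "- a + b + a \<in> B"
  using conj_stableD[OF assms(1) subgrp_minus[OF assms(2,3)] assms(4)] by simp

lemma subgrp_image:
  fixes f :: "'a::group_add \<Rightarrow> 'b::group_add"
  assumes A: "subgrp A" and f: "\<And>x y. x \<in> A \<Longrightarrow> y \<in> A \<Longrightarrow> f (x + y) = f x + f y"
  shows "subgrp (f ` A)"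
proof -
  have "f (0 + 0) = f 0 + f 0" by (intro f subgrp_0[OF A])
  then have f0: "f 0 = 0" by (metis add.right_neutral add_left_imp_eq)
  have fm: "f (- x) = - f x" if "x \<in> A" for x
  proof -
    have "f (x + - x) = f x + f (- x)" using that A by (intro f) (auto simp: subgrp_def)
    then show ?thesis by (simp add: f0 minus_unique)
  qed
  show ?thesis
  proof (rule subgrpI)
    show "0 \<in> f ` A" using f0 subgrp_0[OF A] by force
    fix u v assume "u \<in> f ` A" "v \<in> f ` A"
    then obtain x y where "x \<in> A" "y \<in> A" "u = f x" "v = f y" by blast
    then show "u + v \<in> f ` A" using f[of x y] subgrp_add[OF A, of x y] by (metis imageI)
  next
    fix u assume "u \<in> f ` A"
    then obtain x where "x \<in> A" "u = f x" by blast
    then show "- u \<in> f ` A" using fm[of x] subgrp_minus[OF A, of x] by (metis imageI)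
  qed
qed

lemma complements_subgrp: "complements G N C \<Longrightarrow> subgrp C"
  and complements_subset: "complements G N C \<Longrightarrow> C \<subseteq> G"
  and complements_Int: "complements G N C \<Longrightarrow> x \<in> N \<Longrightarrow> x \<in> C \<Longrightarrow> x = 0"
  by (auto simp: complements_def)

lemma complements_decomp:
  assumes "complements G N C" "g \<in> G"
  obtains x c where "x \<in> N" "c \<in> C" "g = x + c"
  using assms by (auto simp: complements_def)

section \<open>Orders of products and numbers of cosets\<close>

lemma card_vimage_const:
  assumes "finite S" "\<And>y. y \<in> f ` S \<Longrightarrow> card {x \<in> S. f x = y} = k"
  shows "card S = card (f ` S) * k"
proof -
  have "card S = (\<Sum>y\<in>f ` S. card {x \<in> S. f x = y})"
    unfolding card_eq_sum by (rule sum.image_gen[OF assms(1)])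
  then show ?thesis using assms(2) by simp
qed

lemma card_set_plus:
  fixes A B :: "'a::group_add set"
  assumes A: "subgrp A" and B: "subgrp B" and fin: "finite A" "finite B"
  shows "card A * card B = card ((\<lambda>(a, b). a + b) ` (A \<times> B)) * card (A \<inter> B)"
proof -
  let ?f = "\<lambda>(a, b). a + b"
  have "card (A \<times> B) = card (?f ` (A \<times> B)) * card (A \<inter> B)"
  proof (rule card_vimage_const)
    show "finite (A \<times> B)" using fin by simp
    fix y assume "y \<in> ?f ` (A \<times> B)"
    then obtain a b where ab: "a \<in> A" "b \<in> B" "y = a + b" by auto
    \<comment> \<open>All pairs with the same sum arise from one of them by inserting
      \<open>c\<close> and \<open>- c\<close> between the two summands, with \<open>c\<close> in
      both subgroups.\<close>
    have "bij_betw (\<lambda>c. (a + c, - c + b)) (A \<inter> B) {x \<in> A \<times> B. ?f x = y}"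
    proof (rule bij_betwI[where g = "\<lambda>(u, v). - a + u"])
      show "(\<lambda>c. (a + c, - c + b)) \<in> A \<inter> B \<rightarrow> {x \<in> A \<times> B. ?f x = y}"
        using ab A B by (auto simp: add.assoc subgrp_def)
      show "(\<lambda>(u, v). - a + u) \<in> {x \<in> A \<times> B. ?f x = y} \<rightarrow> A \<inter> B"
      proof
        fix x assume "x \<in> {x \<in> A \<times> B. ?f x = y}"
        then obtain u v where uv: "x = (u, v)" "u \<in> A" "v \<in> B" "u + v = a + b"
          using ab by auto
        then have "- a + u = b - v"
          by (metis add.assoc add_diff_cancel minus_add_cancel)
        then show "(case x of (u, v) \<Rightarrow> - a + u) \<in> A \<inter> B"
          using uv ab subgrp_add[OF A subgrp_minus[OF A ab(1)] uv(2)] subgrp_diff[OF B ab(2) uv(3)]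
          by simp
      qed
      show "(case (a + c, - c + b) of (u, v) \<Rightarrow> - a + u) = c" for c by (simp add: add.assoc[symmetric])
      fix x assume "x \<in> {x \<in> A \<times> B. ?f x = y}"
      then obtain u v where uv: "x = (u, v)" "u + v = a + b" using ab by auto
      then have "v = - u + (a + b)" by (metis minus_add_cancel)
      then show "(a + (case x of (u, v) \<Rightarrow> - a + u), - (case x of (u, v) \<Rightarrow> - a + u) + b) = x"
        using uv by (simp add: minus_add add.assoc[symmetric])
    qed
    then show "card {x \<in> A \<times> B. ?f x = y} = card (A \<inter> B)"
      by (rule bij_betw_same_card[symmetric])
  qed
  then show ?thesis by (simp add: card_cartesian_product)
qed

lemma card_complements:
  assumes "complements G N C" "subgrp N" "N \<subseteq> G" "subgrp G" "finite G"
  shows "card N * card C = card G"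
proof -
  have "(\<lambda>(a, b). a + b) ` (N \<times> C) = G"
  proof (intro equalityI subsetI)
    fix g assume "g \<in> G"
    then obtain x c where "x \<in> N" "c \<in> C" "g = x + c" by (rule complements_decomp[OF assms(1)])
    then show "g \<in> (\<lambda>(a, b). a + b) ` (N \<times> C)" by force
  qed (use assms(3,4) complements_subset[OF assms(1)] in \<open>auto intro!: subgrp_add\<close>)
  then show ?thesis
    using card_set_plus[of N C] assms finite_subset by (auto simp: complements_def)
qed

text \<open>Trivial intersection makes the sums of elements of \<open>N\<close> and \<open>C\<close>
  pairwise distinct, so an inequality of orders is enough to fill \<open>G\<close>.\<close>

lemma complements_by_card:
  assumes C: "subgrp C" "C \<subseteq> G" and N: "subgrp N" "N \<subseteq> G" and G: "subgrp G" "finite G"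
    and int: "N \<inter> C = {0}" and card: "card G \<le> card N * card C"
  shows "complements G N C"
proof -
  have "card N * card C = card ((\<lambda>(a, b). a + b) ` (N \<times> C))"
    using card_set_plus[of N C] assms finite_subset by fastforce
  moreover have "(\<lambda>(a, b). a + b) ` (N \<times> C) \<subseteq> G"
    using C(2) N(2) by (auto intro: subgrp_add[OF G(1)])
  ultimately have "(\<lambda>(a, b). a + b) ` (N \<times> C) = G"
    using card G(2) by (intro card_seteq) auto
  then show ?thesis using C int unfolding complements_def by (auto simp: image_iff)
qed

lemma coset_eq_iff:
  assumes A: "subgrp A"
  shows "(+) v ` A = (+) w ` A \<longleftrightarrow> - w + v \<in> A"
proof
  assume eq: "(+) v ` A = (+) w ` A"
  have "v \<in> (+) v ` A" using subgrp_0[OF A] by force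
  then obtain y where "y \<in> A" "v = w + y" using eq by auto
  then show "- w + v \<in> A" by (simp add: add.assoc[symmetric])
next
  have sub: "(+) v ` A \<subseteq> (+) w ` A" if y: "- w + v \<in> A" for v w
  proof
    fix z assume "z \<in> (+) v ` A"
    then obtain u where "u \<in> A" "z = v + u" by auto
    moreover have "z = w + (- w + v + u)" using \<open>z = v + u\<close> by (simp add: add.assoc)
    ultimately show "z \<in> (+) w ` A" using subgrp_add[OF A y] by blast
  qed
  assume y: "- w + v \<in> A"
  have y': "- v + w \<in> A" using subgrp_minus[OF A y] by (simp add: minus_add)
  show "(+) v ` A = (+) w ` A" using sub[OF y] sub[OF y'] by blast
qed

lemma card_cosets:
  assumes A: "subgrp A" and B: "subgrp B" and "A \<subseteq> B" "finite B"
  shows "card B = card ((\<lambda>b. (+) b ` A) ` B) * card A"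
proof (rule card_vimage_const)
  fix y assume "y \<in> (\<lambda>b. (+) b ` A) ` B"
  then obtain b where b: "b \<in> B" "y = (+) b ` A" by auto
  have "{x \<in> B. (+) x ` A = y} = (+) b ` A"
  proof (intro equalityI subsetI)
    fix x assume "x \<in> {x \<in> B. (+) x ` A = y}"
    then have "- b + x \<in> A" using b coset_eq_iff[OF A] by simp
    moreover have "x = b + (- b + x)" by (simp add: add.assoc[symmetric])
    ultimately show "x \<in> (+) b ` A" by blast
  next
    fix x assume "x \<in> (+) b ` A"
    then obtain a where a: "a \<in> A" "x = b + a" by auto
    then have "- b + x \<in> A" by (simp add: add.assoc[symmetric])
    then show "x \<in> {x \<in> B. (+) x ` A = y}"
      using a b coset_eq_iff[OF A, of x b] subgrp_add[OF B b(1), of a] assms(3) by auto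
  qed
  then show "card {x \<in> B. (+) x ` A = y} = card A" by (simp add: card_image)
qed (use assms in auto)

lemma card_subgrp_dvd:
  assumes "subgrp A" "subgrp B" "A \<subseteq> B" "finite B"
  shows "card A dvd card B"
  using card_cosets[OF assms] by (metis dvd_triv_right)

section \<open>Actions, orbits and fixed points of \<open>p\<close>-groups\<close>

definition orb :: "('g \<Rightarrow> 'x \<Rightarrow> 'x) \<Rightarrow> 'g set \<Rightarrow> 'x \<Rightarrow> 'x set" where
  "orb act G x = (\<lambda>g. act g x) ` G"

definition acts :: "('g::group_add \<Rightarrow> 'x \<Rightarrow> 'x) \<Rightarrow> 'g set \<Rightarrow> 'x set \<Rightarrow> bool" where
  "acts act G S \<longleftrightarrow> subgrp G \<and> (\<forall>g\<in>G. \<forall>x\<in>S. act g x \<in> S) \<and> (\<forall>x\<in>S. act 0 x = x) \<and>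
     (\<forall>g\<in>G. \<forall>h\<in>G. \<forall>x\<in>S. act (g + h) x = act g (act h x))"

lemma actsI:
  assumes "subgrp G" "\<And>g x. g \<in> G \<Longrightarrow> x \<in> S \<Longrightarrow> act g x \<in> S" "\<And>x. x \<in> S \<Longrightarrow> act 0 x = x"
    "\<And>g h x. g \<in> G \<Longrightarrow> h \<in> G \<Longrightarrow> x \<in> S \<Longrightarrow> act (g + h) x = act g (act h x)"
  shows "acts act G S"
  using assms by (auto simp: acts_def)

lemma
  assumes "acts act G S"
  shows acts_subgrp: "subgrp G" and acts_in: "g \<in> G \<Longrightarrow> x \<in> S \<Longrightarrow> act g x \<in> S"
    and acts_0: "x \<in> S \<Longrightarrow> act 0 x = x"
    and acts_add: "g \<in> G \<Longrightarrow> h \<in> G \<Longrightarrow> x \<in> S \<Longrightarrow> act (g + h) x = act g (act h x)"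
  using assms by (auto simp: acts_def)

lemma
  assumes "acts act G S" "g \<in> G" "x \<in> S"
  shows acts_inv1: "act (- g) (act g x) = x" and acts_inv2: "act g (act (- g) x) = x"
proof -
  have m: "- g \<in> G" using assms subgrp_minus[OF acts_subgrp] by blast
  show "act (- g) (act g x) = x"
    using acts_add[OF assms(1) m assms(2,3)] acts_0[OF assms(1,3)] by simp
  show "act g (act (- g) x) = x"
    using acts_add[OF assms(1,2) m assms(3)] acts_0[OF assms(1,3)] by simp
qed

lemma acts_subset:
  "acts act G S \<Longrightarrow> subgrp A \<Longrightarrow> A \<subseteq> G \<Longrightarrow> acts act A S"
  unfolding acts_def by (auto simp: subset_eq)

lemma orb_self: "acts act G S \<Longrightarrow> x \<in> S \<Longrightarrow> x \<in> orb act G x"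
  unfolding orb_def by (metis acts_0 acts_subgrp imageI subgrp_0)

lemma orb_subset: "acts act G S \<Longrightarrow> x \<in> S \<Longrightarrow> orb act G x \<subseteq> S"
  unfolding orb_def by (auto intro: acts_in)

lemma orb_sym:
  assumes "acts act G S" "x \<in> S" "y \<in> orb act G x" shows "x \<in> orb act G y"
proof -
  obtain g where "g \<in> G" "y = act g x" using assms by (auto simp: orb_def)
  then have "x = act (- g) y" "- g \<in> G"
    using acts_inv1[OF assms(1)] assms(2) subgrp_minus[OF acts_subgrp[OF assms(1)]] by auto
  then show ?thesis by (auto simp: orb_def)
qed

lemma orb_trans:
  assumes "acts act G S" "x \<in> S" "y \<in> orb act G x" "z \<in> orb act G y" shows "z \<in> orb act G x"
proof -
  obtain g h where "g \<in> G" "h \<in> G" "y = act g x" "z = act h y" using assms by (auto simp: orb_def)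
  then have "z = act (h + g) x" "h + g \<in> G"
    using assms acts_add[OF assms(1)] subgrp_add[OF acts_subgrp[OF assms(1)]] by auto
  then show ?thesis by (auto simp: orb_def)
qed

lemma orb_eq:
  assumes "acts act G S" "x \<in> S" "y \<in> orb act G x" shows "orb act G y = orb act G x"
  using orb_trans[OF assms(1)] orb_sym[OF assms(1)] orb_subset[OF assms(1)] assms(2,3)
  by (meson subset_antisym subset_eq)

lemma orb_Int:
  assumes "acts act G S" "x \<in> S" "y \<in> S" "z \<in> orb act G x" "z \<in> orb act G y"
  shows "orb act G x = orb act G y"
  using orb_eq[OF assms(1)] assms by metis

lemma dvd_sum_orbits:
  fixes f :: "'x \<Rightarrow> int"
  assumes act: "acts act G S" and fin: "finite S"
    and dvd: "\<And>x. x \<in> S \<Longrightarrow> k dvd sum f (orb act G x)"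
  shows "k dvd sum f S"
proof -
  let ?P = "orb act G ` S"
  have "\<Union>?P = S" using orb_subset[OF act] orb_self[OF act] by fastforce
  moreover have "sum f (\<Union>?P) = (sum \<circ> sum) f ?P"
    using orb_Int[OF act] finite_subset[OF orb_subset[OF act] fin]
    by (intro sum.Union_disjoint ballI impI) (auto dest: finite_subset)
  ultimately show ?thesis using dvd by (auto intro!: dvd_sum[of "orb act G ` S" k "sum f"])
qed

lemma orb_stab:
  assumes act: "acts act G S" and x: "x \<in> S" and fin: "finite G"
  shows "card G = card (orb act G x) * card {g \<in> G. act g x = x}"
  unfolding orb_def
proof (rule card_vimage_const)
  fix y assume "y \<in> (\<lambda>g. act g x) ` G"
  then obtain h where h: "h \<in> G" "y = act h x" by auto
  note G = acts_subgrp[OF act]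
  have "bij_betw (\<lambda>g. h + g) {g \<in> G. act g x = x} {g \<in> G. act g x = y}"
  proof (rule bij_betwI[where g = "\<lambda>g. - h + g"])
    show "(\<lambda>g. h + g) \<in> {g \<in> G. act g x = x} \<rightarrow> {g \<in> G. act g x = y}"
      using h G acts_add[OF act] x by (auto simp: subgrp_def)
    show "(\<lambda>g. - h + g) \<in> {g \<in> G. act g x = y} \<rightarrow> {g \<in> G. act g x = x}"
      using h G acts_add[OF act] acts_inv1[OF act] x by (auto simp: subgrp_def)
  qed (auto simp: add.assoc[symmetric])
  then show "card {g \<in> G. act g x = y} = card {g \<in> G. act g x = x}"
    by (rule bij_betw_same_card[symmetric])
qed (use fin in auto)

lemma card_orb_dvd:
  assumes "acts act G S" "x \<in> S" "finite G"
  shows "card (orb act G x) dvd card G"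
  using orb_stab[OF assms] by simp

text \<open>A nontrivial orbit has length divisible by \<open>p\<close>, and \<open>f\<close> is
  constant on it. The weight is used twice: as an indicator for counting fixed points, and as a
  coordinate function in \<open>fixed_point_C1\<close>.\<close>

lemma orb_fixed_sum_dvd:
  fixes p a :: nat and f :: "'x \<Rightarrow> int"
  assumes p: "Factorial_Ring.prime p" and act: "acts act G S" and x: "x \<in> S"
    and G: "finite G" "card G = p ^ a" and nf: "\<exists>g\<in>G. act g x \<noteq> x"
    and f: "\<And>g. g \<in> G \<Longrightarrow> f (act g x) = f x"
  shows "int p dvd sum f (orb act G x)"
proof -
  have fin: "finite (orb act G x)" using G by (simp add: orb_def)
  have "sum f (orb act G x) = int (card (orb act G x)) * f x"
  proof -
    have "sum f (orb act G x) = sum (\<lambda>_. f x) (orb act G x)"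
      by (rule sum.cong[OF refl]) (auto simp: orb_def f)
    then show ?thesis by simp
  qed
  moreover have "p dvd card (orb act G x)"
  proof -
    obtain b where b: "card (orb act G x) = p ^ b"
      using card_orb_dvd[OF act x G(1)] G(2) p by (auto simp: divides_primepow_nat)
    obtain g where g: "g \<in> G" "act g x \<noteq> x" using nf by auto
    have "{x, act g x} \<subseteq> orb act G x"
      using g orb_self[OF act x] by (auto simp: orb_def)
    then have "card {x, act g x} \<le> card (orb act G x)" using fin card_mono by blast
    then have "card (orb act G x) > 1" using g by simp
    then show ?thesis using b by (cases b) auto
  qed
  ultimately show ?thesis by simp
qed

lemma p_group_fixed_points:
  fixes p a :: nat
  assumes p: "Factorial_Ring.prime p" and act: "acts act G S" and S: "finite S"
    and G: "finite G" "card G = p ^ a"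
  shows "card {x \<in> S. \<forall>g\<in>G. act g x = x} mod p = card S mod p"
proof -
  let ?F = "{x \<in> S. \<forall>g\<in>G. act g x = x}"
  \<comment> \<open>With weight 1 on the moved points only, the fixed points drop out and every
    other orbit contributes a multiple of \<open>p\<close>.\<close>
  let ?f = "\<lambda>x. if x \<in> ?F then 0 else 1 :: int"
  have "int p dvd sum ?f S"
  proof (rule dvd_sum_orbits[OF act S])
    fix x assume x: "x \<in> S"
    show "int p dvd sum ?f (orb act G x)"
    proof (cases "x \<in> ?F")
      case True
      then have "orb act G x = {x}" using orb_self[OF act x] by (auto simp: orb_def)
      then show ?thesis using True by simp
    next
      case False
      show ?thesis
      proof (rule orb_fixed_sum_dvd[OF p act x G])
        show "\<exists>g\<in>G. act g x \<noteq> x" using False x by auto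
        show "?f (act g x) = ?f x" if "g \<in> G" for g
        proof -
          have "act g x \<notin> ?F"
          proof
            assume "act g x \<in> ?F"
            then have "act (- g) (act g x) = act g x"
              using subgrp_minus[OF acts_subgrp[OF act] that] by blast
            then have "act g x = x" using acts_inv1[OF act that x] by simp
            then show False using \<open>act g x \<in> ?F\<close> False by simp
          qed
          then show ?thesis using False by simp
        qed
      qed
    qed
  qed
  moreover have "sum ?f S = sum (\<lambda>x. 1) (S - ?F)"
    using S by (intro sum.mono_neutral_cong_right) auto
  moreover have F: "?F \<subseteq> S" by blast
  moreover have "card (S - ?F) = card S - card ?F"
    using S by (intro card_Diff_subset F finite_subset[OF F])
  ultimately have "p dvd card S - card ?F" "card ?F \<le> card S"
    using card_mono[OF S F] by (auto simp: of_nat_diff[symmetric] simp del: of_nat_diff)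
  then show ?thesis by (metis (no_types, lifting) mod_eq_dvd_iff_nat)
qed

lemmas group_simps = add.assoc diff_conv_add_uminus minus_add

lemma p_power_dvdE:
  fixes p :: nat
  assumes "Factorial_Ring.prime p" "k dvd p ^ a"
  obtains b where "k = p ^ b"
  using assms divides_primepow_nat by blast

lemma semidirect_add: "(v + q) + (w + r) = (v + (q + w - q)) + (q + r)"
  for v q w r :: "'a::group_add"
  by (simp add: group_simps del: add_uminus_conv_diff)

lemma subgrp_semidirect:
  assumes A: "subgrp A" and B: "subgrp B" and BA: "conj_stable B A"
  shows "subgrp {a + b |a b. a \<in> A \<and> b \<in> B}" (is "subgrp ?S")
proof (rule subgrpI)
  show "0 \<in> ?S" using subgrp_0[OF A] subgrp_0[OF B] by force
next
  fix x y assume "x \<in> ?S" "y \<in> ?S"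
  then obtain v q w r where *: "v \<in> A" "q \<in> B" "w \<in> A" "r \<in> B" "x = v + q" "y = w + r"
    by blast
  moreover have "v + (q + w - q) \<in> A" "q + r \<in> B"
    using * conj_stableD[OF BA] subgrp_add[OF A] subgrp_add[OF B] by auto
  ultimately show "x + y \<in> ?S" using semidirect_add[of v q w r] by blast
next
  fix x assume "x \<in> ?S"
  then obtain v q where vq: "v \<in> A" "q \<in> B" "x = v + q" by blast
  have "- x = (- q + - v - - q) + - q"
    using vq by (simp add: group_simps del: add_uminus_conv_diff)
  moreover have "- q \<in> B" "- q + - v - - q \<in> A"
    using vq subgrp_minus[OF A] conj_stableD[OF BA] subgrp_minus[OF B] by blast+
  ultimately show "- x \<in> ?S" by blast
qed

text \<open>\<open>Q\<close> has nontrivial fixed points on the quotient \<open>V/Y\<close>, so \<open>Y\<close> can be enlarged until it contains all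
  commutators.\<close>

lemma proper_subgrp_commutators:
  fixes p a b :: nat and V Q Y :: "'a::group_add set"
  assumes p: "Factorial_Ring.prime p" and V: "subgrp V" "finite V" "card V = p ^ b"
    and comm: "\<And>v w. v \<in> V \<Longrightarrow> w \<in> V \<Longrightarrow> v + w = w + v"
    and Q: "subgrp Q" "finite Q" "card Q = p ^ a" and QV: "conj_stable Q V"
  shows "\<lbrakk>subgrp Y; Y \<subset> V; conj_stable Q Y\<rbrakk> \<Longrightarrow>
    \<exists>Z. subgrp Z \<and> Y \<subseteq> Z \<and> Z \<subset> V \<and> (\<forall>q\<in>Q. \<forall>v\<in>V. v - (q + v - q) \<in> Z)"
proof (induction "card V - card Y" arbitrary: Y rule: less_induct)
  case less
  note Y = less.prems
  \<comment> \<open>The preimage of the fixed points of \<open>Q\<close> in \<open>V/Y\<close>. It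
    is \<open>V\<close> exactly when \<open>Y\<close> already contains all commutators; otherwise it
    is the next, larger candidate.\<close>
  define Z where "Z = {v \<in> V. \<forall>q\<in>Q. v - (q + v - q) \<in> Y}"
  have YV: "v \<in> V" if "v \<in> Y" for v using that Y by auto
  have qV: "q + v - q \<in> V" if "q \<in> Q" "v \<in> V" for q v using conj_stableD[OF QV that] .
  have finY: "finite Y" using Y V finite_subset by blast
  have Z: "subgrp Z"
  proof (rule subgrpI)
    show "0 \<in> Z" using V Y by (auto simp: Z_def subgrp_0)
  next
    fix v w assume vw: "v \<in> Z" "w \<in> Z"
    have "(v + w) - (q + (v + w) - q) \<in> Y" if q: "q \<in> Q" for q
    proof -
      let ?v = "q + v - q" and ?w = "q + w - q"
      have mem: "v \<in> V" "w \<in> V" "?v \<in> V" "?w \<in> V" using vw q qV by (auto simp: Z_def)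
      have "q + (v + w) - q = ?v + ?w" by (simp add: group_simps del: add_uminus_conv_diff)
      then have "(v + w) - (q + (v + w) - q) = v + (w - ?w) - ?v"
        by (simp add: group_simps del: add_uminus_conv_diff)
      also have "\<dots> = (w - ?w) + v - ?v" using comm[of v "w - ?w"] mem subgrp_diff[OF V(1)] by simp
      also have "\<dots> = (w - ?w) + (v - ?v)" by (simp add: group_simps del: add_uminus_conv_diff)
      finally show ?thesis using vw q subgrp_add[OF Y(1)] by (simp add: Z_def)
    qed
    then show "v + w \<in> Z" using vw V subgrp_add by (auto simp: Z_def)
  next
    fix v assume v: "v \<in> Z"
    have "- v - (q + - v - q) \<in> Y" if q: "q \<in> Q" for q
    proof -
      let ?v = "q + v - q"
      have mem: "v \<in> V" "?v \<in> V" "v - ?v \<in> Y" using v q qV by (auto simp: Z_def)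
      have "- v - (q + - v - q) = - v + ?v" by (simp add: group_simps del: add_uminus_conv_diff)
      also have "\<dots> = ?v + - v" using comm mem subgrp_minus[OF V(1)] by blast
      also have "\<dots> = - (v - ?v)" by simp
      finally show ?thesis by (metis mem(3) subgrp_minus[OF Y(1)])
    qed
    then show "- v \<in> Z" using v V subgrp_minus by (auto simp: Z_def)
  qed
  have YZ: "Y \<subseteq> Z"
    using Y YV conj_stableD[OF Y(3)] subgrp_diff[OF Y(1)] by (auto simp: Z_def)
  show ?case
  proof (cases "Z = V")
    case True
    then show ?thesis using Y by (intro exI[of _ Y]) (auto simp: Z_def)
  next
    case False
    have ZV: "Z \<subset> V" using False by (auto simp: Z_def)
    have Zst: "conj_stable Q Z"
    proof (rule conj_stableI)
      fix q v assume q: "q \<in> Q" and v: "v \<in> Z"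
      have "(q + v - q) - (r + (q + v - q) - r) \<in> Y" if r: "r \<in> Q" for r
      proof -
        let ?s = "- q + r + q"
        have "?s \<in> Q" using q r Q by (simp add: subgrp_add subgrp_minus)
        then have "v - (?s + v - ?s) \<in> Y" using v by (auto simp: Z_def)
        then have "q + (v - (?s + v - ?s)) - q \<in> Y" using conj_stableD[OF Y(3) q] by blast
        then show ?thesis by (simp add: group_simps del: add_uminus_conv_diff)
      qed
      then show "q + v - q \<in> Z" using qV q v by (auto simp: Z_def)
    qed
    have "Y \<noteq> Z"
    proof -
      \<comment> \<open>The number of cosets of \<open>Y\<close> is a power of \<open>p\<close>
        above 1, so the number of fixed cosets is divisible by \<open>p\<close>. Since
        \<open>Y\<close> is fixed, there is a second one, and its representatives lie in
        \<open>Z\<close> but not in \<open>Y\<close>.\<close>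
      define cos where "cos = (\<lambda>v. (+) v ` Y) ` V"
      define ac :: "'a \<Rightarrow> 'a set \<Rightarrow> 'a set" where "ac = (\<lambda>q S. (\<lambda>v. q + v - q) ` S)"
      have ac_coset: "ac q ((+) v ` Y) = (+) (q + v - q) ` Y" if q: "q \<in> Q" for q v
      proof (intro equalityI subsetI)
        fix z assume "z \<in> ac q ((+) v ` Y)"
        then obtain y where y: "y \<in> Y" "z = q + (v + y) - q" by (auto simp: ac_def)
        then have "z = (q + v - q) + (q + y - q)"
          by (simp add: group_simps del: add_uminus_conv_diff)
        then show "z \<in> (+) (q + v - q) ` Y" using conj_stableD[OF Y(3) q y(1)] by blast
      next
        fix z assume "z \<in> (+) (q + v - q) ` Y"
        then obtain y where y: "y \<in> Y" "z = (q + v - q) + y" by auto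
        have "z = q + (v + (- q + y + q)) - q" using y
          by (simp add: group_simps del: add_uminus_conv_diff)
        moreover have "- q + y + q \<in> Y" using conj_stableD'[OF Y(3) Q(1) q y(1)] .
        ultimately show "z \<in> ac q ((+) v ` Y)" unfolding ac_def by blast
      qed
      note coset_eq = coset_eq_iff[OF Y(1)]
      have act: "acts ac Q cos"
      proof (rule actsI)
        show "subgrp Q" by fact
        show "ac q S \<in> cos" if "q \<in> Q" "S \<in> cos" for q S
          using that ac_coset qV by (auto simp: cos_def)
        show "ac 0 S = S" for S by (simp add: ac_def)
        show "ac (q + r) S = ac q (ac r S)" for q r S
          by (simp add: ac_def image_image group_simps del: add_uminus_conv_diff)
      qed
      have fin: "finite cos" using V by (simp add: cos_def)
      have card: "card V = card cos * card Y"
        unfolding cos_def using Y(2) by (intro card_cosets[OF Y(1) V(1)] V(2)) blast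
      obtain c where c: "card cos = p ^ c"
        using card V(3) p_power_dvdE[OF p] by (metis dvd_triv_left)
      have "card Y < card V" using Y V psubset_card_mono by blast
      then have "c > 0" using card c by (cases c) auto
      then have "p dvd card cos" using c by simp
      then have "p dvd card {S \<in> cos. \<forall>q\<in>Q. ac q S = S}" (is "p dvd card ?F")
        using p_group_fixed_points[OF p act fin Q(2,3)] by (simp add: mod_eq_0_iff_dvd[symmetric])
      moreover have "Y \<in> ?F"
      proof -
        have "(+) 0 ` Y \<in> cos" using subgrp_0[OF V(1)] unfolding cos_def by blast
        moreover have "ac q ((+) 0 ` Y) = (+) 0 ` Y" if "q \<in> Q" for q
          using ac_coset[OF that, of 0] by simp
        ultimately show ?thesis by simp
      qed
      moreover have "finite ?F" using fin by simp
      moreover have "card {Y} < p" using p prime_gt_1_nat by simp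
      ultimately have "?F \<noteq> {Y}" by (metis dvd_imp_le not_less card_gt_0_iff insert_not_empty finite.emptyI finite_insert)
      then obtain S where S: "S \<in> ?F" "S \<noteq> Y" using \<open>Y \<in> ?F\<close> by blast
      then obtain v where v: "v \<in> V" "S = (+) v ` Y" by (auto simp: cos_def)
      have "v \<notin> Y" using S(2) v coset_eq[of v 0] by simp
      moreover have "v \<in> Z"
      proof -
        have "v - (q + v - q) \<in> Y" if q: "q \<in> Q" for q
        proof -
          have "(+) v ` Y = (+) (q + v - q) ` Y" using S(1) v ac_coset[OF q, of v] q by auto
          then have "- (q + v - q) + v \<in> Y" using coset_eq by blast
          moreover have "- (q + v - q) + v = v - (q + v - q)"
            using comm[OF subgrp_minus[OF V(1) qV[OF q v(1)]] v(1)]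
            by (simp only: diff_conv_add_uminus)
          ultimately show ?thesis by argo
        qed
        then show ?thesis using v by (simp add: Z_def)
      qed
      ultimately show ?thesis by blast
    qed
    then have "card Y < card Z" using YZ ZV V finite_subset psubset_card_mono by (metis psubsetI psubset_imp_subset)
    moreover have "card Z < card V" using ZV V psubset_card_mono by blast
    ultimately obtain T where "subgrp T" "Z \<subseteq> T" "T \<subset> V" "\<forall>q\<in>Q. \<forall>v\<in>V. v - (q + v - q) \<in> T"
      using less.hyps[OF _ Z ZV Zst] by (meson diff_less_mono2 order_less_trans)
    then show ?thesis using YZ by blast
  qed
qed

section \<open>Wreath products with a cyclic group of order \<open>p\<close>\<close>

text \<open>The group \<open>V\<close> is \<open>(\<int>/p)\<^sup>\<Omega>\<close> with coordinates \<open>co\<close> in \<open>{0..<p}\<close>. The assumption \<open>blocks\<close> says that \<open>H\<close>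
  permutes the orbits of every normal subgroup of \<open>Q\<close>, even of one that \<open>H\<close> does not normalise.\<close>

locale wreath =
  fixes p :: nat and V Q H :: "'a::group_add set" and \<Omega> :: "'b set"
    and act :: "'a \<Rightarrow> 'b \<Rightarrow> 'b" and co :: "'a \<Rightarrow> 'b \<Rightarrow> int" and base :: 'b
  assumes p: "Factorial_Ring.prime p"
    and V: "subgrp V" "finite V" "\<exists>b. card V = p ^ b"
    and Q: "subgrp Q" "finite Q" "\<exists>a. card Q = p ^ a"
    and H: "subgrp H" "finite H" "coprime (card H) p"
    and V_comm: "v \<in> V \<Longrightarrow> w \<in> V \<Longrightarrow> v + w = w + v"
    and QV: "conj_stable Q V" and HV: "conj_stable H V" and HQ: "conj_stable H Q"
    and VQ: "V \<inter> Q = {0}"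
    and \<Omega>: "finite \<Omega>" "base \<in> \<Omega>"
    and actQ: "acts act Q \<Omega>" and actH: "acts act H \<Omega>"
    and actHQ: "h \<in> H \<Longrightarrow> q \<in> Q \<Longrightarrow> x \<in> \<Omega> \<Longrightarrow> act h (act q x) = act (h + q - h) (act h x)"
    and trans: "x \<in> \<Omega> \<Longrightarrow> y \<in> \<Omega> \<Longrightarrow> \<exists>q\<in>Q. act q x = y"
    and faithful: "q \<in> Q \<Longrightarrow> (\<And>x. x \<in> \<Omega> \<Longrightarrow> act q x = x) \<Longrightarrow> q = 0"
    and base: "h \<in> H \<Longrightarrow> act h base = base"
    and blocks: "subgrp B \<Longrightarrow> B \<subseteq> Q \<Longrightarrow> conj_stable Q B \<Longrightarrow> x \<in> \<Omega> \<Longrightarrow> y \<in> orb act B x \<Longrightarrow>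
      h \<in> H \<Longrightarrow> act h y \<in> orb act B (act h x)"
    and co_add: "v \<in> V \<Longrightarrow> w \<in> V \<Longrightarrow> x \<in> \<Omega> \<Longrightarrow> co (v + w) x = (co v x + co w x) mod int p"
    and co_ex: "\<exists>v\<in>V. \<forall>x\<in>\<Omega>. co v x = f x mod int p"
    and co_inj: "v \<in> V \<Longrightarrow> (\<And>x. x \<in> \<Omega> \<Longrightarrow> co v x = 0) \<Longrightarrow> v = 0"
    and co_Q: "q \<in> Q \<Longrightarrow> v \<in> V \<Longrightarrow> x \<in> \<Omega> \<Longrightarrow> co (q + v - q) (act q x) = co v x"
    and co_H: "h \<in> H \<Longrightarrow> \<exists>a. \<forall>v\<in>V. \<forall>x\<in>\<Omega>. co (h + v - h) (act h x) = a * co v x mod int p"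
begin

section \<open>Coordinates and their sums over orbits\<close>

abbreviation "pp \<equiv> int p"

lemma p_gt_1: "p > 1"
  using p prime_gt_1_nat by blast

lemma co_0: "x \<in> \<Omega> \<Longrightarrow> co 0 x = 0"
proof -
  assume x: "x \<in> \<Omega>"
  have eq: "co 0 x = (co 0 x + co 0 x) mod pp"
    using co_add[OF subgrp_0 subgrp_0 x] V(1) by simp
  then have "co 0 x mod pp = (co 0 x + co 0 x) mod pp" by (metis mod_mod_trivial)
  then have "pp dvd co 0 x" by (simp add: mod_eq_dvd_iff)
  then show ?thesis using eq by (metis dvd_add mod_0_imp_dvd dvd_imp_mod_0)
qed

lemma co_mod: "v \<in> V \<Longrightarrow> x \<in> \<Omega> \<Longrightarrow> co v x mod pp = co v x"
  using co_add[of v 0 x] co_0[of x] subgrp_0[OF V(1)] by (metis add.right_neutral mod_mod_trivial)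

lemma co_minus:
  assumes "v \<in> V" "x \<in> \<Omega>" shows "co (- v) x = (- co v x) mod pp"
proof -
  have m: "- v \<in> V" using assms V subgrp_minus by blast
  have "0 = (co v x + co (- v) x) mod pp" using co_add[OF assms(1) m assms(2)] co_0 assms by simp
  then have "co (- v) x mod pp = (- co v x) mod pp"
    by (metis add.commute add.left_neutral add_diff_cancel_right' diff_0 mod_diff_left_eq uminus_add_conv_diff mod_add_left_eq)
  then show ?thesis using co_mod[OF m assms(2)] by simp
qed

lemma co_diff:
  assumes "v \<in> V" "w \<in> V" "x \<in> \<Omega>" shows "co (v - w) x = (co v x - co w x) mod pp"
proof -
  have "co (v + - w) x = (co v x + (- co w x) mod pp) mod pp"
    using co_add[of v "- w" x] assms subgrp_minus[OF V(1)] co_minus by simp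
  then show ?thesis by (simp add: mod_simps)
qed

lemma co_eq: 
  assumes "v \<in> V" "w \<in> V" "\<And>x. x \<in> \<Omega> \<Longrightarrow> co v x = co w x" shows "v = w"
proof -
  have "v - w = 0" using assms co_diff subgrp_diff[OF V(1)] by (intro co_inj) auto
  then show ?thesis by simp
qed

definition tot :: "'b set \<Rightarrow> 'a \<Rightarrow> int" where
  "tot B v = (\<Sum>x\<in>B. co v x) mod pp"

lemma tot_add:
  assumes "v \<in> V" "w \<in> V" "B \<subseteq> \<Omega>" shows "tot B (v + w) = (tot B v + tot B w) mod pp"
proof -
  have "tot B (v + w) = (\<Sum>x\<in>B. (co v x + co w x) mod pp) mod pp"
    unfolding tot_def using assms co_add by (intro arg_cong[of _ _ "\<lambda>x. x mod pp"] sum.cong) auto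
  then show ?thesis by (simp add: mod_sum_eq sum.distrib tot_def mod_simps)
qed

lemma tot_diff:
  assumes "v \<in> V" "w \<in> V" "B \<subseteq> \<Omega>" shows "tot B (v - w) = (tot B v - tot B w) mod pp"
proof -
  have "tot B (v - w) = (\<Sum>x\<in>B. (co v x - co w x) mod pp) mod pp"
    unfolding tot_def using assms co_diff by (intro arg_cong[of _ _ "\<lambda>x. x mod pp"] sum.cong) auto
  then show ?thesis by (simp add: mod_sum_eq sum_subtractf tot_def mod_simps)
qed

lemma tot_0: "B \<subseteq> \<Omega> \<Longrightarrow> tot B 0 = 0"
  using co_0 by (simp add: tot_def subset_iff)

lemma tot_minus: "v \<in> V \<Longrightarrow> B \<subseteq> \<Omega> \<Longrightarrow> tot B (- v) = (- tot B v) mod pp"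
  using tot_diff[of 0 v B] tot_0 subgrp_0[OF V(1)] by simp

lemma act_bij: "q \<in> Q \<Longrightarrow> bij_betw (act q) \<Omega> \<Omega>"
  using acts_in[OF actQ] acts_inv1[OF actQ] acts_inv2[OF actQ] subgrp_minus[OF Q(1)]
  by (intro bij_betwI[where g = "act (- q)"]) auto

lemma tot_conj:
  assumes "q \<in> Q" "v \<in> V" "B \<subseteq> \<Omega>" shows "tot (act q ` B) (q + v - q) = tot B v"
proof -
  have "inj_on (act q) B" using act_bij[OF assms(1)] assms(3) inj_on_subset by (auto simp: bij_betw_def)
  then have "(\<Sum>x\<in>act q ` B. co (q + v - q) x) = (\<Sum>x\<in>B. co (q + v - q) (act q x))"
    by (simp add: sum.reindex)
  also have "\<dots> = (\<Sum>x\<in>B. co v x)" using assms co_Q by (intro sum.cong) auto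
  finally show ?thesis by (simp add: tot_def)
qed

lemma conjV: "q \<in> Q \<Longrightarrow> v \<in> V \<Longrightarrow> q + v - q \<in> V"
  using QV conj_stableD by blast

lemma V_diff: "v \<in> V \<Longrightarrow> w \<in> V \<Longrightarrow> v - w \<in> V"
  and V_add: "v \<in> V \<Longrightarrow> w \<in> V \<Longrightarrow> v + w \<in> V"
  and V_minus: "v \<in> V \<Longrightarrow> - v \<in> V"
  and V_0: "0 \<in> V"
  using V(1) by (auto simp: subgrp_diff subgrp_add subgrp_minus subgrp_0)

text \<open>This is the commutator subgroup \<open>[V, B]\<close>: it contains the commutators by
  \<open>zero_sum_comm\<close>, and they generate it by \<open>zero_sum_generated\<close>.\<close>

definition zero_sum :: "'a set \<Rightarrow> 'a set" where
  "zero_sum B = {v \<in> V. \<forall>x\<in>\<Omega>. tot (orb act B x) v = 0}"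

lemma act_subset: "subgrp B \<Longrightarrow> B \<subseteq> Q \<Longrightarrow> acts act B \<Omega>"
  using actQ acts_subset by blast

lemma act_orb_self:
  assumes B: "subgrp B" "B \<subseteq> Q" and m: "m \<in> B" and x: "x \<in> \<Omega>"
  shows "act m ` orb act B x = orb act B x"
proof -
  note actB = act_subset[OF B]
  have "act m y \<in> orb act B x" if "y \<in> orb act B x" for y
    using orb_trans[OF actB x that] m by (auto simp: orb_def)
  moreover have "y \<in> act m ` orb act B x" if y: "y \<in> orb act B x" for y
  proof -
    have "act (- m) y \<in> orb act B x"
      using orb_trans[OF actB x y] subgrp_minus[OF B(1) m] by (auto simp: orb_def)
    moreover have "y = act m (act (- m) y)"
      using acts_inv2[OF actB m] orb_subset[OF actB x] y by auto
    ultimately show ?thesis by blast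
  qed
  ultimately show ?thesis by blast
qed

lemma zero_sum_subgrp:
  assumes B: "subgrp B" "B \<subseteq> Q" shows "subgrp (zero_sum B)"
proof (rule subgrpI)
  note o = orb_subset[OF act_subset[OF B]]
  show "0 \<in> zero_sum B" using V_0 tot_0[OF o] by (auto simp: zero_sum_def)
  show "v + w \<in> zero_sum B" if "v \<in> zero_sum B" "w \<in> zero_sum B" for v w
    using that V_add tot_add[OF _ _ o] by (auto simp: zero_sum_def)
  show "- v \<in> zero_sum B" if "v \<in> zero_sum B" for v
    using that V_minus tot_minus[OF _ o] by (auto simp: zero_sum_def)
qed

lemma zero_sum_comm:
  assumes B: "subgrp B" "B \<subseteq> Q" and "m \<in> B" "v \<in> V"
  shows "v - (m + v - m) \<in> zero_sum B"
proof -
  have mQ: "m \<in> Q" using assms by blast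
  have "tot (orb act B x) (v - (m + v - m)) = 0" if x: "x \<in> \<Omega>" for x
  proof -
    have o: "orb act B x \<subseteq> \<Omega>" using orb_subset[OF act_subset[OF B]] x .
    have "tot (orb act B x) (m + v - m) = tot (orb act B x) v"
      using tot_conj[OF mQ assms(4) o] act_orb_self[OF B assms(3) x] by simp
    then show ?thesis using tot_diff[OF assms(4) conjV[OF mQ assms(4)] o] by simp
  qed
  then show ?thesis using V_diff conjV[OF mQ] assms by (simp add: zero_sum_def)
qed

lemma delta_ex:
  assumes "x \<in> \<Omega>"
  obtains v where "v \<in> V" "\<And>y. y \<in> \<Omega> \<Longrightarrow> co v y = (if y = x then a mod pp else 0)"
proof -
  obtain v where "v \<in> V" "\<forall>y\<in>\<Omega>. co v y = (if y = x then a else 0) mod pp"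
    using co_ex[of "\<lambda>y. if y = x then a else 0"] by blast
  then show thesis using that[of v] by auto
qed

text \<open>Modulo commutators with \<open>B\<close>, a nonzero coordinate can be moved within its \<open>B\<close>-orbit, which lowers the
  number of nonzero coordinates.\<close>

lemma zero_sum_generated:
  assumes Y: "subgrp Y" and B: "subgrp B" "B \<subseteq> Q"
    and comm: "\<And>m v. m \<in> B \<Longrightarrow> v \<in> V \<Longrightarrow> v - (m + v - m) \<in> Y"
  shows "v \<in> zero_sum B \<Longrightarrow> v \<in> Y"
proof (induction "card {x \<in> \<Omega>. co v x \<noteq> 0}" arbitrary: v rule: less_induct)
  case less
  note actB = act_subset[OF B]
  have v: "v \<in> V" using less.prems by (simp add: zero_sum_def)
  show ?case
  proof (cases "\<forall>x\<in>\<Omega>. co v x = 0")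
    case True
    then show ?thesis using co_inj v subgrp_0[OF Y] by metis
  next
    case False
    then obtain x where x: "x \<in> \<Omega>" "co v x \<noteq> 0" by blast
    let ?O = "orb act B x"
    have O: "?O \<subseteq> \<Omega>" "finite ?O" "x \<in> ?O"
      using orb_subset[OF actB x(1)] finite_subset \<Omega>(1) orb_self[OF actB x(1)] by blast+
    have "\<exists>y\<in>?O. y \<noteq> x \<and> co v y \<noteq> 0"
    proof (rule ccontr)
      assume "\<not> ?thesis"
      then have "(\<Sum>y\<in>?O. co v y) = (\<Sum>y\<in>{x}. co v y)"
        using O by (intro sum.mono_neutral_right) auto
      then have "tot ?O v = co v x" using co_mod[OF v x(1)] by (simp add: tot_def)
      then show False using less.prems x by (auto simp: zero_sum_def)
    qed
    then obtain m where m: "m \<in> B" "act m x \<noteq> x" "co v (act m x) \<noteq> 0" by (auto simp: orb_def)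
    then have mQ: "m \<in> Q" using B by blast
    \<comment> \<open>Subtracting \<open>d - (m + d - m)\<close> carries the coordinate at
      \<open>x\<close> over to \<open>act m x\<close>. That point is in the support already, so no
      new nonzero coordinate appears while the one at \<open>x\<close> disappears.\<close>
    obtain d where d: "d \<in> V" "\<And>y. y \<in> \<Omega> \<Longrightarrow> co d y = (if y = x then co v x mod pp else 0)"
      using delta_ex[OF x(1), of "co v x"] by blast
    let ?d = "m + d - m"
    have d': "?d \<in> V" using conjV mQ d by blast
    have cod': "co ?d y = 0" if "y \<in> \<Omega>" "y \<noteq> act m x" for y
    proof -
      let ?y = "act (- m) y"
      have "?y \<in> \<Omega>" "act m ?y = y"
        using acts_in[OF actQ subgrp_minus[OF Q(1) mQ] that(1)] acts_inv2[OF actQ mQ that(1)] by auto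
      then show ?thesis using co_Q[OF mQ d(1), of ?y] d(2)[of ?y] that(2) by auto
    qed
    have dY: "d - ?d \<in> Y" "d - ?d \<in> zero_sum B" "d - ?d \<in> V"
      using comm[OF m(1) d(1)] zero_sum_comm[OF B m(1) d(1)] V_diff[OF d(1) d'] by auto
    let ?v = "v - (d - ?d)"
    have co: "co ?v y = (co v y - (co d y - co ?d y)) mod pp" if "y \<in> \<Omega>" for y
      using co_diff[OF v dY(3) that] co_diff[OF d(1) d' that] by (simp add: mod_simps)
    have "{y \<in> \<Omega>. co ?v y \<noteq> 0} \<subset> {y \<in> \<Omega>. co v y \<noteq> 0}"
    proof
      show "{y \<in> \<Omega>. co ?v y \<noteq> 0} \<subseteq> {y \<in> \<Omega>. co v y \<noteq> 0}"
      proof -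
        have "co ?v y = 0" if "y \<in> \<Omega>" "co v y = 0" for y
        proof -
          have "y \<noteq> x" "y \<noteq> act m x" using that x m(3) by auto
          then show ?thesis using co[OF that(1)] d(2)[OF that(1)] cod'[OF that(1)] that(2) by simp
        qed
        then show ?thesis by blast
      qed
      have "co ?v x = 0" using co[OF x(1)] d(2)[OF x(1)] cod'[OF x(1)] m(2)
        by (auto simp: mod_simps)
      then show "{y \<in> \<Omega>. co ?v y \<noteq> 0} \<noteq> {y \<in> \<Omega>. co v y \<noteq> 0}" using x by blast
    qed
    then have "card {y \<in> \<Omega>. co ?v y \<noteq> 0} < card {y \<in> \<Omega>. co v y \<noteq> 0}"
      using \<Omega>(1) by (intro psubset_card_mono) auto
    moreover have "?v \<in> zero_sum B"
      using subgrp_diff[OF zero_sum_subgrp[OF B] less.prems dY(2)] .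
    ultimately have "?v \<in> Y" using less.hyps by blast
    then have "?v + (d - ?d) \<in> Y" using subgrp_add[OF Y _ dY(1)] by blast
    then show ?thesis by (simp only: diff_add_cancel)
  qed
qed

lemma orb_Q: "x \<in> \<Omega> \<Longrightarrow> orb act Q x = \<Omega>"
  using trans acts_in[OF actQ] by (fastforce simp: orb_def)

text \<open>A proper invariant subgroup lies in a proper \<open>Z\<close> that contains all
  commutators with \<open>Q\<close>, hence all functions with sum zero, as \<open>Q\<close> is
  transitive. Together with one function of nonzero sum these generate \<open>V\<close>. In module
  terms, the sum-zero functions are the radical of the permutation module.\<close>

lemma invariant_subgrp_full:
  assumes Y: "subgrp Y" "Y \<subseteq> V" "conj_stable Q Y" and v: "v \<in> Y" "tot \<Omega> v \<noteq> 0"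
  shows "Y = V"
proof (rule ccontr)
  assume "Y \<noteq> V"
  then have "Y \<subset> V" using Y by blast
  then obtain Z where Z: "subgrp Z" "Y \<subseteq> Z" "Z \<subset> V" "\<forall>q\<in>Q. \<forall>v\<in>V. v - (q + v - q) \<in> Z"
    using proper_subgrp_commutators[OF p V(1,2) _ V_comm Q(1,2) _ QV Y(1) _ Y(3)] V(3) Q(3) by metis
  have zs: "zero_sum Q \<subseteq> Z"
    using zero_sum_generated[OF Z(1) Q(1) subset_refl] Z(4) by blast
  have "w \<in> Z" if w: "w \<in> V" for w
  proof -
    have "coprime (tot \<Omega> v) pp"
    proof -
      have "\<not> pp dvd tot \<Omega> v" using v(2) by (auto simp: tot_def dvd_eq_mod_eq_0)
      moreover have "Factorial_Ring.prime pp" using p by simp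
      ultimately have "coprime pp (tot \<Omega> v)" using prime_imp_coprime by blast
      then show ?thesis by (rule coprime_imp_coprime) auto
    qed
    then obtain t :: int where t: "(t * tot \<Omega> v) mod pp = 1 mod pp"
    proof -
      obtain u s where us: "u * tot \<Omega> v + s * pp = 1"
        using bezout_int[of "tot \<Omega> v" pp] \<open>coprime (tot \<Omega> v) pp\<close> by auto
      have "(u * tot \<Omega> v) mod pp = (u * tot \<Omega> v + s * pp) mod pp" by simp
      then show ?thesis using us that by auto
    qed
    \<comment> \<open>\<open>k\<close> represents the quotient of the two sums modulo
      \<open>p\<close>, so that the \<open>k\<close>-fold multiple of \<open>v\<close> has the sum
      of \<open>w\<close>. It is natural because multiples are built by repeated addition.\<close>
    define k where "k = nat ((t * tot \<Omega> w) mod pp)"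
    have k: "int k = (t * tot \<Omega> w) mod pp" unfolding k_def using p_gt_1 by simp
    have mult: "\<exists>u\<in>Y. tot \<Omega> u = (int n * tot \<Omega> v) mod pp" for n
    proof (induction n)
      case 0
      then show ?case using subgrp_0[OF Y(1)] tot_0 by force
    next
      case (Suc n)
      then obtain u where u: "u \<in> Y" "tot \<Omega> u = (int n * tot \<Omega> v) mod pp" by blast
      have "tot \<Omega> (u + v) = (int (Suc n) * tot \<Omega> v) mod pp"
        using tot_add[of u v \<Omega>] u v Y by (auto simp: mod_simps algebra_simps)
      then show ?case using subgrp_add[OF Y(1) u(1) v(1)] by blast
    qed
    obtain u where u: "u \<in> Y" "tot \<Omega> u = (int k * tot \<Omega> v) mod pp" using mult by blast
    have "tot \<Omega> u = (t * tot \<Omega> v * tot \<Omega> w) mod pp"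
      unfolding u(2) k by (simp add: mod_simps ac_simps)
    also have "\<dots> = (1 * tot \<Omega> w) mod pp" using t by (metis mod_mult_left_eq)
    finally have "tot \<Omega> u = tot \<Omega> w" by (simp add: tot_def)
    then have "tot \<Omega> (w - u) = 0" using tot_diff[of w u \<Omega>] w u(1) Y by auto
    then have "w - u \<in> zero_sum Q"
      using V_diff w u(1) Y by (auto simp: zero_sum_def orb_Q)
    then have "(w - u) + u \<in> Z" using zs u(1) Z subgrp_add[OF Z(1)] by blast
    then show ?thesis by (simp only: diff_add_cancel)
  qed
  then show False using Z by blast
qed

section \<open>The product of \<open>V\<close> and \<open>Q\<close> with its two projections\<close>

definition P :: "'a set" where "P = {v + q |v q. v \<in> V \<and> q \<in> Q}"

definition pi :: "'a \<Rightarrow> 'a" where "pi g = (THE q. q \<in> Q \<and> g - q \<in> V)"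

text \<open>The component in \<open>V\<close> is a crossed homomorphism for the action through
  \<open>pi\<close> (\<open>al_add\<close>). On elements over \<open>M\<close> it becomes additive
  once commutators with \<open>M\<close> are factored out.\<close>

definition al :: "'a \<Rightarrow> 'a" where "al g = g - pi g"

lemma pi_eq: "v \<in> V \<Longrightarrow> q \<in> Q \<Longrightarrow> pi (v + q) = q"
  unfolding pi_def
proof (rule the_equality)
  fix r assume vq: "v \<in> V" "q \<in> Q" and r: "r \<in> Q \<and> v + q - r \<in> V"
  have "- v + (v + q - r) \<in> V" using vq r V_add V_minus by blast
  then have "q - r \<in> V" by (simp add: group_simps del: add_uminus_conv_diff)
  then have "q - r = 0" using vq r subgrp_diff[OF Q(1)] VQ by blast
  then show "r = q" by simp
qed auto

lemma al_eq: "v \<in> V \<Longrightarrow> q \<in> Q \<Longrightarrow> al (v + q) = v"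
  by (simp add: al_def pi_eq)

lemma P_cases:
  assumes "g \<in> P" shows pi_Q: "pi g \<in> Q" and al_V: "al g \<in> V" and al_pi: "g = al g + pi g"
  using assms by (auto simp: P_def pi_eq al_eq)

lemma V_P: "v \<in> V \<Longrightarrow> v \<in> P" and Q_P: "q \<in> Q \<Longrightarrow> q \<in> P"
proof -
  show "v \<in> P" if "v \<in> V" unfolding P_def using that subgrp_0[OF Q(1)] by force
  show "q \<in> P" if "q \<in> Q" unfolding P_def using that V_0 by force
qed

lemma pi_V: "v \<in> V \<Longrightarrow> pi v = 0" and pi_Q_id: "q \<in> Q \<Longrightarrow> pi q = q"
  using pi_eq[of v 0] pi_eq[of 0 q] subgrp_0[OF Q(1)] V_0 by simp_all

lemma subgrp_P: "subgrp P"
  unfolding P_def by (rule subgrp_semidirect[OF V(1) Q(1) QV])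

lemma pi_add: "g \<in> P \<Longrightarrow> h \<in> P \<Longrightarrow> pi (g + h) = pi g + pi h"
  and al_add: "g \<in> P \<Longrightarrow> h \<in> P \<Longrightarrow> al (g + h) = al g + (pi g + al h - pi g)"
proof -
  assume gh: "g \<in> P" "h \<in> P"
  have eq: "g + h = (al g + (pi g + al h - pi g)) + (pi g + pi h)"
    using semidirect_add[of "al g" "pi g" "al h" "pi h"] al_pi gh by simp
  have mem: "al g + (pi g + al h - pi g) \<in> V" "pi g + pi h \<in> Q"
    using gh P_cases V_add conjV subgrp_add[OF Q(1)] by auto
  show "pi (g + h) = pi g + pi h" "al (g + h) = al g + (pi g + al h - pi g)"
    using pi_eq[OF mem] al_eq[OF mem] eq by auto
qed

lemma pi_0: "pi 0 = 0" and al_0: "al 0 = 0"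
  using pi_V[OF V_0] by (simp_all add: al_def)

lemma P_minus: "g \<in> P \<Longrightarrow> - g \<in> P" and P_add: "g \<in> P \<Longrightarrow> h \<in> P \<Longrightarrow> g + h \<in> P"
  and P_diff: "g \<in> P \<Longrightarrow> h \<in> P \<Longrightarrow> g - h \<in> P"
  using subgrp_P by (auto intro: subgrp_add subgrp_minus subgrp_diff)

lemma pi_minus: "g \<in> P \<Longrightarrow> pi (- g) = - pi g"
  using pi_add[of g "- g"] P_minus pi_0 by (metis add.right_inverse minus_unique)

lemma pi_diff: "g \<in> P \<Longrightarrow> h \<in> P \<Longrightarrow> pi (g - h) = pi g - pi h"
  using pi_add[of g "- h"] P_minus pi_minus by simp

lemma finite_P: "finite P" and card_P: "card P = card V * card Q"
proof -
  have P: "P = (\<lambda>(a, b). a + b) ` (V \<times> Q)" by (auto simp: P_def)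
  show "finite P" using V Q by (simp add: P)
  show "card P = card V * card Q" using card_set_plus[OF V(1) Q(1) V(2) Q(2)] VQ by (simp add: P)
qed

end

section \<open>A normal subgroup with a complement\<close>

locale wreath_complement = wreath +
  fixes N C :: "'a set"
  assumes N: "subgrp N" "N \<subseteq> P" "conj_stable P N"
    and C: "complements P N C"
begin

lemma C_subgrp: "subgrp C" and C_P: "c \<in> C \<Longrightarrow> c \<in> P" and N_P: "n \<in> N \<Longrightarrow> n \<in> P"
  and NC: "x \<in> N \<Longrightarrow> x \<in> C \<Longrightarrow> x = 0"
  using C N by (auto simp: complements_def)

lemma finite_N: "finite N" and finite_C: "finite C"
  using N C finite_subset[OF _ finite_P] by (auto simp: complements_def)

lemma C_closed: "c \<in> C \<Longrightarrow> d \<in> C \<Longrightarrow> c + d \<in> C" "c \<in> C \<Longrightarrow> - c \<in> C" "0 \<in> C"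
  "c \<in> C \<Longrightarrow> d \<in> C \<Longrightarrow> c - d \<in> C"
  using C_subgrp by (auto intro: subgrp_add subgrp_minus subgrp_0 subgrp_diff)

lemma N_closed: "c \<in> N \<Longrightarrow> d \<in> N \<Longrightarrow> c + d \<in> N" "c \<in> N \<Longrightarrow> - c \<in> N" "0 \<in> N"
  "c \<in> N \<Longrightarrow> d \<in> N \<Longrightarrow> c - d \<in> N" "g \<in> P \<Longrightarrow> c \<in> N \<Longrightarrow> g + c - g \<in> N"
  using N by (auto intro: subgrp_add subgrp_minus subgrp_0 subgrp_diff conj_stableD)

lemma subgrp_pi: "subgrp A \<Longrightarrow> A \<subseteq> P \<Longrightarrow> subgrp (pi ` A)"
  using pi_add by (intro subgrp_image) auto

text \<open>Orders decide everything. \<open>CV\<close> makes \<open>pi\<close> injective on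
  \<open>C\<close>, and comparing the product of \<open>N\<close> and \<open>Q\<close> with
  \<open>P\<close> gives \<open>card Q \<le> card (N \<inter> Q) * card C\<close>. By
  \<open>CQ\<close> the intersection is trivial, so equality holds, whence
  \<open>card N = card V * card (N \<inter> Q)\<close>. A complement of \<open>N \<inter> Q\<close>
  in \<open>Q\<close> therefore has exactly the order of a complement of \<open>N\<close> in
  \<open>P\<close>.\<close>

lemma
  assumes CV: "\<And>c. c \<in> C \<Longrightarrow> c \<in> V \<Longrightarrow> c = 0" and CQ: "\<And>c. c \<in> C \<Longrightarrow> pi c \<in> N \<Longrightarrow> c = 0"
  shows complements_pi: "complements Q (N \<inter> Q) (pi ` C)"
    and complements_lift: "complements Q (N \<inter> Q) C' \<Longrightarrow> complements P N C'"
proof -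
  have inj: "inj_on pi C"
  proof (rule inj_onI)
    fix c d assume cd: "c \<in> C" "d \<in> C" "pi c = pi d"
    then have "pi (c - d) = 0" using pi_diff C_P by simp
    then have "c - d \<in> V" using al_V[of "c - d"] al_pi[of "c - d"] cd C_P P_diff by (metis add.right_neutral)
    then have "c - d = 0" using CV C_closed(4) cd by blast
    then show "c = d" by simp
  qed
  have NQ: "subgrp (N \<inter> Q)" "N \<inter> Q \<subseteq> Q" "finite (N \<inter> Q)"
    using subgrp_Int N Q finite_N by auto
  have "card N * card Q = card ((\<lambda>(a, b). a + b) ` (N \<times> Q)) * card (N \<inter> Q)"
    by (rule card_set_plus[OF N(1) Q(1) finite_N Q(2)])
  also have "\<dots> \<le> card P * card (N \<inter> Q)"
    using N_P Q_P P_add by (intro mult_right_mono card_mono finite_P) auto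
  also have cP: "card P = card N * card C"
    using card_complements[OF C N(1,2) subgrp_P finite_P] by simp
  finally have "card Q \<le> card C * card (N \<inter> Q)"
    using finite_N N_closed(3) by (simp add: card_gt_0_iff) (metis equals0D)
  then have le: "card Q \<le> card (N \<inter> Q) * card (pi ` C)"
    using inj by (simp add: card_image mult.commute)
  show comp: "complements Q (N \<inter> Q) (pi ` C)"
  proof (rule complements_by_card)
    show "subgrp (pi ` C)" using subgrp_pi C_subgrp C_P by blast
    show "pi ` C \<subseteq> Q" using pi_Q C_P by blast
    show "(N \<inter> Q) \<inter> pi ` C = {0}"
      using CQ pi_0 N_closed(3) C_closed(3) subgrp_0[OF Q(1)] by (auto simp: image_iff)
  qed (use NQ Q le in auto)
  have "card (N \<inter> Q) * card C = card Q"
    using card_complements[OF comp NQ(1,2) Q(1,2)] inj by (simp add: card_image)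
  moreover have "card N * card C = card V * card Q" using cP card_P by simp
  ultimately have "card N * card C = card V * card (N \<inter> Q) * card C" by (simp add: mult.assoc)
  moreover have "card C > 0" using finite_C C_closed(3) card_gt_0_iff by blast
  ultimately have cN: "card N = card V * card (N \<inter> Q)" by simp
  show "complements P N C'" if C': "complements Q (N \<inter> Q) C'"
  proof (rule complements_by_card)
    show "subgrp C'" using C' complements_subgrp by blast
    show "C' \<subseteq> P" using C' complements_subset Q_P by blast
    show "N \<inter> C' = {0}" using C' complements_subset[OF C'] by (auto simp: complements_def)
    show "card P \<le> card N * card C'"
      using card_complements[OF C' NQ(1,2) Q(1,2)] cN card_P by (simp add: mult.assoc)
  qed (use N subgrp_P finite_P in auto)
qed

definition "K = N \<inter> V"
definition "M = pi ` N"
definition "D = {c \<in> C. pi c \<in> M}"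

lemma M: "subgrp M" "M \<subseteq> Q" "conj_stable Q M"
proof -
  show "subgrp M" "M \<subseteq> Q" unfolding M_def using subgrp_pi N N_P pi_Q by auto
  show "conj_stable Q M"
  proof (rule conj_stableI)
    fix q m assume "q \<in> Q" "m \<in> M"
    then obtain n where n: "n \<in> N" "m = pi n" by (auto simp: M_def)
    then have "q + m - q = pi (q + n - q)"
      using \<open>q \<in> Q\<close> Q_P N_P pi_diff pi_add pi_Q_id P_add by simp
    then show "q + m - q \<in> M" using N_closed(5) Q_P n \<open>q \<in> Q\<close> unfolding M_def by blast
  qed
qed

lemma M_closed: "c \<in> M \<Longrightarrow> d \<in> M \<Longrightarrow> c + d \<in> M" "c \<in> M \<Longrightarrow> - c \<in> M" "0 \<in> M"
  "c \<in> M \<Longrightarrow> d \<in> M \<Longrightarrow> c - d \<in> M" "q \<in> Q \<Longrightarrow> c \<in> M \<Longrightarrow> q + c - q \<in> M" "c \<in> M \<Longrightarrow> c \<in> Q"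
  using M by (auto intro: subgrp_add subgrp_minus subgrp_0 subgrp_diff conj_stableD)

lemma K: "subgrp K" "K \<subseteq> V"
  using subgrp_Int N V by (auto simp: K_def)

lemma K_closed: "c \<in> K \<Longrightarrow> d \<in> K \<Longrightarrow> c + d \<in> K" "c \<in> K \<Longrightarrow> - c \<in> K" "0 \<in> K"
  "c \<in> K \<Longrightarrow> d \<in> K \<Longrightarrow> c - d \<in> K" "q \<in> Q \<Longrightarrow> c \<in> K \<Longrightarrow> q + c - q \<in> K" "c \<in> K \<Longrightarrow> c \<in> V"
  "c \<in> K \<Longrightarrow> c \<in> N"
  using K N_closed(5) Q_P conjV
  by (auto intro: subgrp_add[OF K(1)] subgrp_minus[OF K(1)] subgrp_0[OF K(1)] subgrp_diff[OF K(1)])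
    (auto simp: K_def)

lemma D: "subgrp D"
  unfolding D_def
  using C_closed M_closed pi_add pi_minus C_P pi_0 by (intro subgrpI) auto

lemma D_C: "d \<in> D \<Longrightarrow> d \<in> C" and D_M: "d \<in> D \<Longrightarrow> pi d \<in> M" and D_P: "d \<in> D \<Longrightarrow> d \<in> P"
  by (auto simp: D_def C_P)

lemma finite_D: "finite D"
  using finite_C by (auto simp: D_def)

lemma D_closed: "c \<in> D \<Longrightarrow> d \<in> D \<Longrightarrow> c + d \<in> D" "c \<in> D \<Longrightarrow> - c \<in> D" "0 \<in> D"
  "c \<in> D \<Longrightarrow> d \<in> D \<Longrightarrow> c - d \<in> D"
  by (blast intro: subgrp_add[OF D] subgrp_minus[OF D] subgrp_0[OF D] subgrp_diff[OF D])+

lemma D_conj: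
  assumes "c \<in> C" "d \<in> D" shows "c + d - c \<in> D" "pi (c + d - c) = pi c + pi d - pi c"
proof -
  show eq: "pi (c + d - c) = pi c + pi d - pi c"
    using assms C_P D_P pi_diff pi_add P_add by simp
  show "c + d - c \<in> D"
    unfolding D_def mem_Collect_eq eq
    by (intro conjI C_closed(1,4) M_closed(5) pi_Q C_P D_C D_M assms)
qed

text \<open>The commutator of \<open>v\<close> with an element of \<open>N\<close> over
  \<open>m\<close> lies in \<open>N\<close>. As \<open>V\<close> is abelian, the
  \<open>V\<close>-component of that element cancels, which leaves the commutator with
  \<open>m\<close>.\<close>

lemma K_comm:
  assumes "m \<in> M" "v \<in> V" shows "v - (m + v - m) \<in> K"
proof -
  obtain n where n: "n \<in> N" "m = pi n" using assms(1) by (auto simp: M_def)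
  define a where "a = al n"
  have a: "a \<in> V" "n = a + m" using n N_P al_V al_pi by (auto simp: a_def)
  let ?w = "m + v - m"
  have w: "?w \<in> V" using conjV M_closed(6) assms by blast
  have "(v + n - v) - n \<in> N" using N_closed(4,5) V_P assms(2) n by blast
  also have "(v + n - v) - n = v + a - ?w - a"
    unfolding a(2) by (simp add: group_simps del: add_uminus_conv_diff)
  also have "\<dots> = v + (a + - ?w) - a" by (simp only: diff_conv_add_uminus add.assoc)
  also have "\<dots> = v + (- ?w + a) - a" using V_comm[OF a(1) V_minus[OF w]] by simp
  also have "\<dots> = v - ?w" by (simp only: diff_conv_add_uminus add.assoc right_minus add.right_neutral)
  finally show ?thesis using V_diff assms(2) w by (simp add: K_def)
qed

lemma Q_decomp:
  assumes "q \<in> Q" obtains m c where "m \<in> M" "c \<in> C" "q = m + pi c"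
proof -
  obtain n c where nc: "n \<in> N" "c \<in> C" "q = n + c"
    using complements_decomp[OF C] Q_P assms by blast
  then have "q = pi n + pi c" using pi_Q_id[OF assms] pi_add N_P C_P by metis
  then show thesis using that nc by (auto simp: M_def)
qed

text \<open>\<open>Q\<close> is the product of \<open>M\<close> and the image of \<open>C\<close>.
  Containing the commutators with \<open>M\<close> gives stability under \<open>M\<close>, so only
  conjugation by \<open>C\<close> remains, and this is visible on sets defined through
  \<open>D\<close>.\<close>

lemma conj_stable_QI:
  assumes Y: "subgrp Y" "Y \<subseteq> V" and m: "\<And>m v. m \<in> M \<Longrightarrow> v \<in> V \<Longrightarrow> v - (m + v - m) \<in> Y"
    and c: "\<And>c y. c \<in> C \<Longrightarrow> y \<in> Y \<Longrightarrow> pi c + y - pi c \<in> Y"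
  shows "conj_stable Q Y"
proof (rule conj_stableI)
  fix q y assume q: "q \<in> Q" and y: "y \<in> Y"
  obtain m c where mc: "m \<in> M" "c \<in> C" "q = m + pi c" using Q_decomp[OF q] .
  let ?u = "pi c + y - pi c"
  have u: "?u \<in> Y" using c mc y by blast
  then have "?u - (m + ?u - m) \<in> Y" using m mc Y by blast
  then have "- (?u - (m + ?u - m)) + ?u \<in> Y"
    using subgrp_add[OF Y(1) subgrp_minus[OF Y(1)] u] by blast
  also have "- (?u - (m + ?u - m)) + ?u = q + y - q"
    unfolding mc(3) by (simp add: group_simps del: add_uminus_conv_diff)
  finally show "q + y - q \<in> Y" .
qed

lemma A_V:
  assumes "v \<in> V" obtains n d where "n \<in> N" "d \<in> D" "v = n + d"
proof -
  obtain n c where nc: "n \<in> N" "c \<in> C" "v = n + c"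
    using complements_decomp[OF C] V_P assms by blast
  then have "0 = pi n + pi c" using pi_V[OF assms] pi_add N_P C_P by metis
  then have "pi c = - pi n" by (metis minus_unique)
  then have "c \<in> D" using nc M_closed(2) by (auto simp: D_def M_def)
  then show thesis using that nc by blast
qed

text \<open>The preimage \<open>A\<close> of \<open>M\<close> is the product of \<open>N\<close> and
  \<open>D\<close>, which meet trivially, and also the product of \<open>N\<close> and
  \<open>V\<close>, which meet in \<open>K\<close>. Comparing orders gives the formula;
  structurally, both \<open>D\<close> and \<open>V/K\<close> are copies of
  \<open>A/N\<close>.\<close>

lemma card_DK: "card D * card K = card V"
proof -
  define A where "A = {g \<in> P. pi g \<in> M}"
  have A: "subgrp A" unfolding A_def
    using subgrp_0[OF subgrp_P] P_add P_minus pi_add pi_minus pi_0 M_closed by (intro subgrpI) auto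
  have NA: "N \<subseteq> A" using N_P by (auto simp: A_def M_def)
  have finA: "finite A" using finite_P by (simp add: A_def)
  have "complements A N D"
    unfolding complements_def
  proof (intro conjI ballI)
    show "D \<subseteq> A" using D_P D_M by (auto simp: A_def)
    show "N \<inter> D = {0}" using NC D_C N_closed(3) D_closed(3) by blast
    fix g assume g: "g \<in> A"
    obtain n c where nc: "n \<in> N" "c \<in> C" "g = n + c"
      using complements_decomp[OF C] g by (auto simp: A_def)
    then have "pi c = - pi n + pi g" using pi_add N_P C_P by (simp add: add.assoc[symmetric])
    then have "c \<in> D" using nc g M_closed(1,2) by (auto simp: D_def A_def M_def)
    then show "\<exists>n\<in>N. \<exists>d\<in>D. g = n + d" using nc by blast
  qed (rule D)
  then have 1: "card N * card D = card A" using card_complements N(1) NA A finA by blast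
  have "(\<lambda>(a, b). a + b) ` (N \<times> V) = A"
  proof (intro equalityI subsetI)
    fix g assume "g \<in> (\<lambda>(a, b). a + b) ` (N \<times> V)"
    then show "g \<in> A" using N_P V_P P_add pi_add pi_V by (auto simp: A_def M_def)
  next
    fix g assume g: "g \<in> A"
    then obtain n where n: "n \<in> N" "pi g = pi n" by (auto simp: A_def M_def)
    have gP: "- n + g \<in> P" using P_add P_minus N_P n g by (auto simp: A_def)
    have "pi (- n + g) = 0" using pi_add pi_minus P_minus N_P n g by (auto simp: A_def)
    then have "- n + g \<in> V" using al_V[OF gP] al_pi[OF gP] by simp
    moreover have "g = n + (- n + g)" by (simp add: add.assoc[symmetric])
    ultimately show "g \<in> (\<lambda>(a, b). a + b) ` (N \<times> V)" using n by force
  qed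
  then have "card N * card V = card N * card D * card K"
    using card_set_plus[OF N(1) V(1) finite_N V(2)] 1 by (simp add: K_def)
  moreover have "card N > 0" using finite_N N_closed(3) card_gt_0_iff by blast
  ultimately show ?thesis by simp
qed

text \<open>The sets \<open>T\<close> and, below, \<open>X1\<close> are the two invariant subgroups of \<open>V\<close> of which one must be full.
  Modulo \<open>K\<close>, an element \<open>d = n + v\<close> of \<open>D\<close> contributes \<open>al d\<close> to \<open>X1\<close> and \<open>v - al d\<close> to \<open>T\<close>.\<close>

definition "T = {w \<in> V. \<exists>d\<in>D. - w + pi d \<in> N}"

text \<open>Each \<open>d\<close> in \<open>D\<close> determines an element \<open>W d\<close> of
  \<open>V\<close> up to \<open>K\<close>. If all of \<open>V\<close> is reached, the map
  \<open>(d, k)\<close> to \<open>W d + k\<close> from \<open>D \<times> K\<close> onto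
  \<open>V\<close> is bijective by \<open>card_DK\<close>. An element with \<open>pi d\<close> in
  \<open>N\<close> admits 0 as its partner, just as \<open>d = 0\<close> does, so it is 0; both
  claims are of this kind.\<close>

lemma T_full:
  assumes "T = V"
  shows "c \<in> C \<Longrightarrow> c \<in> V \<Longrightarrow> c = 0" and "c \<in> C \<Longrightarrow> pi c \<in> N \<Longrightarrow> c = 0"
proof -
  have "\<exists>w. w \<in> V \<and> - w + pi d \<in> N" if "d \<in> D" for d
  proof -
    obtain n where n: "n \<in> N" "pi d = pi n" using D_M[OF \<open>d \<in> D\<close>] by (auto simp: M_def)
    have "- (- al n) + pi d = n" using al_pi[OF N_P[OF n(1)]] n(2) by simp
    then show ?thesis using V_minus al_V[OF N_P[OF n(1)]] n(1) by metis
  qed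
  then obtain W where W: "\<And>d. d \<in> D \<Longrightarrow> W d \<in> V \<and> - W d + pi d \<in> N" by metis
  have diff: "\<exists>k\<in>K. w = W d + k" if "d \<in> D" "w \<in> V" "- w + pi d \<in> N" for d w
  proof -
    have "(- W d + pi d) - (- w + pi d) \<in> N" using W that N_closed(4) by blast
    then have "- W d + w \<in> N" by (simp add: group_simps del: add_uminus_conv_diff)
    moreover have "- W d + w \<in> V" using W that V_add V_minus by blast
    moreover have "w = W d + (- W d + w)" by (simp add: add.assoc[symmetric])
    ultimately show ?thesis unfolding K_def by blast
  qed
  let ?f = "\<lambda>(d, k). W d + k"
  have "?f ` (D \<times> K) = V"
  proof (intro equalityI subsetI)
    fix w assume "w \<in> V"
    then have "w \<in> T" using assms by simp
    then obtain d where "d \<in> D" "- w + pi d \<in> N" by (auto simp: T_def)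
    then show "w \<in> ?f ` (D \<times> K)" using diff \<open>w \<in> V\<close> by force
  qed (use W K_closed V_add in auto)
  then have inj: "inj_on ?f (D \<times> K)"
    using card_DK finite_D V K finite_subset[of K V]
    by (intro eq_card_imp_inj_on) (auto simp: card_cartesian_product)
  have key: "c = 0" if c: "c \<in> D" "pi c \<in> N" for c
  proof -
    obtain k where k: "k \<in> K" "0 = W c + k" using diff[of c 0] c V_0 by auto
    obtain k' where k': "k' \<in> K" "0 = W 0 + k'"
      using diff[of 0 0] D_closed(3) N_closed(3) V_0 pi_0 by auto
    have "(c, k) = (0, k')"
      using inj_onD[OF inj, of "(c, k)" "(0, k')"] k k' c D_closed(3) by auto
    then show "c = 0" by simp
  qed
  show "c = 0" if "c \<in> C" "c \<in> V"
    using key[of c] that pi_V[of c] N_closed(3) M_closed(3) by (auto simp: D_def)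
  show "c = 0" if "c \<in> C" "pi c \<in> N"
  proof -
    have "pi c \<in> M" using that pi_Q_id[OF pi_Q[OF C_P[OF that(1)]]] unfolding M_def by (metis imageI)
    then show ?thesis using key that by (auto simp: D_def)
  qed
qed

lemma T_subgrp: "subgrp T"
proof (rule subgrpI)
  show "0 \<in> T" using V_0 D_closed(3) N_closed(3) pi_0 by (auto simp: T_def intro!: bexI[of _ 0])
next
  fix w1 w2 assume "w1 \<in> T" "w2 \<in> T"
  then obtain d1 d2 where w: "w1 \<in> V" "w2 \<in> V" "d1 \<in> D" "d2 \<in> D"
    "- w1 + pi d1 \<in> N" "- w2 + pi d2 \<in> N" by (auto simp: T_def)
  \<comment> \<open>Moving \<open>w2\<close> past \<open>pi d1\<close> costs this commutator, which
    lies in \<open>K\<close> and may therefore be added inside \<open>N\<close>.\<close>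
  define k where "k = - w2 - (pi d1 + - w2 - pi d1)"
  have k: "k \<in> K" unfolding k_def using K_comm D_M V_minus w by blast
  have "k + ((- w1 + pi d1) + (- w2 + pi d2)) \<in> N" using k w N_closed(1) K_closed(7) by blast
  also have "k + ((- w1 + pi d1) + (- w2 + pi d2)) = (k + - w1) + (pi d1 + - w2 + pi d2)"
    by (simp add: group_simps del: add_uminus_conv_diff)
  also have "k + - w1 = - w1 + k" using V_comm K_closed(6) k V_minus w by blast
  also have "- w1 + k + (pi d1 + - w2 + pi d2) = (- w1 + - w2) + (pi d1 + pi d2)"
    unfolding k_def by (simp add: group_simps del: add_uminus_conv_diff)
  also have "- w1 + - w2 = - (w1 + w2)" using V_comm V_minus w by (metis minus_add)
  also have "pi d1 + pi d2 = pi (d1 + d2)" using pi_add D_P w by simp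
  finally show "w1 + w2 \<in> T" using w V_add D_closed(1) unfolding T_def by blast
next
  fix w assume "w \<in> T"
  then obtain d where w: "w \<in> V" "d \<in> D" "- w + pi d \<in> N" by (auto simp: T_def)
  have "pi d + - (- w + pi d) - pi d \<in> N" using N_closed(2,5) w Q_P pi_Q D_P by blast
  then have "- (- w) + pi (- d) \<in> N"
    using pi_minus[OF D_P[OF w(2)]] by (simp add: group_simps del: add_uminus_conv_diff)
  then show "- w \<in> T" using w V_minus D_closed(2) unfolding T_def by blast
qed

lemma T_stable: "conj_stable Q T"
proof (rule conj_stable_QI[OF T_subgrp])
  show "T \<subseteq> V" by (auto simp: T_def)
  have "K \<subseteq> T" using K_closed D_closed(3) pi_0 N_closed by (auto simp: T_def intro!: bexI[of _ 0])
  then show "v - (m + v - m) \<in> T" if "m \<in> M" "v \<in> V" for m v using K_comm that by blast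
next
  fix c w assume c: "c \<in> C" and "w \<in> T"
  then obtain d where w: "w \<in> V" "d \<in> D" "- w + pi d \<in> N" by (auto simp: T_def)
  have q: "pi c \<in> Q" using pi_Q C_P c by blast
  have "pi c + (- w + pi d) - pi c \<in> N" using N_closed(5) Q_P q w by blast
  then have "- (pi c + w - pi c) + (pi c + pi d - pi c) \<in> N"
    by (simp add: group_simps del: add_uminus_conv_diff)
  then have "- (pi c + w - pi c) + pi (c + d - c) \<in> N" unfolding D_conj(2)[OF c w(2)] .
  then show "pi c + w - pi c \<in> T"
    using D_conj(1)[OF c w(2)] conjV[OF q w(1)] unfolding T_def by blast
qed

text \<open>In general \<open>U\<close> is only contained in \<open>K\<close>. The group
  \<open>X1\<close> is formed modulo \<open>U\<close> and not modulo \<open>K\<close> on purpose: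
  its being full then forces \<open>U = K\<close>, so that \<open>K\<close> is described by orbit
  sums.\<close>

definition "U = zero_sum M"

lemma U: "subgrp U" "U \<subseteq> V" "U \<subseteq> K"
  and U_comm: "m \<in> M \<Longrightarrow> v \<in> V \<Longrightarrow> v - (m + v - m) \<in> U"
  using zero_sum_subgrp[OF M(1,2)] zero_sum_generated[OF K(1) M(1,2) K_comm]
    zero_sum_comm[OF M(1,2)] by (auto simp: U_def zero_sum_def)

lemma orb_conj:
  assumes "q \<in> Q" "x \<in> \<Omega>" shows "act q ` orb act M x = orb act M (act q x)"
proof (intro equalityI subsetI)
  fix y assume "y \<in> act q ` orb act M x"
  then obtain m where m: "m \<in> M" "y = act q (act m x)" by (auto simp: orb_def)
  have "act (q + m - q) (act q x) = act (q + m - q + q) x"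
    by (rule acts_add[OF actQ M_closed(6)[OF M_closed(5)[OF assms(1) m(1)]] assms, symmetric])
  also have "\<dots> = y" using acts_add[OF actQ] M_closed(6) m assms by simp
  finally show "y \<in> orb act M (act q x)" using M_closed(5) m assms unfolding orb_def by blast
next
  fix y assume "y \<in> orb act M (act q x)"
  then obtain m where m: "m \<in> M" "y = act m (act q x)" by (auto simp: orb_def)
  have mm: "- q + m + q \<in> M" using conj_stableD'[OF M(3) Q(1) assms(1) m(1)] .
  have "act q (act (- q + m + q) x) = act (q + (- q + m + q)) x"
    using acts_add[OF actQ] M_closed(6) mm assms by simp
  also have "q + (- q + m + q) = m + q" by (simp add: add.assoc[symmetric])
  also have "act (m + q) x = y" using acts_add[OF actQ] M_closed(6) m assms by simp
  finally show "y \<in> act q ` orb act M x" using mm unfolding orb_def by blast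
qed

lemma orb_M_subset: "x \<in> \<Omega> \<Longrightarrow> orb act M x \<subseteq> \<Omega>"
  using orb_subset[OF act_subset[OF M(1,2)]] .

lemma U_stable: "q \<in> Q \<Longrightarrow> u \<in> U \<Longrightarrow> q + u - q \<in> U"
proof -
  assume q: "q \<in> Q" and u: "u \<in> U"
  have uV: "u \<in> V" using u U by blast
  have "tot (orb act M x) (q + u - q) = 0" if x: "x \<in> \<Omega>" for x
  proof -
    let ?y = "act (- q) x"
    have y: "?y \<in> \<Omega>" "act q ?y = x"
      using acts_in[OF actQ subgrp_minus[OF Q(1) q] x] acts_inv2[OF actQ q x] by auto
    have "tot (orb act M x) (q + u - q) = tot (orb act M ?y) u"
      using orb_conj[OF q y(1)] y(2) tot_conj[OF q uV orb_M_subset[OF y(1)]] by simp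
    then show ?thesis using u y by (simp add: U_def zero_sum_def)
  qed
  then show ?thesis using conjV q uV by (simp add: U_def zero_sum_def)
qed

section \<open>Congruences in \<open>V\<close> and the choice between the two cases\<close>

definition cg :: "'a set \<Rightarrow> 'a \<Rightarrow> 'a \<Rightarrow> bool" where
  "cg Y v w \<longleftrightarrow> v \<in> V \<and> w \<in> V \<and> v - w \<in> Y"

lemma cg_refl: "subgrp Y \<Longrightarrow> v \<in> V \<Longrightarrow> cg Y v v"
  by (simp add: cg_def subgrp_0)

lemma cg_sym: "subgrp Y \<Longrightarrow> cg Y v w \<Longrightarrow> cg Y w v"
  using subgrp_minus[of Y "v - w"] by (simp add: cg_def)

lemma cg_trans: "subgrp Y \<Longrightarrow> cg Y u v \<Longrightarrow> cg Y v w \<Longrightarrow> cg Y u w"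
  using subgrp_add[of Y "u - v" "v - w"]
  by (simp add: cg_def group_simps del: add_uminus_conv_diff)

lemma cg_add:
  assumes "subgrp Y" "cg Y u v" "cg Y u' v'" shows "cg Y (u + u') (v + v')"
proof -
  have mem: "u \<in> V" "v \<in> V" "u' \<in> V" "v' \<in> V" using assms by (auto simp: cg_def)
  have "(u + u') - (v + v') = u + (u' - v') - v"
    by (simp add: group_simps del: add_uminus_conv_diff)
  also have "\<dots> = (u' - v') + (u - v)"
    using V_comm[of u "u' - v'"] mem V_diff by (simp add: group_simps del: add_uminus_conv_diff)
  finally show ?thesis
    using assms mem V_add subgrp_add[OF assms(1)] by (simp add: cg_def)
qed

lemma cg_minus:
  assumes "subgrp Y" "cg Y u v" shows "cg Y (- u) (- v)"
proof -
  have mem: "u \<in> V" "v \<in> V" using assms by (auto simp: cg_def)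
  have "- u - - v = v - u" using V_comm[of "- u" v] mem V_minus by simp
  then show ?thesis using cg_sym[OF assms] V_minus mem by (simp add: cg_def)
qed

lemma cg_conj:
  assumes "q \<in> Q" "\<And>y. y \<in> Y \<Longrightarrow> q + y - q \<in> Y" "cg Y u v"
  shows "cg Y (q + u - q) (q + v - q)"
proof -
  have "(q + u - q) - (q + v - q) = q + (u - v) - q"
    by (simp add: group_simps del: add_uminus_conv_diff)
  then show ?thesis using assms conjV by (simp add: cg_def)
qed

lemma cg_M: "subgrp Y \<Longrightarrow> U \<subseteq> Y \<Longrightarrow> m \<in> M \<Longrightarrow> v \<in> V \<Longrightarrow> cg Y (m + v - m) v"
  by (rule cg_sym) (use U_comm conjV M_closed(6) in \<open>unfold cg_def, blast+\<close>)

text \<open>The twist in the cocycle law comes from \<open>pi d\<close> in \<open>M\<close>, and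
  \<open>M\<close> acts trivially on \<open>V\<close> modulo \<open>U\<close>.\<close>

lemma al_add_cg:
  assumes Y: "subgrp Y" "U \<subseteq> Y" and d: "d \<in> D" and g: "g \<in> P"
  shows "cg Y (al (d + g)) (al d + al g)"
  unfolding al_add[OF D_P[OF d] g]
  using cg_add[OF Y(1) cg_refl[OF Y(1)] cg_M[OF Y D_M[OF d]]] al_V D_P d g by blast

lemma al_minus_cg:
  assumes Y: "subgrp Y" "U \<subseteq> Y" and d: "d \<in> D"
  shows "cg Y (al (- d)) (- al d)"
proof -
  have "cg Y (al (d + - d)) (al d + al (- d))" using al_add_cg[OF Y d P_minus[OF D_P[OF d]]] .
  then have "cg Y (al d + al (- d)) 0" using cg_sym[OF Y(1)] al_0 by simp
  then have "cg Y (- al d + (al d + al (- d))) (- al d + 0)"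
    using cg_add[OF Y(1) cg_refl[OF Y(1)]] V_minus al_V D_P d by blast
  then show ?thesis by simp
qed

text \<open>Evaluate \<open>al\<close> on \<open>c + d = (c + d - c) + c\<close> in two ways. The
  conjugate is again in \<open>D\<close>, so its twist is invisible modulo \<open>Y\<close>, and
  \<open>al c\<close> cancels because \<open>V\<close> is abelian.\<close>

lemma al_conj_cg:
  assumes Y: "subgrp Y" "U \<subseteq> Y" and c: "c \<in> C" and d: "d \<in> D"
  shows "cg Y (al (c + d - c)) (pi c + al d - pi c)"
proof -
  let ?e = "c + d - c" and ?w = "pi c + al d - pi c"
  have e: "?e \<in> D" using D_conj c d by blast
  have V': "al c \<in> V" "?w \<in> V" using al_V pi_Q C_P c conjV D_P d by auto
  have "cg Y (al (?e + c)) (al ?e + al c)" using al_add_cg[OF Y e C_P[OF c]] .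
  moreover have "al (?e + c) = al (c + d)" by simp
  moreover have "al (c + d) = al c + ?w" using al_add C_P c D_P d by blast
  moreover have "al c + ?w = ?w + al c" using V_comm V' by blast
  ultimately have "cg Y (?w + al c) (al ?e + al c)" by simp
  then have "cg Y (?w + al c + - al c) (al ?e + al c + - al c)"
    using cg_add[OF Y(1) _ cg_refl[OF Y(1)]] V_minus V' by blast
  then have "cg Y ?w (al ?e)" by (simp add: add.assoc)
  then show ?thesis by (rule cg_sym[OF Y(1)])
qed

definition "X1 = {v \<in> V. \<exists>d\<in>D. cg U v (al d)}"

lemma X1_subgrp: "subgrp X1"
proof (rule subgrpI)
  show "0 \<in> X1" using V_0 D_closed(3) al_0 cg_refl[OF U(1)] unfolding X1_def by force
next
  fix v w assume "v \<in> X1" "w \<in> X1"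
  then obtain d e where *: "v \<in> V" "w \<in> V" "d \<in> D" "e \<in> D" "cg U v (al d)" "cg U w (al e)"
    by (auto simp: X1_def)
  have "cg U (v + w) (al d + al e)" using cg_add U * by blast
  then have "cg U (v + w) (al (d + e))"
    using al_add_cg[OF U(1) subset_refl] * D_P cg_trans[OF U(1)] cg_sym[OF U(1)] by blast
  then show "v + w \<in> X1" using * V_add D_closed(1) unfolding X1_def by blast
next
  fix v assume "v \<in> X1"
  then obtain d where *: "v \<in> V" "d \<in> D" "cg U v (al d)" by (auto simp: X1_def)
  then have "cg U (- v) (al (- d))"
    using al_minus_cg[OF U(1) subset_refl] cg_minus cg_trans[OF U(1)] cg_sym[OF U(1)] U by blast
  then show "- v \<in> X1" using * V_minus D_closed(2) unfolding X1_def by blast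
qed

lemma X1_stable: "conj_stable Q X1"
proof (rule conj_stable_QI[OF X1_subgrp])
  show "X1 \<subseteq> V" by (auto simp: X1_def)
  show "v - (m + v - m) \<in> X1" if "m \<in> M" "v \<in> V" for m v
  proof -
    let ?u = "v - (m + v - m)"
    have "?u \<in> V" "?u - 0 \<in> U" using that U_comm U by auto
    then have "cg U ?u (al 0)" using al_0 V_0 by (simp add: cg_def)
    then show ?thesis using \<open>?u \<in> V\<close> D_closed(3) unfolding X1_def by blast
  qed
next
  fix c v assume c: "c \<in> C" and "v \<in> X1"
  then obtain d where *: "v \<in> V" "d \<in> D" "cg U v (al d)" by (auto simp: X1_def)
  have q: "pi c \<in> Q" using pi_Q C_P c by blast
  have "cg U (pi c + v - pi c) (pi c + al d - pi c)" using cg_conj[OF q U_stable[OF q]] * by blast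
  then have "cg U (pi c + v - pi c) (al (c + d - c))"
    using al_conj_cg[OF U(1) subset_refl c *(2)] cg_trans[OF U(1)] cg_sym[OF U(1)] by blast
  then show "pi c + v - pi c \<in> X1" using conjV[OF q] * D_conj(1)[OF c] unfolding X1_def by blast
qed

text \<open>Write the unit vector \<open>v\<close> at \<open>base\<close> as \<open>n + d\<close>.
  Then \<open>al d\<close> lies in \<open>X1\<close> and \<open>v - al d\<close> in
  \<open>T\<close>, and their sums over \<Omega> add up to 1 modulo \<open>p\<close>; whichever sum
  is nonzero makes its group all of \<open>V\<close>.\<close>

lemma X1_or_T: "X1 = V \<or> T = V"
proof (rule disjCI)
  assume "T \<noteq> V"
  obtain v where v: "v \<in> V" "\<And>y. y \<in> \<Omega> \<Longrightarrow> co v y = (if y = base then 1 mod pp else 0)"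
    using delta_ex[OF \<Omega>(2), of 1] by blast
  have "tot \<Omega> v = (\<Sum>y\<in>\<Omega>. if y = base then 1 mod pp else 0) mod pp"
    unfolding tot_def using v(2) by (simp cong: sum.cong)
  then have totv: "tot \<Omega> v = 1" using \<Omega> p_gt_1 by simp
  obtain n d where nd: "n \<in> N" "d \<in> D" "v = n + d" using A_V[OF v(1)] .
  define m u where "m = pi d" and "u = - v"
  define w where "w = v - al d"
  have a: "al d \<in> V" "d = al d + m" "m \<in> M" "u \<in> V"
    using al_V al_pi D_P nd D_M V_minus v by (auto simp: m_def u_def)
  \<comment> \<open>In \<open>- n = d - v\<close> the summand \<open>u = - v\<close> appears
    conjugated by \<open>m\<close>. Adding this commutator, which is in \<open>N\<close>, undoes the
    conjugation and leaves \<open>- w + m\<close>.\<close>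
  define k where "k = u - (m + u - m)"
  have k: "k \<in> K" unfolding k_def using K_comm a by blast
  have "- n = d - v" using nd(3) by (simp add: group_simps del: add_uminus_conv_diff)
  also have "\<dots> = al d + (m + u - m) + m"
    unfolding u_def by (subst a(2)) (simp add: group_simps del: add_uminus_conv_diff)
  finally have "al d + (m + u - m) + m \<in> N" using N_closed(2) nd(1) by metis
  then have "k + (al d + (m + u - m) + m) \<in> N" using N_closed(1) K_closed(7) k by blast
  also have "k + (al d + (m + u - m) + m) = (k + al d) + (m + u - m) + m" by (simp add: add.assoc)
  also have "k + al d = al d + k" using V_comm k K_closed(6) a by blast
  also have "al d + k + (m + u - m) + m = al d + (u + m)"
    unfolding k_def by (simp add: group_simps del: add_uminus_conv_diff)
  also have "\<dots> = - w + m" unfolding w_def u_def by (simp add: group_simps del: add_uminus_conv_diff)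
  finally have "w \<in> T" using V_diff v a nd unfolding T_def m_def w_def by blast
  then have "tot \<Omega> w = 0"
    using invariant_subgrp_full[OF T_subgrp _ T_stable] \<open>T \<noteq> V\<close> by (auto simp: T_def)
  then have "tot \<Omega> (al d) \<noteq> 0" using tot_diff[OF v(1) a(1) subset_refl] totv p_gt_1
    unfolding w_def by auto
  moreover have "al d \<in> X1" using a nd cg_refl[OF U(1)] unfolding X1_def by blast
  ultimately show "X1 = V"
    using invariant_subgrp_full[OF X1_subgrp _ X1_stable] by (auto simp: X1_def)
qed

end

section \<open>Coordinate sums over points moved by an element killed by \<open>p\<close>\<close>

context wreath
begin

lemma acts_pi: "acts (\<lambda>g. act (pi g)) P \<Omega>"
  using subgrp_P acts_in[OF actQ] acts_0[OF actQ] acts_add[OF actQ] pi_Q pi_0 pi_add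
  by (intro actsI) auto

lemma p_subgrp:
  assumes "subgrp A" "A \<subseteq> Q" shows "finite A" "\<exists>a. card A = p ^ a"
  using assms Q finite_subset card_subgrp_dvd[OF assms(1) Q(1) assms(2) Q(2)] p_power_dvdE[OF p]
  by (blast, metis)

text \<open>On an orbit of length \<open>p\<close> the coordinates of \<open>al d\<close> add up to the translation by which
  \<open>p \<cdot> d = 0\<close> acts.\<close>

lemma tot_moved_points:
  assumes d: "d \<in> P" and pd: "((+) d ^^ p) 0 = 0" and B: "B \<subseteq> \<Omega>"
    and inv: "\<And>y. y \<in> B \<Longrightarrow> act (pi d) y \<in> B" and moved: "\<And>y. y \<in> B \<Longrightarrow> act (pi d) y \<noteq> y"
  shows "tot B (al d) = 0"
proof -
  \<comment> \<open>The \<open>n\<close>-fold multiple of \<open>d\<close>. These multiples form a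
    group of at most \<open>p\<close> elements; since \<open>d\<close> fixes no point of
    \<open>B\<close>, each of its orbits has length exactly \<open>p\<close>.\<close>
  define md where "md n = ((+) d ^^ n) 0" for n
  have md_0: "md 0 = 0" and md_Suc: "md (Suc n) = d + md n" and md_p: "md p = 0" for n
    using pd by (simp_all add: md_def)
  have md_P: "md n \<in> P" for n
    by (induction n) (auto simp: md_0 md_Suc intro: subgrp_0[OF subgrp_P] P_add d)
  have md_add: "md (m + n) = md m + md n" for m n
    by (induction m) (simp_all add: md_0 md_Suc add.assoc)
  have md_mult: "md (k * p) = 0" for k
    by (induction k) (simp_all add: md_0 md_p md_add)
  have md_minus: "- md n = md (n * (p - 1))" for n
  proof -
    have "n + n * (p - 1) = n * p" using p_gt_1 by (cases p) auto
    then have "md n + md (n * (p - 1)) = 0" using md_add[of n "n * (p - 1)"] md_mult by simp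
    then show ?thesis by (rule minus_unique)
  qed
  define T where "T = range md"
  have md_mod: "md n = md (n mod p)" for n
    using md_add[of "n div p * p" "n mod p"] md_mult by simp
  have T_eq: "T = md ` {..<p}"
  proof -
    have "md n \<in> md ` {..<p}" for n by (rule image_eqI[of _ _ "n mod p"]) (use md_mod[of n] p_gt_1 in auto)
    then show ?thesis unfolding T_def by blast
  qed
  have T: "subgrp T"
  proof (rule subgrpI)
    show "0 \<in> T" unfolding T_def by (rule range_eqI[of _ _ 0]) (simp add: md_0)
    show "x + y \<in> T" if "x \<in> T" "y \<in> T" for x y
      using that by (auto simp: T_def md_add[symmetric])
    show "- x \<in> T" if "x \<in> T" for x
      using that by (auto simp: T_def md_minus)
  qed
  have TP: "T \<subseteq> P" using md_P by (auto simp: T_def)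
  have finT: "finite T" by (simp add: T_eq)
  have card_le: "card T \<le> p" unfolding T_eq using card_image_le[of "{..<p}" md] by simp
  obtain v q where "card V = p ^ v" "card Q = p ^ q" using V Q by blast
  then have "card P = p ^ (v + q)" using card_P by (simp add: power_add)
  then obtain t where t: "card T = p ^ t"
    using card_subgrp_dvd[OF T subgrp_P TP finite_P] p_power_dvdE[OF p] by metis
  have actT: "acts (\<lambda>g. act (pi g)) T B"
  proof (rule actsI)
    have "act (pi (md n)) x \<in> B" if "x \<in> B" for n x
    proof (induction n)
      case 0
      then show ?case using that B acts_0[OF actQ] by (auto simp: md_0 pi_0)
    next
      case (Suc n)
      then show ?case using inv acts_add[OF acts_pi d md_P, of x n] that B by (auto simp: md_Suc)
    qed
    then show "act (pi g) x \<in> B" if "g \<in> T" "x \<in> B" for g x using that by (auto simp: T_def)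
  qed (use T TP B acts_0[OF acts_pi] acts_add[OF acts_pi] in \<open>auto simp: subset_eq\<close>)
  have "pp dvd sum (co (al d)) B"
  proof (rule dvd_sum_orbits[OF actT])
    show "finite B" using B \<Omega> finite_subset by blast
    fix y assume y: "y \<in> B"
    define z where "z n = act (pi (md n)) y" for n
    let ?O = "orb (\<lambda>g. act (pi g)) T y"
    have y\<Omega>: "y \<in> \<Omega>" using y B by blast
    have z\<Omega>: "z n \<in> \<Omega>" for n using acts_in[OF acts_pi md_P y\<Omega>] by (simp add: z_def)
    have z_Suc: "z (Suc n) = act (pi d) (z n)" for n
      using acts_add[OF acts_pi d md_P y\<Omega>] by (simp add: z_def md_Suc)
    \<comment> \<open>The orbit is listed as \<open>z 1\<close>, ..., \<open>z p\<close>, with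
      \<open>z p = z 0\<close> at the end, because the coordinate contributed by \<open>d\<close> is
      read at the image point.\<close>
    have O: "?O = (\<lambda>i. z (Suc i)) ` {..<p}"
    proof (intro equalityI subsetI)
      fix x assume "x \<in> ?O"
      then obtain n where n: "x = z n" by (auto simp: orb_def T_def z_def)
      show "x \<in> (\<lambda>i. z (Suc i)) ` {..<p}"
      proof (cases "n mod p")
        case 0
        then have "x = z p" using md_mod[of n] md_p md_0 n by (simp add: z_def)
        then show ?thesis using p_gt_1 by (intro image_eqI[of _ _ "p - 1"]) auto
      next
        case (Suc k)
        then have "x = z (Suc k)" using md_mod[of n] n by (simp add: z_def)
        moreover have "k < p" using Suc p_gt_1 by (metis Suc_lessD mod_less_divisor less_trans zero_less_one)
        ultimately show ?thesis by blast
      qed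
    qed (auto simp: orb_def T_def z_def)
    have "card ?O = p"
    proof -
      obtain k where k: "card ?O = p ^ k"
        using card_orb_dvd[OF actT y finT] t p_power_dvdE[OF p] by metis
      have finO: "finite ?O" by (simp add: O)
      have "z 0 = y" using acts_0[OF actQ y\<Omega>] by (simp add: z_def md_0 pi_0)
      then have "act (pi d) y = z (Suc 0)" using z_Suc[of 0] by simp
      then have "act (pi d) y \<in> ?O" unfolding O using p_gt_1 by (intro image_eqI[of _ _ 0]) auto
      then have "{y, act (pi d) y} \<subseteq> ?O" using orb_self[OF actT y] by blast
      then have "card {y, act (pi d) y} \<le> card ?O" using finO card_mono by blast
      then have "p ^ k > 1" using moved[OF y] k by simp
      then have "k \<noteq> 0" by (cases "k = 0") simp_all
      moreover have "p ^ k \<le> p" using k card_image_le[of "{..<p}" "\<lambda>i. z (Suc i)"] O by simp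
      then have "k \<le> 1" using power_le_imp_le_exp[OF p_gt_1, of k 1] by simp
      ultimately have "k = 1" by simp
      then show ?thesis using k by simp
    qed
    then have inj: "inj_on (\<lambda>i. z (Suc i)) {..<p}" using O by (intro eq_card_imp_inj_on) auto
    \<comment> \<open>The cocycle law telescopes along the orbit: each application of
      \<open>d\<close> adds the coordinate of \<open>al d\<close> at the point reached. For
      \<open>n = p\<close> the left side is 0.\<close>
    have sum: "co (al (md n)) (z n) = (\<Sum>i<n. co (al d) (z (Suc i))) mod pp" for n
    proof (induction n)
      case 0
      then show ?case using co_0[OF z\<Omega>] by (simp add: md_0 al_0)
    next
      case (Suc n)
      let ?u = "pi d + al (md n) - pi d"
      have "co (al (md (Suc n))) (z (Suc n)) = co (al d + ?u) (z (Suc n))"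
        using al_add[OF d md_P] by (simp add: md_Suc)
      also have "\<dots> = (co (al d) (z (Suc n)) + co ?u (z (Suc n))) mod pp"
        using al_V[OF d] conjV[OF pi_Q[OF d] al_V[OF md_P]] z\<Omega> by (rule co_add)
      also have "co ?u (z (Suc n)) = co (al (md n)) (z n)"
        unfolding z_Suc using co_Q[OF pi_Q[OF d] al_V[OF md_P] z\<Omega>] .
      finally show ?case using Suc by (simp add: mod_simps add.commute)
    qed
    have "sum (co (al d)) ?O = (\<Sum>i<p. co (al d) (z (Suc i)))"
      unfolding O by (simp add: sum.reindex[OF inj])
    then have "sum (co (al d)) ?O mod pp = 0" using sum[of p] md_p co_0[OF z\<Omega>] al_0 by simp
    then show "pp dvd sum (co (al d)) ?O" by auto
  qed
  then show ?thesis by (simp add: tot_def)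
qed

end

section \<open>The stabiliser of an orbit of \<open>M\<close>, and the case
  \<open>X1 = V\<close>\<close>

context wreath_complement
begin

abbreviation "B0 \<equiv> orb act M base"

lemma B0: "B0 \<subseteq> \<Omega>" "base \<in> B0" "finite B0"
  using orb_M_subset[OF \<Omega>(2)] orb_self[OF act_subset[OF M(1,2)] \<Omega>(2)] finite_subset[OF _ \<Omega>(1)]
  by auto

lemma B0_eq: "y \<in> B0 \<Longrightarrow> orb act M y = B0"
  using orb_eq[OF act_subset[OF M(1,2)] \<Omega>(2)] .

lemma stab_B0:
  assumes "q \<in> Q" "y \<in> B0" "act q y \<in> B0" shows "act q ` B0 = B0"
proof -
  have "act q ` orb act M y = orb act M (act q y)"
    using orb_conj[OF assms(1)] assms(2) B0(1) by blast
  then show ?thesis by (simp only: B0_eq[OF assms(2)] B0_eq[OF assms(3)])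
qed

text \<open>The setwise stabiliser of \<open>B0\<close> in \<open>A\<close>. Since \<open>B0\<close>
  is a block of \<open>Q\<close>, the image of one point decides membership; \<open>stab_iff\<close>
  allows any point of \<open>B0\<close> in place of \<open>base\<close>.\<close>

definition "stab A = {q \<in> A. act q base \<in> B0}"

lemma stab_iff:
  assumes "q \<in> A" "A \<subseteq> Q" "y \<in> B0" shows "q \<in> stab A \<longleftrightarrow> act q y \<in> B0"
proof -
  have "q \<in> Q" using assms by blast
  then show ?thesis using stab_B0[of q y] stab_B0[of q base] assms B0(2) by (auto simp: stab_def)
qed

lemma stab_image: "q \<in> stab A \<Longrightarrow> A \<subseteq> Q \<Longrightarrow> act q ` B0 = B0"
  using stab_B0[of q base] B0 by (auto simp: stab_def)

lemma stab_subgrp: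
  assumes A: "subgrp A" "A \<subseteq> Q" shows "subgrp (stab A)"
proof (rule subgrpI)
  note actA = act_subset[OF A]
  show "0 \<in> stab A" using subgrp_0[OF A(1)] acts_0[OF actA \<Omega>(2)] B0 by (simp add: stab_def)
next
  note actA = act_subset[OF A]
  fix q r assume qr: "q \<in> stab A" "r \<in> stab A"
  then have *: "q \<in> A" "r \<in> A" "act r base \<in> B0" by (auto simp: stab_def)
  have "act (q + r) base = act q (act r base)" using acts_add[OF actA] * \<Omega> by blast
  then show "q + r \<in> stab A"
    using * stab_image[OF qr(1) A(2)] subgrp_add[OF A(1)] by (auto simp: stab_def)
next
  note actA = act_subset[OF A]
  fix q assume q: "q \<in> stab A"
  then obtain y where y: "y \<in> B0" "base = act q y" using stab_image[OF q A(2)] B0(2) by blast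
  have qA: "q \<in> A" using q by (simp add: stab_def)
  have "act (- q) base = y" using acts_inv1[OF actA qA] y B0(1) by auto
  then show "- q \<in> stab A" using y(1) subgrp_minus[OF A(1) qA] by (simp add: stab_def)
qed

text \<open>If \<open>act c y\<close> and \<open>act d y\<close> lie in one \<open>M\<close>-orbit,
  then \<open>- c + d\<close> carries \<open>y\<close> into \<open>B0\<close>, hence stabilises
  \<open>B0\<close>, hence fixes \<open>y\<close>. So the \<open>A\<close>-orbit of \<open>y\<close>
  meets each \<open>M\<close>-orbit at most once.\<close>

lemma fixed_imp_inj:
  assumes A: "subgrp A" "A \<subseteq> Q" and y: "y \<in> B0" and fixed: "\<And>q. q \<in> stab A \<Longrightarrow> act q y = y"
  shows "inj_on (orb act M) (orb act A y)"
proof (rule inj_onI)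
  note actA = act_subset[OF A]
  have y\<Omega>: "y \<in> \<Omega>" using y B0 by blast
  fix u v assume "u \<in> orb act A y" "v \<in> orb act A y" and eq: "orb act M u = orb act M v"
  then obtain c d where cd: "c \<in> A" "d \<in> A" "u = act c y" "v = act d y" by (auto simp: orb_def)
  have v\<Omega>: "v \<in> \<Omega>" unfolding cd(4) by (rule acts_in[OF actA cd(2) y\<Omega>])
  have cQ: "c \<in> Q" using cd(1) A(2) by (rule subsetD[rotated])
  have "v \<in> orb act M u" using eq orb_self[OF act_subset[OF M(1,2)] v\<Omega>] by simp
  also have "orb act M u = act c ` B0"
    unfolding cd(3) orb_conj[OF cQ y\<Omega>, symmetric] B0_eq[OF y] ..
  finally obtain b where b: "act d y = act c b" "b \<in> B0" unfolding cd(4) by (rule imageE)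
  let ?e = "- c + d"
  have e: "?e \<in> A" using cd A subgrp_add subgrp_minus by blast
  have "act ?e y = act (- c) (act d y)"
    using acts_add[OF actA subgrp_minus[OF A(1)]] cd y\<Omega> by blast
  also have "\<dots> = b" unfolding b(1) using acts_inv1[OF actA cd(1)] b(2) B0(1) by blast
  finally have "act ?e y = y" using stab_iff[OF e A(2) y] b fixed by blast
  have "v = act (c + ?e) y" using cd by (simp add: add.assoc[symmetric])
  also have "\<dots> = act c (act ?e y)" using acts_add[OF actA cd(1) e y\<Omega>] .
  finally show "u = v" using \<open>act ?e y = y\<close> cd by simp
qed

lemma fixed_imp_card:
  assumes "subgrp A" "A \<subseteq> Q" "y \<in> B0" "\<And>q. q \<in> stab A \<Longrightarrow> act q y = y"
  shows "card (orb act A y) \<le> card (orb act M ` \<Omega>)"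
proof -
  have "orb act A y \<subseteq> \<Omega>" using orb_subset[OF act_subset[OF assms(1,2)]] assms(3) B0 by blast
  then have "card (orb act M ` orb act A y) \<le> card (orb act M ` \<Omega>)"
    using \<Omega>(1) by (intro card_mono image_mono finite_imageI)
  then show ?thesis using card_image[OF fixed_imp_inj[OF assms]] by simp
qed

context
  assumes full: "X1 = V"
begin

lemma X1_decomp:
  assumes "v \<in> V" obtains d where "d \<in> D" "cg U v (al d)"
  using assms full by (auto simp: X1_def)

text \<open>Fullness of \<open>X1\<close> covers \<open>V\<close> by one coset of \<open>U\<close>
  for each element of \<open>D\<close>. With \<open>card_DK\<close> this bounds
  \<open>card K\<close> by \<open>card U\<close>, while \<open>U\<close> lies in
  \<open>K\<close>.\<close>

lemma U_eq_K: "U = K"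
proof -
  have "V \<subseteq> (\<lambda>(d, u). u + al d) ` (D \<times> U)"
  proof
    fix v assume "v \<in> V"
    then obtain d where d: "d \<in> D" "v - al d \<in> U" using X1_decomp by (auto simp: cg_def)
    moreover have "v = (v - al d) + al d" by simp
    ultimately show "v \<in> (\<lambda>(d, u). u + al d) ` (D \<times> U)" by force
  qed
  moreover have finU: "finite U" using U V finite_subset by blast
  ultimately have "card V \<le> card D * card U"
    using finite_D by (metis card_cartesian_product finite_cartesian_product surj_card_le)
  then have "card D * card K \<le> card D * card U" using card_DK by simp
  moreover have "card D > 0" using finite_D D_closed(3) card_gt_0_iff by blast
  ultimately have "card K \<le> card U" by simp
  then show ?thesis using U(3) K V finite_subset card_seteq by metis
qed

text \<open>The same covering, now by cosets of \<open>K\<close>, is by cardinality free of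
  overlaps: \<open>al\<close> embeds \<open>D\<close> in \<open>V/K\<close>.\<close>

lemma al_inj:
  assumes d: "d \<in> D" "al d \<in> K" shows "d = 0"
proof -
  let ?f = "\<lambda>(d, u). u + al d"
  have "?f ` (D \<times> K) = V"
  proof (intro equalityI subsetI)
    fix v assume "v \<in> V"
    then obtain d where d: "d \<in> D" "cg U v (al d)" by (rule X1_decomp)
    then have "v - al d \<in> K" using U_eq_K by (simp add: cg_def)
    moreover have "v = (v - al d) + al d" by simp
    ultimately show "v \<in> ?f ` (D \<times> K)" using d(1) by force
  qed (use K_closed(6) al_V D_P V_add in auto)
  then have inj: "inj_on ?f (D \<times> K)"
    using card_DK finite_D V K finite_subset[of K V]
    by (intro eq_card_imp_inj_on) (auto simp: card_cartesian_product)
  have "(d, 0) = (0, al d)"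
    using inj_onD[OF inj, of "(d, 0)" "(0, al d)"] d al_0 D_closed(3) K_closed(3) by auto
  then show "d = 0" by simp
qed

lemma UK: "U \<subseteq> K" using U_eq_K by simp

text \<open>The complement of \<open>D\<close> in \<open>C\<close> formed by the kernel of the crossed homomorphism \<open>al\<close> modulo \<open>K\<close>.\<close>

definition "C1 = {c \<in> C. al c \<in> K}"

lemma C1_subgrp: "subgrp C1" and C1_C: "c \<in> C1 \<Longrightarrow> c \<in> C"
proof -
  show C: "c \<in> C" if "c \<in> C1" for c using that by (simp add: C1_def)
  show "subgrp C1"
  proof (rule subgrpI)
    show "0 \<in> C1" using C_closed(3) al_0 K_closed(3) by (simp add: C1_def)
    show "c + d \<in> C1" if "c \<in> C1" "d \<in> C1" for c d
      using that C_closed(1) al_add C_P K_closed(1,5) pi_Q by (simp add: C1_def)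
    show "- c \<in> C1" if c: "c \<in> C1" for c
    proof -
      have cP: "c \<in> P" "al c \<in> K" using c C_P by (auto simp: C1_def)
      have "al c + (pi c + al (- c) - pi c) = 0"
        using al_add[OF cP(1) P_minus[OF cP(1)]] al_0 by simp
      then have "pi c + al (- c) - pi c = - al c" by (metis minus_unique)
      then have "- pi c + - al c - - pi c = al (- c)"
        by (simp add: group_simps add_eq_0_iff flip: diff_conv_add_uminus)
          (metis add.assoc diff_add_cancel minus_add_cancel)
      moreover have "- pi c + - al c - - pi c \<in> K"
        using K_closed(2,5) cP pi_Q subgrp_minus[OF Q(1)] by blast
      ultimately show ?thesis using c C_closed(2) by (simp add: C1_def)
    qed
  qed
qed

lemma pi_C1: "subgrp (pi ` C1)" "pi ` C1 \<subseteq> Q"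
  using subgrp_pi[OF C1_subgrp] C1_C C_P pi_Q by auto

lemma complements_C1: "complements Q M (pi ` C1)"
  unfolding complements_def
proof (intro conjI ballI)
  show "M \<inter> pi ` C1 = {0}"
  proof (intro equalityI subsetI)
    fix q assume "q \<in> M \<inter> pi ` C1"
    then obtain c where "c \<in> C1" "q = pi c" "pi c \<in> M" by blast
    then have "c \<in> D" "al c \<in> K" by (auto simp: C1_def D_def)
    then have "c = 0" by (rule al_inj)
    then show "q \<in> {0}" using \<open>q = pi c\<close> pi_0 by simp
  qed (use M_closed(3) subgrp_0[OF pi_C1(1)] in auto)
  fix q assume "q \<in> Q"
  then obtain m c where mc: "m \<in> M" "c \<in> C" "q = m + pi c" by (rule Q_decomp)
  have alc: "al c \<in> V" using al_V C_P mc by blast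
  \<comment> \<open>Correcting \<open>c\<close> by an element of \<open>D\<close> with opposite
    \<open>V\<close>-component moves it into \<open>C1\<close>; the correction is visible in
    \<open>Q\<close> only through \<open>M\<close>, which absorbs it.\<close>
  obtain d where d: "d \<in> D" "cg K (- al c) (al d)"
    using X1_decomp[OF V_minus[OF alc]] U_eq_K by metis
  have "cg K (- al c + al c) (al d + al c)" using cg_add[OF K(1) d(2) cg_refl[OF K(1) alc]] .
  then have "cg K 0 (al d + al c)" by simp
  then have "cg K 0 (al (d + c))"
    by (rule cg_trans[OF K(1) _ cg_sym[OF K(1) al_add_cg[OF K(1) UK d(1) C_P[OF mc(2)]]]])
  then have "al (d + c) \<in> K" using K_closed(2)[of "- al (d + c)"] by (simp add: cg_def)
  then have "d + c \<in> C1" using C_closed(1) D_C d mc by (simp add: C1_def)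
  moreover have "q = (m - pi d) + pi (d + c)"
    using mc pi_add[OF D_P[OF d(1)] C_P[OF mc(2)]]
    by (simp add: group_simps del: add_uminus_conv_diff)
  moreover have "m - pi d \<in> M" using M_closed(4) mc D_M d by blast
  ultimately show "\<exists>x\<in>M. \<exists>c\<in>pi ` C1. q = x + c" by blast
qed (use pi_C1 in auto)

text \<open>\<open>al\<close> is additive on \<open>D\<close> modulo \<open>K\<close> and
  \<open>V\<close> has exponent \<open>p\<close>, so the \<open>p\<close>-fold multiple has its
  \<open>V\<close>-component in \<open>K\<close> and vanishes by \<open>al_inj\<close>. This is what
  makes \<open>tot_moved_points\<close> applicable to \<open>D\<close>.\<close>

lemma D_p_mult:
  assumes d: "d \<in> D" shows "((+) d ^^ p) 0 = 0"
proof -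
  have "((+) d ^^ n) 0 \<in> D \<and> (\<exists>v\<in>V. cg K (al (((+) d ^^ n) 0)) v \<and>
      (\<forall>x\<in>\<Omega>. co v x = (int n * co (al d) x) mod pp))" for n
  proof (induction n)
    case 0
    then show ?case
      using D_closed(3) al_0 V_0 cg_refl[OF K(1) V_0] co_0 by (auto intro!: bexI[of _ 0])
  next
    case (Suc n)
    let ?e = "((+) d ^^ n) 0"
    obtain v where e: "?e \<in> D" and v: "v \<in> V" "cg K (al ?e) v"
      "\<forall>x\<in>\<Omega>. co v x = (int n * co (al d) x) mod pp" using Suc by blast
    have ald: "al d \<in> V" using al_V D_P d by blast
    have "cg K (al (d + ?e)) (al d + v)"
      using cg_trans[OF K(1) al_add_cg[OF K(1) UK d D_P[OF e]] cg_add[OF K(1) cg_refl[OF K(1) ald] v(2)]] .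
    moreover have "co (al d + v) x = (int (Suc n) * co (al d) x) mod pp" if "x \<in> \<Omega>" for x
      using co_add[OF ald v(1) that] v(3) that by (simp add: mod_simps algebra_simps)
    ultimately show ?case using D_closed(1)[OF d e] V_add[OF ald v(1)] by auto
  qed
  from this[of p] obtain v where *: "((+) d ^^ p) 0 \<in> D" "v \<in> V" "cg K (al (((+) d ^^ p) 0)) v"
    "\<forall>x\<in>\<Omega>. co v x = (pp * co (al d) x) mod pp" by auto
  have "v = 0" using co_inj[OF *(2)] *(4) by simp
  then have "al (((+) d ^^ p) 0) \<in> K" using *(3) by (simp add: cg_def)
  then show ?thesis using al_inj *(1) by blast
qed

text \<open>The element \<open>d\<close> of \<open>D\<close> that represents the unit vector at \<open>base\<close> is centralised by the
  stabiliser of the \<open>M\<close>-orbit of \<open>base\<close>. Its coordinates on the points of this orbit fixed by \<open>d\<close>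
  are therefore invariant under the stabiliser and have nonzero sum.\<close>

lemma fixed_point_C1: "\<exists>y\<in>B0. \<forall>q\<in>stab (pi ` C1). act q y = y"
proof -
  obtain v where v: "v \<in> V" "\<And>y. y \<in> \<Omega> \<Longrightarrow> co v y = (if y = base then 1 mod pp else 0)"
    using delta_ex[OF \<Omega>(2), of 1] by blast
  obtain d where d: "d \<in> D" "cg U v (al d)" using X1_decomp[OF v(1)] .
  have ald: "al d \<in> V" and dP: "d \<in> P" and piQ: "pi d \<in> Q" using al_V pi_Q D_P d by auto
  have "tot B0 v = (\<Sum>y\<in>B0. if y = base then 1 mod pp else 0) mod pp"
    unfolding tot_def using v(2) B0 by (intro arg_cong[of _ _ "\<lambda>x. x mod pp"] sum.cong) auto
  then have "tot B0 v = 1" using B0 p_gt_1 by simp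
  moreover have "tot B0 (v - al d) = 0" using d(2) \<Omega>(2) by (auto simp: cg_def U_def zero_sum_def)
  ultimately have "(1 - tot B0 (al d)) mod pp = 0" using tot_diff[OF v(1) ald B0(1)] by simp
  then have tot1: "tot B0 (al d) \<noteq> 0" using p_gt_1 by auto
  define F where "F = {y \<in> B0. act (pi d) y = y}"
  have actM: "acts act M \<Omega>" using act_subset[OF M(1,2)] .
  have d_inv: "act (pi d) ` B0 = B0" using act_orb_self[OF M(1,2) D_M[OF d(1)] \<Omega>(2)] .
  \<comment> \<open>The moved points of \<open>B0\<close> contribute nothing, so the nonzero sum
    over \<open>B0\<close> is carried entirely by the fixed points in \<open>F\<close>.\<close>
  have "tot (B0 - F) (al d) = 0"
  proof (rule tot_moved_points[OF dP D_p_mult[OF d(1)]])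
    show "B0 - F \<subseteq> \<Omega>" using B0 by blast
    show "act (pi d) y \<noteq> y" if "y \<in> B0 - F" for y using that by (auto simp: F_def)
    show "act (pi d) y \<in> B0 - F" if y: "y \<in> B0 - F" for y
    proof -
      have y': "y \<in> \<Omega>" using y B0 by blast
      have "act (pi d) y \<notin> F"
      proof
        assume "act (pi d) y \<in> F"
        then have "act (- pi d) (act (pi d) (act (pi d) y)) = act (- pi d) (act (pi d) y)"
          by (simp add: F_def)
        then have "act (pi d) y = y" using acts_inv1[OF actQ piQ] acts_in[OF actQ piQ] y' by simp
        then show False using y by (auto simp: F_def)
      qed
      then show ?thesis using y d_inv by blast
    qed
  qed
  moreover have "tot B0 (al d) = (tot (B0 - F) (al d) + tot F (al d)) mod pp"
    unfolding tot_def using B0(3) sum.subset_diff[of F B0 "co (al d)"] by (simp add: F_def mod_simps)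
  ultimately have "\<not> pp dvd sum (co (al d)) F" using tot1 by (auto simp: tot_def)
  define S where "S = stab (pi ` C1)"
  have S: "subgrp S" "S \<subseteq> Q" using stab_subgrp[OF pi_C1] pi_C1(2) by (auto simp: S_def stab_def)
  \<comment> \<open>\<open>s\<close> and some \<open>m\<close> in \<open>M\<close> send
    \<open>base\<close> to the same point, hence conjugate the unit vector \<open>v\<close> to the
    same unit vector; conjugation by \<open>m\<close> changes nothing modulo \<open>U\<close>. So
    \<open>d\<close> and its conjugate by \<open>c\<close> have congruent
    \<open>V\<close>-components and agree by \<open>al_inj\<close>.\<close>
  have S_conj: "\<exists>c\<in>C1. s = pi c \<and> c + d - c = d" if s: "s \<in> S" for s
  proof -
    obtain c where c: "c \<in> C1" "s = pi c" "act s base \<in> B0" using s by (auto simp: S_def stab_def)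
    then obtain m where m: "m \<in> M" "act s base = act m base" by (auto simp: orb_def)
    have sQ: "s \<in> Q" and cC: "c \<in> C" and mQ: "m \<in> Q" using S s c C1_C M_closed(6) m by auto
    let ?e = "c + d - c"
    have e: "?e \<in> D" using D_conj(1)[OF cC d(1)] .
    have "s + v - s = m + v - m"
    proof (rule co_eq[OF conjV[OF sQ v(1)] conjV[OF mQ v(1)]])
      have delta: "co (q + v - q) x = (if x = act q base then 1 mod pp else 0)"
        if q: "q \<in> Q" and x: "x \<in> \<Omega>" for q x
      proof -
        let ?y = "act (- q) x"
        have y: "?y \<in> \<Omega>" "act q ?y = x"
          using acts_in[OF actQ subgrp_minus[OF Q(1) q] x] acts_inv2[OF actQ q x] by auto
        have "?y = base \<longleftrightarrow> x = act q base" using y acts_inv1[OF actQ q \<Omega>(2)] by auto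
        then show ?thesis using co_Q[OF q v(1) y(1)] y v(2)[OF y(1)] by simp
      qed
      fix x assume "x \<in> \<Omega>"
      then show "co (s + v - s) x = co (m + v - m) x" using delta sQ mQ m(2) by simp
    qed
    then have "cg U (s + v - s) v" using cg_M[OF U(1) subset_refl m(1) v(1)] by simp
    moreover have "cg U (s + v - s) (s + al d - s)" using cg_conj[OF sQ U_stable[OF sQ] d(2)] .
    moreover have "cg U (al ?e) (s + al d - s)"
      using al_conj_cg[OF U(1) subset_refl cC d(1)] c(2) by simp
    ultimately have "cg U (al ?e) (al d)"
      using d(2) cg_trans[OF U(1)] cg_sym[OF U(1)] by blast
    then have "cg U (al (?e + - d)) (al d + - al d)"
      using al_add_cg[OF U(1) subset_refl e P_minus[OF dP]] cg_trans[OF U(1)]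
        cg_add[OF U(1) _ al_minus_cg[OF U(1) subset_refl d(1)]] by blast
    then have "al (?e - d) \<in> K" using U(3) by (auto simp: cg_def)
    then have "?e - d = 0" using al_inj D_closed(4)[OF e d(1)] by blast
    then show ?thesis using c by auto
  qed
  have F_S: "act s y \<in> F \<and> co (al d) (act s y) = co (al d) y" if s: "s \<in> S" and y: "y \<in> F" for s y
  proof -
    obtain c where c: "c \<in> C1" "s = pi c" "c + d - c = d" using S_conj[OF s] by blast
    have cC: "c \<in> C" and cP: "c \<in> P" and sQ: "s \<in> Q" using c C1_C C_P S s by auto
    have y': "y \<in> \<Omega>" "y \<in> B0" "act (pi d) y = y" using y B0 by (auto simp: F_def)
    let ?y = "act s y"
    have y1: "?y \<in> \<Omega>" "?y \<in> B0"
      using acts_in[OF actQ sQ y'(1)] stab_image[of s "pi ` C1"] s pi_C1 y' by (auto simp: S_def)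
    have cd: "c + d = d + c" using c(3) by (metis diff_add_cancel)
    have "act (pi d) ?y = act (pi d + s) y" using acts_add[OF actQ piQ sQ y'(1)] by simp
    also have "pi d + s = s + pi d" using cd pi_add[OF cP dP] pi_add[OF dP cP] c(2) by simp
    also have "act (s + pi d) y = ?y" using acts_add[OF actQ sQ piQ y'(1)] y'(3) by simp
    finally have fix_y: "act (pi d) ?y = ?y" .
    \<comment> \<open>Both sides are \<open>al\<close> of the commuting sum of \<open>c\<close> and
      \<open>d\<close>. At a point fixed by \<open>pi d\<close> the twisted and untwisted
      coordinates of \<open>al c\<close> agree and cancel, so the coordinate of \<open>al d\<close>
      is constant along \<open>S\<close>.\<close>
    have "al c + (s + al d - s) = al d + (pi d + al c - pi d)"
      using al_add[OF cP dP] al_add[OF dP cP] cd c(2) by simp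
    then have "co (al c + (s + al d - s)) ?y = co (al d + (pi d + al c - pi d)) ?y" by simp
    moreover have "co (s + al d - s) ?y = co (al d) y" using co_Q[OF sQ ald y'(1)] .
    moreover have "co (pi d + al c - pi d) ?y = co (al c) ?y"
      using co_Q[OF piQ al_V[OF cP] y1(1)] fix_y by simp
    ultimately have "(co (al c) ?y + co (al d) y) mod pp = (co (al d) ?y + co (al c) ?y) mod pp"
      using co_add[OF al_V[OF cP] conjV[OF sQ ald] y1(1)]
        co_add[OF ald conjV[OF piQ al_V[OF cP]] y1(1)] by simp
    then have "co (al d) y mod pp = co (al d) ?y mod pp"
      by (metis (no_types, lifting) add.commute add_diff_cancel_right' mod_diff_left_eq)
    then show ?thesis using co_mod ald y' y1 fix_y by (simp add: F_def)
  qed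
  have actS: "acts act S F"
    using S F_S act_subset[OF S] B0 by (auto simp: acts_def F_def)
  obtain a where S_card: "finite S" "card S = p ^ a" using p_subgrp[OF S] by blast
  \<comment> \<open>Without a fixed point, \<open>F\<close> would split into nontrivial orbits of
    the \<open>p\<close>-group \<open>S\<close> with constant coordinates, and the sum over
    \<open>F\<close> would be divisible by \<open>p\<close>.\<close>
  have "\<exists>y\<in>F. \<forall>q\<in>S. act q y = y"
  proof (rule ccontr)
    assume no: "\<not> ?thesis"
    have "pp dvd sum (co (al d)) F"
    proof (rule dvd_sum_orbits[OF actS])
      show "finite F" using B0 by (simp add: F_def)
      show "pp dvd sum (co (al d)) (orb act S y)" if "y \<in> F" for y
        using that no F_S by (intro orb_fixed_sum_dvd[OF p actS that S_card]) auto
    qed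
    then show False using \<open>\<not> pp dvd sum (co (al d)) F\<close> by blast
  qed
  then show ?thesis by (auto simp: S_def F_def)
qed

lemma small_orbit_C1: "\<exists>y\<in>\<Omega>. card (orb act (pi ` C1) y) \<le> card (orb act M ` \<Omega>)"
  using fixed_point_C1 fixed_imp_card[OF pi_C1] B0 by blast

end

end

text \<open>The bound on the orbit lengths carries the induction: if \<open>N\<close> does not contain the base group, a suitable
  complement exists only over a complement in the quotient that has a short orbit.\<close>

definition stable_complements ::
  "'a::group_add set \<Rightarrow> 'a set \<Rightarrow> ('a \<Rightarrow> 'x \<Rightarrow> 'x) \<Rightarrow> 'x set \<Rightarrow> bool" where
  "stable_complements G H act S \<longleftrightarrow>
     (\<forall>N C. subgrp N \<longrightarrow> N \<subseteq> G \<longrightarrow> conj_stable G N \<longrightarrow> complements G N C \<longrightarrow>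
       (\<exists>C'. complements G N C' \<and> conj_stable H C' \<and>
         (\<forall>x\<in>S. \<exists>y\<in>S. card (orb act C' y) \<le> card (orb act C x))))"

lemma stable_complementsD:
  assumes "stable_complements G H act S" "subgrp N" "N \<subseteq> G" "conj_stable G N" "complements G N C"
  obtains C' where "complements G N C'" "conj_stable H C'"
    "\<And>x. x \<in> S \<Longrightarrow> \<exists>y\<in>S. card (orb act C' y) \<le> card (orb act C x)"
  using assms unfolding stable_complements_def by meson

text \<open>The data of the second case. \<open>w\<close> marks an orbit of \<open>R\<close> that
  meets every \<open>M\<close>-orbit once, \<open>U = K\<close> results from \<open>X1 = V\<close>,
  and excluding \<open>N = {0}\<close> ensures that \<open>B0\<close> has more than one
  point.\<close>

locale wreath_split = wreath_complement +
  fixes R :: "'a set" and w :: 'b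
  assumes R: "complements Q M R" "conj_stable H R"
    and w: "w \<in> B0" "\<And>r. r \<in> stab R \<Longrightarrow> act r w = w"
    and U_K: "U = K" and N_nonzero: "N \<noteq> {0}"
begin

section \<open>An \<open>H\<close>-invariant complement lying over \<open>R\<close>\<close>

lemma R_subgrp: "subgrp R" and R_Q: "R \<subseteq> Q"
  using R by (auto simp: complements_def)

lemma R_closed: "r \<in> R \<Longrightarrow> s \<in> R \<Longrightarrow> r + s \<in> R" "r \<in> R \<Longrightarrow> - r \<in> R" "0 \<in> R"
  using R_subgrp by (auto intro: subgrp_add subgrp_minus subgrp_0)

lemma actR: "acts act R \<Omega>"
  using act_subset R_subgrp R_Q by blast

lemma h_minus: "h \<in> H \<Longrightarrow> - h \<in> H"
  using subgrp_minus[OF H(1)] .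

lemma H_R: "h \<in> H \<Longrightarrow> r \<in> R \<Longrightarrow> h + r - h \<in> R" "h \<in> H \<Longrightarrow> r \<in> R \<Longrightarrow> - h + r + h \<in> R"
  using conj_stableD[OF R(2)] conj_stableD'[OF R(2) H(1)] by auto

text \<open>\<open>M\<close> is not assumed to be normalised by \<open>H\<close>. The orbit of
  \<open>base\<close> is preserved because \<open>H\<close> respects the orbits of all normal
  subgroups of \<open>Q\<close> and fixes \<open>base\<close>.\<close>

lemma H_B0: "h \<in> H \<Longrightarrow> x \<in> B0 \<Longrightarrow> act h x \<in> B0"
  using blocks[OF M \<Omega>(2)] base by simp

lemma act_h_conj:
  assumes "h \<in> H" "r \<in> R" "x \<in> \<Omega>"
  shows "act r (act h x) = act h (act (- h + r + h) x)"
proof -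
  have "- h + r + h \<in> Q" using H_R(2) assms R_Q by blast
  then have "act h (act (- h + r + h) x) = act (h + (- h + r + h) - h) (act h x)"
    by (rule actHQ[OF assms(1) _ assms(3)])
  also have "h + (- h + r + h) - h = r" by (simp add: group_simps del: add_uminus_conv_diff)
  finally show ?thesis by simp
qed

text \<open>\<open>H\<close> may move \<open>w\<close>, so \<open>w\<close> is replaced by its
  \<open>H\<close>-orbit. The length divides \<open>card H\<close> and is thus invertible modulo
  \<open>p\<close>.\<close>

definition "E = orb act H w"

lemma E: "E \<subseteq> B0" "E \<subseteq> \<Omega>" "w \<in> E" "coprime (card E) p" "finite E"
proof -
  have w\<Omega>: "w \<in> \<Omega>" using w B0 by blast
  show "E \<subseteq> B0" using H_B0 w by (auto simp: E_def orb_def)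
  then show "E \<subseteq> \<Omega>" "finite E" using B0 finite_subset by auto
  show "w \<in> E" using orb_self[OF actH w\<Omega>] by (simp add: E_def)
  have "card E dvd card H" unfolding E_def by (rule card_orb_dvd[OF actH w\<Omega> H(2)])
  then show "coprime (card E) p" using H(3) coprime_divisors[of "card E" "card H" p p] by simp
qed

lemma E_H: "h \<in> H \<Longrightarrow> e \<in> E \<Longrightarrow> act h e \<in> E"
  using orb_trans[OF actH, of w e "act h e"] w(1) B0 by (auto simp: E_def orb_def)

lemma stab_conj:
  assumes "h \<in> H" "r \<in> stab R" shows "- h + r + h \<in> stab R"
proof -
  have r: "r \<in> R" "act r base \<in> B0" using assms by (auto simp: stab_def)
  have "act (- h + r + h) base \<in> \<Omega>" using acts_in[OF actR H_R(2)[OF assms(1) r(1)]] \<Omega> by blast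
  then have "act (- h + r + h) base = act (- h) (act h (act (- h + r + h) base))"
    using acts_inv1[OF actH assms(1)] by simp
  also have "\<dots> = act (- h) (act r (act h base))" using act_h_conj[OF assms(1) r(1) \<Omega>(2)] by simp
  also have "\<dots> = act (- h) (act r base)" using base assms by simp
  finally show ?thesis using H_B0[OF h_minus[OF assms(1)] r(2)] H_R(2)[OF assms(1) r(1)]
    by (simp add: stab_def)
qed

lemma E_fixed:
  assumes "e \<in> E" "r \<in> stab R" shows "act r e = e"
proof -
  obtain h where h: "h \<in> H" "e = act h w" using assms by (auto simp: E_def orb_def)
  have "act r e = act h (act (- h + r + h) w)"
    using act_h_conj[of h r w] h assms w(1) B0 by (auto simp: stab_def)
  then show ?thesis using w(2)[OF stab_conj[OF h(1) assms(2)]] h by simp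
qed

lemma rep: 
  assumes "x \<in> \<Omega>" obtains r where "r \<in> R" "x \<in> orb act M (act r base)"
proof -
  obtain q where q: "q \<in> Q" "x = act q base" using trans[OF \<Omega>(2) assms] by blast
  obtain m r where mr: "m \<in> M" "r \<in> R" "q = m + r" using complements_decomp[OF R(1) q(1)] .
  have "x = act m (act r base)" using q mr acts_add[OF actQ _ _ \<Omega>(2)] M_closed(6) R_Q by auto
  then show thesis using that mr by (auto simp: orb_def)
qed

lemma orb_r: "r \<in> R \<Longrightarrow> orb act M (act r base) = act r ` B0"
  using orb_conj[of r base] R_Q \<Omega>(2) by auto

lemma diff_stab:
  assumes "r \<in> R" "s \<in> R" "y \<in> B0" "act r y \<in> act s ` B0" shows "- s + r \<in> stab R"
proof -
  obtain b where b: "act r y = act s b" "b \<in> B0" using assms(4) by (rule imageE)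
  have y: "y \<in> \<Omega>" using assms(3) B0 by blast
  have "act (- s + r) y = act (- s) (act r y)"
    by (rule acts_add[OF actR R_closed(2)[OF assms(2)] assms(1) y])
  also have "\<dots> = b" unfolding b(1) using acts_inv1[OF actR assms(2)] b(2) B0(1) by blast
  finally have "act (- s + r) y \<in> B0" using b(2) by blast
  then show ?thesis
    using stab_iff[OF R_closed(1)[OF R_closed(2)[OF assms(2)] assms(1)] R_Q assms(3)] by blast
qed

lemma same_act:
  assumes "r \<in> R" "s \<in> R" "y \<in> \<Omega>" "act (- s + r) y = y" shows "act r y = act s y"
proof -
  have "act (s + (- s + r)) y = act s (act (- s + r) y)"
    using acts_add[OF actR] assms R_closed by blast
  then show ?thesis using assms(4) by (simp add: add.assoc[symmetric])
qed

text \<open>Translates of \<open>E\<close> by \<open>R\<close> that meet a common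
  \<open>M\<close>-orbit agree point by point, since the two translating elements differ by one that
  stabilises \<open>B0\<close> and so fixes \<open>E\<close>. Hence each \<open>M\<close>-orbit
  contains a single translate of \<open>E\<close>.\<close>

lemma E_translate:
  assumes "r \<in> R" "s \<in> R" "e \<in> E" "act r e \<in> act s ` B0" shows "act r e = act s e"
  using same_act[OF assms(1,2)] E_fixed[OF assms(3) diff_stab[OF assms(1,2)]] assms E by blast

text \<open>\<open>L\<close> consists of the functions that are supported on the translates of \<open>E\<close> under \<open>R\<close> and constant on
  each of them. Since \<open>card E\<close> is prime to \<open>p\<close>, such a function is determined by its sums over the \<open>M\<close>-orbits.\<close>

definition "EO = (\<Union>r\<in>R. act r ` E)"

definition "L = {v \<in> V. (\<forall>x\<in>\<Omega>. x \<notin> EO \<longrightarrow> co v x = 0) \<and>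
  (\<forall>r\<in>R. \<forall>e\<in>E. co v (act r e) = co v (act r w))}"

lemma EO_subset: "EO \<subseteq> \<Omega>"
  using acts_in[OF actR] E by (auto simp: EO_def)

lemma w\<Omega>: "w \<in> \<Omega>" using w B0 by blast

lemma L_V: "v \<in> L \<Longrightarrow> v \<in> V" by (simp add: L_def)

lemma L_subgrp: "subgrp L"
proof (rule subgrpI)
  have e\<Omega>: "act r e \<in> \<Omega>" if "r \<in> R" "e \<in> E" for r e using that acts_in[OF actR] E by blast
  have ww: "act r w \<in> \<Omega>" if "r \<in> R" for r using that acts_in[OF actR] w\<Omega> by blast
  show "0 \<in> L" using V_0 co_0 e\<Omega> ww by (simp add: L_def)
  show "u + v \<in> L" if "u \<in> L" "v \<in> L" for u v
    using that V_add co_add e\<Omega> ww by (simp add: L_def)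
  show "- v \<in> L" if "v \<in> L" for v
    using that V_minus co_minus e\<Omega> ww by (simp add: L_def)
qed

lemma L_R: "conj_stable R L"
proof (rule conj_stableI)
  fix r v assume r: "r \<in> R" and v: "v \<in> L"
  have rQ: "r \<in> Q" "- r \<in> R" using r R_Q R_closed by auto
  have co: "co (r + v - r) x = co v (act (- r) x)" if "x \<in> \<Omega>" for x
    using co_Q[OF rQ(1) L_V[OF v] acts_in[OF actR rQ(2) that]] acts_inv2[OF actR r that] by simp
  have O: "x \<in> EO" if x: "act (- r) x \<in> EO" "x \<in> \<Omega>" for x
  proof -
    obtain s e where se: "s \<in> R" "e \<in> E" "act (- r) x = act s e" using x by (auto simp: EO_def)
    have "x = act r (act s e)" using acts_inv2[OF actR r x(2)] se by simp
    then have "x = act (r + s) e" using acts_add[OF actR r se(1)] se E by auto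
    then show ?thesis using R_closed(1)[OF r se(1)] se(2) by (auto simp: EO_def)
  qed
  have shift: "co (r + v - r) (act s e) = co v (act (- r + s) e)" if "s \<in> R" "e \<in> E" for s e
  proof -
    have e: "e \<in> \<Omega>" using that E by blast
    show ?thesis using co[OF acts_in[OF actR that(1) e]] acts_add[OF actR rQ(2) that(1) e] by simp
  qed
  have "co (r + v - r) (act s e) = co (r + v - r) (act s w)" if "s \<in> R" "e \<in> E" for s e
    using shift[OF that] shift[OF that(1) E(3)] v R_closed(1)[OF rQ(2) that(1)] that(2)
    by (simp add: L_def)
  moreover have "co (r + v - r) x = 0" if "x \<in> \<Omega>" "x \<notin> EO" for x
    using co[OF that(1)] O[OF _ that(1)] that acts_in[OF actR rQ(2) that(1)] v by (auto simp: L_def)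
  ultimately show "r + v - r \<in> L" using conjV[OF rQ(1) L_V[OF v]] by (simp add: L_def)
qed

text \<open>\<open>h\<close> takes the translate of \<open>E\<close> by \<open>r\<close> to the
  translate by \<open>h + r - h\<close> and multiplies all coordinates by one common factor, so both
  the support and the constancy on translates survive.\<close>

lemma L_H: "conj_stable H L"
proof (rule conj_stableI)
  fix h v assume h: "h \<in> H" and v: "v \<in> L"
  have hm: "- h \<in> H" using h_minus h .
  have vV: "v \<in> V" using v L_V by blast
  obtain a where a: "\<And>x. x \<in> \<Omega> \<Longrightarrow> co (h + v - h) (act h x) = a * co v x mod pp"
    using co_H[OF h] vV by blast
  have co: "co (h + v - h) x = a * co v (act (- h) x) mod pp" if "x \<in> \<Omega>" for x
    using a[OF acts_in[OF actH hm that]] acts_inv2[OF actH h that] by simp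
  have move: "act (- h) (act r e) = act (- h + r + h) (act (- h) e)"
    if "r \<in> R" "e \<in> E" for r e
  proof -
    have e: "e \<in> \<Omega>" "r \<in> Q" using that E R_Q by auto
    show ?thesis using actHQ[OF hm e(2,1)] by simp
  qed
  have O: "x \<in> EO" if x: "act (- h) x \<in> EO" "x \<in> \<Omega>" for x
  proof -
    obtain s e where se: "s \<in> R" "e \<in> E" "act (- h) x = act s e" using x by (auto simp: EO_def)
    have e: "e \<in> \<Omega>" "s \<in> Q" using se E R_Q by auto
    have "x = act h (act s e)" using acts_inv2[OF actH h x(2)] se by simp
    also have "\<dots> = act (h + s - h) (act h e)" using actHQ[OF h e(2,1)] .
    finally show ?thesis using H_R(1)[OF h se(1)] E_H[OF h se(2)] by (auto simp: EO_def)
  qed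
  have "co (h + v - h) (act r e) = co (h + v - h) (act r w)" if re: "r \<in> R" "e \<in> E" for r e
  proof -
    let ?r = "- h + r + h"
    have r: "?r \<in> R" using H_R(2)[OF h re(1)] .
    have mem: "act (- h) e \<in> E" "act (- h) w \<in> E" using E_H[OF hm] re E by auto
    have "co v (act ?r (act (- h) e)) = co v (act ?r (act (- h) w))"
      using v r mem by (simp add: L_def)
    moreover have "act r e \<in> \<Omega>" "act r w \<in> \<Omega>" using acts_in[OF actR re(1)] re E w\<Omega> by auto
    ultimately show ?thesis using co move[OF re] move[OF re(1) E(3)] by simp
  qed
  moreover have "co (h + v - h) x = 0" if "x \<in> \<Omega>" "x \<notin> EO" for x
    using co[OF that(1)] O[OF _ that(1)] that acts_in[OF actH hm that(1)] v by (auto simp: L_def)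
  ultimately show "h + v - h \<in> L" using conj_stableD[OF HV h vV] by (simp add: L_def)
qed

text \<open>By \<open>E_translate\<close> the \<open>M\<close>-orbit meets \<open>EO\<close> in one
  translate of \<open>E\<close> only, and \<open>v\<close> is constant there and zero on the rest of
  the orbit.\<close>

lemma tot_L:
  assumes v: "v \<in> L" and r: "r \<in> R"
  shows "tot (orb act M (act r base)) v = (int (card E) * co v (act r w)) mod pp"
proof -
  have rQ: "r \<in> Q" using r R_Q by blast
  have sub: "act r ` E \<subseteq> act r ` B0" using E by blast
  have "(\<Sum>x\<in>act r ` B0. co v x) = (\<Sum>x\<in>act r ` E. co v x)"
  proof (rule sum.mono_neutral_right[OF _ sub])
    show "finite (act r ` B0)" using B0 by blast
    show "\<forall>x\<in>act r ` B0 - act r ` E. co v x = 0"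
    proof
      fix x assume x: "x \<in> act r ` B0 - act r ` E"
      have "x \<notin> EO"
      proof
        assume "x \<in> EO"
        then obtain s e where se: "s \<in> R" "e \<in> E" "x = act s e" by (auto simp: EO_def)
        then have "x = act r e" using E_translate[OF se(1) r se(2)] x by blast
        then show False using x se by blast
      qed
      moreover have "x \<in> \<Omega>" using x acts_in[OF actR r] B0 by blast
      ultimately show "co v x = 0" using v by (simp add: L_def)
    qed
  qed
  also have "\<dots> = (\<Sum>x\<in>act r ` E. co v (act r w))"
    using v r by (intro sum.cong) (auto simp: L_def)
  also have "\<dots> = int (card (act r ` E)) * co v (act r w)" by simp
  also have "card (act r ` E) = card E"
    using act_bij[OF rQ] E(2) by (intro card_image) (auto simp: bij_betw_def dest: inj_on_subset)
  finally show ?thesis unfolding tot_def orb_r[OF r] by simp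
qed

lemma coprime_E: "coprime (int (card E)) pp"
  using E(4) by simp

lemma L_K: "v \<in> L \<Longrightarrow> v \<in> K \<Longrightarrow> v = 0"
proof -
  assume v: "v \<in> L" "v \<in> K"
  have zero: "co v (act r w) = 0" if r: "r \<in> R" for r
  proof -
    have "act r base \<in> \<Omega>" using acts_in[OF actR r \<Omega>(2)] .
    moreover have "v \<in> U" using v(2) U_K by simp
    ultimately have "tot (orb act M (act r base)) v = 0" unfolding U_def zero_sum_def by blast
    then have "(int (card E) * co v (act r w)) mod pp = 0" using tot_L[OF v(1) r] by simp
    then have "pp dvd int (card E) * co v (act r w)" by auto
    then have "pp dvd co v (act r w)"
      using coprime_E by (simp add: coprime_dvd_mult_right_iff coprime_commute)
    then show ?thesis
      using co_mod[OF L_V[OF v(1)] acts_in[OF actR r w\<Omega>]] by simp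
  qed
  show "v = 0"
  proof (rule co_inj[OF L_V[OF v(1)]])
    fix x assume x: "x \<in> \<Omega>"
    show "co v x = 0"
    proof (cases "x \<in> EO")
      case True
      then obtain r e where "r \<in> R" "e \<in> E" "x = act r e" by (auto simp: EO_def)
      then show ?thesis using v(1) zero by (simp add: L_def)
    qed (use v(1) x in \<open>simp add: L_def\<close>)
  qed
qed

lemma V_split:
  assumes v: "v \<in> V" obtains l where "l \<in> L" "v - l \<in> K"
proof -
  \<comment> \<open>\<open>s\<close> inverts \<open>card E\<close> modulo \<open>p\<close>. Giving
    each point of the translate of \<open>E\<close> the value \<open>s\<close> times the orbit sum
    of \<open>v\<close> reproduces that sum.\<close>
  obtain s t where st: "s * int (card E) + t * pp = 1"
    using bezout_int[of "int (card E)" pp] coprime_E by auto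
  obtain l where l: "l \<in> V"
    "\<forall>x\<in>\<Omega>. co l x = (if x \<in> EO then s * tot (orb act M x) v else 0) mod pp"
    using co_ex[of "\<lambda>x. if x \<in> EO then s * tot (orb act M x) v else 0"] by blast
  have co_l: "co l (act r e) = (s * tot (orb act M (act r base)) v) mod pp"
    if re: "r \<in> R" "e \<in> E" for r e
  proof -
    have r: "act r base \<in> \<Omega>" using acts_in[OF actR re(1) \<Omega>(2)] .
    have "act r e \<in> orb act M (act r base)" using orb_r re E by blast
    then have "orb act M (act r e) = orb act M (act r base)"
      by (rule orb_eq[OF act_subset[OF M(1,2)] r])
    moreover have "act r e \<in> EO" using re by (auto simp: EO_def)
    ultimately show ?thesis using l(2) EO_subset by auto
  qed
  have lL: "l \<in> L"
    using l co_l E(3) by (simp add: L_def)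
  have "v - l \<in> U"
    unfolding U_def zero_sum_def
  proof (intro CollectI conjI ballI)
    show "v - l \<in> V" using V_diff v l by blast
    fix x assume x: "x \<in> \<Omega>"
    obtain r where r: "r \<in> R" "x \<in> orb act M (act r base)" using rep[OF x] .
    let ?B = "orb act M (act r base)"
    have rb: "act r base \<in> \<Omega>" using acts_in[OF actR r(1) \<Omega>(2)] .
    have "tot ?B l = (int (card E) * s * tot ?B v) mod pp"
      using tot_L[OF lL r(1)] co_l[OF r(1) E(3)] by (simp add: mod_simps mult.assoc)
    also have "int (card E) * s = 1 - t * pp" using st by (simp add: algebra_simps)
    also have "((1 - t * pp) * tot ?B v) mod pp = tot ?B v mod pp"
      by (simp add: left_diff_distrib mult.assoc mult.left_commute[of _ pp]
          mod_diff_right_eq[symmetric])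
    finally have "tot ?B (v - l) = 0"
      using tot_diff[OF v l(1) orb_M_subset[OF rb]] by (simp add: mod_simps)
    then show "tot (orb act M x) (v - l) = 0"
      using orb_eq[OF act_subset[OF M(1,2)] rb r(2)] by simp
  qed
  then show thesis using that lL U_K by simp
qed

definition "C2 = {l + r |l r. l \<in> L \<and> r \<in> R}"

lemma C2_complements: "complements P N C2"
  unfolding complements_def
proof (intro conjI ballI)
  show "subgrp C2" unfolding C2_def by (rule subgrp_semidirect[OF L_subgrp R_subgrp L_R])
  show "C2 \<subseteq> P" using L_V R_Q by (auto simp: C2_def P_def)
  show "N \<inter> C2 = {0}"
  proof (intro equalityI subsetI)
    fix n assume n: "n \<in> N \<inter> C2"
    then obtain l r where lr: "l \<in> L" "r \<in> R" "n = l + r" by (auto simp: C2_def)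
    have "pi n = r" using pi_eq L_V R_Q lr by blast
    then have "r \<in> M" using n by (auto simp: M_def)
    then have "r = 0" using complements_Int[OF R(1)] lr by blast
    then have "l \<in> K" using n lr L_V by (auto simp: K_def)
    then show "n \<in> {0}" using L_K lr \<open>r = 0\<close> by simp
  next
    fix n :: 'a assume "n \<in> {0}"
    then show "n \<in> N \<inter> C2" using N_closed(3) subgrp_0[OF \<open>subgrp C2\<close>] by simp
  qed
  fix g assume g: "g \<in> P"
  obtain m r where mr: "m \<in> M" "r \<in> R" "pi g = m + r"
    using complements_decomp[OF R(1) pi_Q[OF g]] .
  obtain n where n: "n \<in> N" "m = pi n" using mr by (auto simp: M_def)
  have nP: "- n \<in> P" using N_P P_minus n by blast
  have gP: "- n + g \<in> P" using P_add nP g by blast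
  have "pi (- n + g) = r"
    using pi_add[OF nP g] pi_minus[OF N_P[OF n(1)]] mr n by (simp add: add.assoc[symmetric])
  then have g1: "- n + g = al (- n + g) + r" using al_pi[OF gP] by simp
  obtain l where l: "l \<in> L" "al (- n + g) - l \<in> K" using V_split[OF al_V[OF gP]] .
  let ?k = "al (- n + g) - l"
  have "g = n + (- n + g)" by (simp add: add.assoc[symmetric])
  also have "\<dots> = n + (?k + l + r)" using g1 by simp
  also have "\<dots> = (n + ?k) + (l + r)" by (simp only: add.assoc)
  finally have "g = (n + ?k) + (l + r)" .
  moreover have "n + ?k \<in> N" using n l K_closed(7) N_closed(1) by blast
  ultimately show "\<exists>x\<in>N. \<exists>c\<in>C2. g = x + c" using l mr unfolding C2_def by blast
qed

lemma C2_H: "conj_stable H C2"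
proof (rule conj_stableI)
  fix h c assume h: "h \<in> H" and "c \<in> C2"
  then obtain l r where lr: "l \<in> L" "r \<in> R" "c = l + r" by (auto simp: C2_def)
  have "h + c - h = (h + l - h) + (h + r - h)"
    unfolding lr(3) by (simp add: group_simps del: add_uminus_conv_diff)
  then show "h + c - h \<in> C2"
    using conj_stableD[OF L_H h lr(1)] H_R(1)[OF h lr(2)] unfolding C2_def by blast
qed

text \<open>The length is a power of \<open>p\<close>. Were it 1, all \<open>M\<close>-orbits would
  be points by transitivity of \<open>Q\<close>, so \<open>M\<close> would be trivial by
  faithfulness and \<open>K = U\<close> would be trivial as well, leaving
  \<open>N = {0}\<close>.\<close>

lemma p_dvd_card_B0: "p dvd card B0"
proof -
  have actM: "acts act M \<Omega>" using act_subset[OF M(1,2)] .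
  obtain a where a: "card M = p ^ a" "finite M" using p_subgrp[OF M(1,2)] by blast
  obtain b where b: "card B0 = p ^ b"
    using card_orb_dvd[OF actM \<Omega>(2) a(2)] a(1) p_power_dvdE[OF p] by metis
  have "b \<noteq> 0"
  proof
    assume "b = 0"
    then have "card B0 = 1" using b by simp
    then have B0': "B0 = {base}" using B0(2) by (metis card_1_singletonE singletonD)
    have triv: "act m x = x" if m: "m \<in> M" and x: "x \<in> \<Omega>" for m x
    proof -
      obtain q where q: "q \<in> Q" "x = act q base" using trans[OF \<Omega>(2) x] by blast
      have "orb act M x = act q ` B0" using orb_conj[OF q(1) \<Omega>(2)] q by simp
      then have "orb act M x = {x}" using B0' q by simp
      then show ?thesis using m by (auto simp: orb_def)
    qed
    have M0: "m = 0" if "m \<in> M" for m using faithful triv M_closed(6) that by blast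
    have "v = 0" if v: "v \<in> K" for v
    proof (rule co_inj[OF K_closed(6)[OF v]])
      fix x assume x: "x \<in> \<Omega>"
      have "orb act M x = {x}"
        using triv[OF _ x] M_closed(3) by (auto simp: orb_def intro!: image_eqI[of _ _ 0])
      moreover have "tot (orb act M x) v = 0" using v U_K x by (auto simp: U_def zero_sum_def)
      ultimately show "co v x = 0" using co_mod[OF K_closed(6)[OF v] x] by (simp add: tot_def)
    qed
    moreover have "n \<in> K" if n: "n \<in> N" for n
    proof -
      have "pi n = 0" using M0 n by (auto simp: M_def)
      then have "n \<in> V" using al_V[OF N_P[OF n]] al_pi[OF N_P[OF n]] by simp
      then show ?thesis using n by (simp add: K_def)
    qed
    ultimately show False using N_nonzero N_closed(3) by blast
  qed
  then show ?thesis using b by simp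
qed

text \<open>The fixed points of the stabiliser in the orbit \<open>B0\<close> are divisible by \<open>p\<close> in number, so
  the set \<open>E\<close> misses one of them.\<close>

lemma free_point:
  obtains y where "y \<in> \<Omega>" "card (orb act R y) \<le> card (orb act M ` \<Omega>)"
    "\<And>l r. l \<in> L \<Longrightarrow> r \<in> R \<Longrightarrow> co l (act r y) = 0"
proof -
  define S where "S = stab R"
  have S: "subgrp S" "S \<subseteq> Q" using stab_subgrp[OF R_subgrp R_Q] R_Q by (auto simp: S_def stab_def)
  have actS: "acts act S B0"
    using act_subset[OF S] stab_image[OF _ R_Q] B0(1) S
    by (intro actsI) (auto simp: S_def acts_0 dest: acts_add subsetD)
  obtain a where a: "finite S" "card S = p ^ a" using p_subgrp[OF S] by blast
  let ?F = "{x \<in> B0. \<forall>g\<in>S. act g x = x}"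
  have "card ?F mod p = 0"
    using p_group_fixed_points[OF p actS B0(3) a] p_dvd_card_B0 by simp
  moreover have "card E mod p \<noteq> 0"
    using coprime_common_divisor[OF E(4), of p] p_gt_1 by (auto simp: mod_eq_0_iff_dvd)
  ultimately have "E \<noteq> ?F" by metis
  moreover have "E \<subseteq> ?F" using E E_fixed by (auto simp: S_def)
  ultimately obtain y where y: "y \<in> B0" "\<forall>g\<in>S. act g y = y" "y \<notin> E" by blast
  show thesis
  proof (rule that)
    show y\<Omega>: "y \<in> \<Omega>" using y B0 by blast
    show "card (orb act R y) \<le> card (orb act M ` \<Omega>)"
      using fixed_imp_card[OF R_subgrp R_Q y(1)] y(2) by (simp add: S_def)
    fix l r assume lr: "l \<in> L" "r \<in> R"
    \<comment> \<open>If a translate of \<open>y\<close> met a translate of \<open>E\<close>, the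
      two translating elements would differ by an element of \<open>stab R\<close>, which fixes
      \<open>y\<close>; then \<open>y\<close> would lie in \<open>E\<close>.\<close>
    have "act r y \<notin> EO"
    proof
      assume "act r y \<in> EO"
      then obtain s e where se: "s \<in> R" "e \<in> E" "act r y = act s e" by (auto simp: EO_def)
      have "act r y \<in> act s ` B0" using se E by auto
      then have "- s + r \<in> stab R" by (rule diff_stab[OF lr(2) se(1) y(1)])
      then have "act r y = act s y" using same_act[OF lr(2) se(1) y\<Omega>] y(2) by (simp add: S_def)
      then have "act s y = act s e" using se by simp
      then have "y = e"
        using acts_inv1[OF actR se(1)] y\<Omega> se(2) E(2) by (metis subsetD)
      then show False using se y by blast
    qed
    then show "co l (act r y) = 0" using lr acts_in[OF actR lr(2) y\<Omega>] by (simp add: L_def)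
  qed
qed

end

text \<open>\<open>Z\<close> is the point set of the next level, fibred over \<Omega> by
  \<open>pr\<close>, with zero section \<open>sec\<close>. In \<open>pt_sec\<close> the coordinate
  is taken at \<open>act q x\<close>, since \<open>q\<close> acts before \<open>v\<close>.\<close>

locale wreath_points = wreath +
  fixes Z :: "'c set" and pt :: "'a \<Rightarrow> 'c \<Rightarrow> 'c" and pr :: "'c \<Rightarrow> 'b" and sec :: "'b \<Rightarrow> 'c"
  assumes pr: "z \<in> Z \<Longrightarrow> pr z \<in> \<Omega>" and sec: "x \<in> \<Omega> \<Longrightarrow> sec x \<in> Z"
    and pr_pt: "v \<in> V \<Longrightarrow> q \<in> Q \<Longrightarrow> z \<in> Z \<Longrightarrow> pr (pt (v + q) z) = act q (pr z)"
    and pt_sec: "v \<in> V \<Longrightarrow> q \<in> Q \<Longrightarrow> x \<in> \<Omega> \<Longrightarrow> co v (act q x) = 0 \<Longrightarrow>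
      pt (v + q) (sec x) = sec (act q x)"
begin

lemma pr_pt': "g \<in> P \<Longrightarrow> z \<in> Z \<Longrightarrow> pr (pt g z) = act (pi g) (pr z)"
  using pr_pt[OF al_V pi_Q] al_pi by metis

lemma card_orb_pr:
  assumes "A \<subseteq> P" "finite A" "z \<in> Z" shows "card (orb act (pi ` A) (pr z)) \<le> card (orb pt A z)"
proof -
  have "orb act (pi ` A) (pr z) = pr ` orb pt A z"
    using assms pr_pt' by (auto simp: orb_def image_image subset_eq)
  then show ?thesis using card_image_le[of "orb pt A z" pr] assms by (simp add: orb_def)
qed

lemma card_orb_sec:
  assumes A: "\<And>g. g \<in> A \<Longrightarrow> \<exists>v\<in>V. \<exists>q\<in>B. g = v + q \<and> co v (act q x) = 0"
    and B: "B \<subseteq> Q" and x: "x \<in> \<Omega>"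
  shows "card (orb pt A (sec x)) \<le> card (orb act B x)"
proof -
  have "orb pt A (sec x) \<subseteq> sec ` orb act B x"
  proof
    fix z assume "z \<in> orb pt A (sec x)"
    then obtain g where g: "g \<in> A" "z = pt g (sec x)" by (auto simp: orb_def)
    obtain v q where vq: "v \<in> V" "q \<in> B" "g = v + q" "co v (act q x) = 0" using A[OF g(1)] by blast
    then have "z = sec (act q x)" using g pt_sec[OF vq(1) _ x vq(4)] B by auto
    then show "z \<in> sec ` orb act B x" using vq by (auto simp: orb_def)
  qed
  moreover have fin: "finite (orb act B x)" using B Q(2) finite_subset by (auto simp: orb_def)
  ultimately have "card (orb pt A (sec x)) \<le> card (sec ` orb act B x)"
    by (intro card_mono finite_imageI)
  then show ?thesis using card_image_le[OF fin, of sec] by simp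
qed

theorem stable_complements_wreath:
  assumes IH: "stable_complements Q H act \<Omega>"
  shows "stable_complements P H pt Z"
  unfolding stable_complements_def
proof (intro allI impI)
  fix N C assume N: "subgrp N" "N \<subseteq> P" "conj_stable P N" and C: "complements P N C"
  interpret wreath_complement p V Q H \<Omega> act co base N C
    by unfold_locales (use N C in auto)
  show "\<exists>C'. complements P N C' \<and> conj_stable H C' \<and>
    (\<forall>z\<in>Z. \<exists>y\<in>Z. card (orb pt C' y) \<le> card (orb pt C z))"
  \<comment> \<open>For \<open>N = {0}\<close> the only complement is \<open>P\<close> itself. This
    case is set apart because the second construction needs \<open>p\<close> to divide the length of
    \<open>B0\<close>.\<close>
  proof (cases "T = V \<or> N = {0}")
    case True
    show ?thesis
    proof (cases "T = V")
      case True
      note CC = T_full[OF True]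
      have "complements Q (N \<inter> Q) (pi ` C)" by (rule complements_pi) (fact CC)+
      moreover have "subgrp (N \<inter> Q)" using subgrp_Int N Q by blast
      moreover have "conj_stable Q (N \<inter> Q)"
        using N_closed(5) Q_P conj_stableD[OF conj_stable_self[OF Q(1)]] by (intro conj_stableI) auto
      ultimately obtain R where R: "complements Q (N \<inter> Q) R" "conj_stable H R"
        "\<And>x. x \<in> \<Omega> \<Longrightarrow> \<exists>y\<in>\<Omega>. card (orb act R y) \<le> card (orb act (pi ` C) x)"
        using stable_complementsD[OF IH, of "N \<inter> Q" "pi ` C"] by auto
      have RQ: "R \<subseteq> Q" using R complements_subset by blast
      have comp: "complements P N R" using CC R(1) by (rule complements_lift)
      have "\<exists>y\<in>Z. card (orb pt R y) \<le> card (orb pt C z)" if z: "z \<in> Z" for z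
      proof -
        obtain x where x: "x \<in> \<Omega>" "card (orb act R x) \<le> card (orb act (pi ` C) (pr z))"
          using R(3)[OF pr[OF z]] by blast
        \<comment> \<open>\<open>R\<close> lies in \<open>Q\<close>, so its elements have
          \<open>V\<close>-component 0 and preserve the zero section.\<close>
        have "card (orb pt R (sec x)) \<le> card (orb act R x)"
        proof (rule card_orb_sec[OF _ RQ x(1)])
          fix g assume g: "g \<in> R"
          have "act g x \<in> \<Omega>" using acts_in[OF actQ] g RQ x by blast
          then show "\<exists>v\<in>V. \<exists>q\<in>R. g = v + q \<and> co v (act q x) = 0"
            using g V_0 co_0 by (intro bexI[of _ 0] bexI[of _ g]) auto
        qed
        moreover have "card (orb act (pi ` C) (pr z)) \<le> card (orb pt C z)"
          using card_orb_pr[OF _ finite_C z] C_P by blast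
        ultimately have "card (orb pt R (sec x)) \<le> card (orb pt C z)" using x by linarith
        then show ?thesis using sec[OF x(1)] by blast
      qed
      then show ?thesis using comp R by blast
    next
      case False
      then have N0: "N = {0}" using \<open>T = V \<or> N = {0}\<close> by blast
      have "C = P"
        using C N0 by (auto simp: complements_def)
      moreover have "conj_stable H P"
      proof (rule conj_stableI)
        fix h g assume h: "h \<in> H" and "g \<in> P"
        then obtain v q where vq: "v \<in> V" "q \<in> Q" "g = v + q" by (auto simp: P_def)
        have "h + g - h = (h + v - h) + (h + q - h)"
          unfolding vq(3) by (simp add: group_simps del: add_uminus_conv_diff)
        then show "h + g - h \<in> P"
          using conj_stableD[OF HV h vq(1)] conj_stableD[OF HQ h vq(2)] unfolding P_def by blast
      qed
      ultimately show ?thesis using C by blast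
    qed
  next
    case False
    then have full: "X1 = V" and N0: "N \<noteq> {0}" using X1_or_T by auto
    have c1: "complements Q M (pi ` C1)" using complements_C1[OF full] .
    obtain R where R: "complements Q M R" "conj_stable H R"
      "\<And>x. x \<in> \<Omega> \<Longrightarrow> \<exists>y\<in>\<Omega>. card (orb act R y) \<le> card (orb act (pi ` C1) x)"
      using stable_complementsD[OF IH M(1,2,3) c1] by blast
    have R': "subgrp R" "R \<subseteq> Q" using R(1) by (auto simp: complements_def)
    have actR: "acts act R \<Omega>" using act_subset[OF R'] .
    obtain x0 where x0: "x0 \<in> \<Omega>" "card (orb act R x0) \<le> card (orb act M ` \<Omega>)"
      using small_orbit_C1[OF full] R(3) by (meson order_trans)
    have meets: "\<exists>r\<in>A. y \<in> orb act M (act r x)"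
      if A: "\<And>q. q \<in> Q \<Longrightarrow> \<exists>m\<in>M. \<exists>r\<in>A. q = m + r" "A \<subseteq> Q" and x: "x \<in> \<Omega>" and y: "y \<in> \<Omega>" for A x y
    proof -
      obtain q where q: "q \<in> Q" "y = act q x" using trans[OF x y] by blast
      obtain m r where mr: "m \<in> M" "r \<in> A" "q = m + r" using A(1)[OF q(1)] by blast
      then have "y = act m (act r x)" using q acts_add[OF actQ _ _ x] M_closed(6) A(2) by auto
      then show ?thesis using mr by (auto simp: orb_def)
    qed
    have R_decomp: "\<exists>m\<in>M. \<exists>r\<in>R. q = m + r" if "q \<in> Q" for q
      using complements_decomp[OF R(1) that] by metis
    have surj: "orb act M ` orb act R x0 = orb act M ` \<Omega>"
    proof (intro equalityI subsetI)
      fix B assume "B \<in> orb act M ` \<Omega>"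
      then obtain y where y: "y \<in> \<Omega>" "B = orb act M y" by blast
      obtain r where r: "r \<in> R" "y \<in> orb act M (act r x0)" using meets[OF R_decomp R'(2) x0(1) y(1)] by blast
      have "B = orb act M (act r x0)"
        using orb_eq[OF act_subset[OF M(1,2)] acts_in[OF actR r(1) x0(1)] r(2)] y by simp
      then show "B \<in> orb act M ` orb act R x0" using r by (auto simp: orb_def)
    qed (use orb_subset[OF actR x0(1)] in auto)
    have finR: "finite (orb act R x0)" using R'(2) Q(2) finite_subset by (auto simp: orb_def)
    \<comment> \<open>The \<open>R\<close>-orbit of \<open>x0\<close> meets every
      \<open>M\<close>-orbit, because \<open>R\<close> complements \<open>M\<close>, and is no
      longer than their number; so it meets each exactly once.\<close>
    have inj: "inj_on (orb act M) (orb act R x0)"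
      using x0(2) surj card_image_le[OF finR, of "orb act M"] by (intro eq_card_imp_inj_on[OF finR]) simp
    \<comment> \<open>\<open>w\<close> is the point of this \<open>R\<close>-orbit that lies in
      \<open>B0\<close>. An element of \<open>R\<close> stabilising \<open>B0\<close> keeps it in
      \<open>B0\<close> and in the orbit, hence fixes it.\<close>
    obtain r0 where r0: "r0 \<in> R" "base \<in> orb act M (act r0 x0)"
      using meets[OF R_decomp R'(2) x0(1) \<Omega>(2)] by blast
    let ?w = "act r0 x0"
    have w\<Omega>: "?w \<in> \<Omega>" using acts_in[OF actR r0(1) x0(1)] .
    have w0: "?w \<in> B0" using orb_sym[OF act_subset[OF M(1,2)] w\<Omega> r0(2)] .
    have fixed: "act r ?w = ?w" if r: "r \<in> stab R" for r
    proof -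
      have rR: "r \<in> R" using r by (simp add: stab_def)
      have "act r ?w \<in> B0" using stab_iff[OF rR R'(2) w0] r by blast
      then have "orb act M (act r ?w) = orb act M ?w" using B0_eq w0 by simp
      moreover have "act r ?w \<in> orb act R x0"
        using acts_add[OF actR rR r0(1) x0(1)] subgrp_add[OF R'(1) rR r0(1)]
        by (metis imageI orb_def)
      moreover have "?w \<in> orb act R x0" using r0 by (auto simp: orb_def)
      ultimately show ?thesis using inj by (auto dest: inj_onD)
    qed
    interpret wreath_split p V Q H \<Omega> act co base N C R ?w
      by unfold_locales (use R w0 fixed U_eq_K[OF full] N0 in auto)
    \<comment> \<open>Along the \<open>R\<close>-orbit of \<open>y\<close> all coordinates of
      elements of \<open>L\<close> vanish, so \<open>C2\<close> moves the point of the zero section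
      over \<open>y\<close> just as \<open>R\<close> moves \<open>y\<close>.\<close>
    obtain y where y: "y \<in> \<Omega>" "card (orb act R y) \<le> card (orb act M ` \<Omega>)"
      "\<And>l r. l \<in> L \<Longrightarrow> r \<in> R \<Longrightarrow> co l (act r y) = 0" using free_point by blast
    have "card (orb pt C2 (sec y)) \<le> card (orb act R y)"
      by (rule card_orb_sec[OF _ R'(2) y(1)]) (use y(3) L_V in \<open>auto simp: C2_def\<close>)
    \<comment> \<open>Any complement of \<open>N\<close> maps onto \<open>Q/M\<close>, so its orbits
      on \<Omega> meet all \<open>M\<close>-orbits. The number of these is thus a lower bound for
      orbit lengths, and it is attained by \<open>C2\<close>.\<close>
    moreover have "card (orb act M ` \<Omega>) \<le> card (orb pt C z)" if z: "z \<in> Z" for z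
    proof -
      have piC: "pi ` C \<subseteq> Q" using pi_Q C_P by blast
      have dec: "\<exists>m\<in>M. \<exists>r\<in>pi ` C. q = m + r" if q: "q \<in> Q" for q
      proof -
        obtain m c where "m \<in> M" "c \<in> C" "q = m + pi c" by (rule Q_decomp[OF q])
        then show ?thesis by (intro bexI[of _ m] bexI[of _ "pi c"] imageI)
      qed
      have "orb act M ` \<Omega> \<subseteq> orb act M ` orb act (pi ` C) (pr z)"
      proof
        fix B assume "B \<in> orb act M ` \<Omega>"
        then obtain x where x: "x \<in> \<Omega>" "B = orb act M x" by blast
        obtain r where r: "r \<in> pi ` C" "x \<in> orb act M (act r (pr z))"
          using meets[OF dec piC pr[OF z] x(1)] by blast
        have "B = orb act M (act r (pr z))"
          using orb_eq[OF act_subset[OF M(1,2)] acts_in[OF actQ _ pr[OF z]] r(2)] x r(1) piC by blast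
        then show "B \<in> orb act M ` orb act (pi ` C) (pr z)" using r by (auto simp: orb_def)
      qed
      moreover have fin: "finite (orb act (pi ` C) (pr z))" using finite_C by (simp add: orb_def)
      ultimately have "card (orb act M ` \<Omega>) \<le> card (orb act M ` orb act (pi ` C) (pr z))"
        by (intro card_mono finite_imageI)
      also have "\<dots> \<le> card (orb act (pi ` C) (pr z))" by (rule card_image_le[OF fin])
      also have "\<dots> \<le> card (orb pt C z)" using card_orb_pr[OF _ finite_C z] C_P by blast
      finally show ?thesis .
    qed
    ultimately have "card (orb pt C2 (sec y)) \<le> card (orb pt C z)" if "z \<in> Z" for z
      using y(2) that by (meson order_trans)
    then show ?thesis using C2_complements C2_H sec[OF y(1)] by blast
  qed
qed

end

section \<open>Permutations of the natural numbers as an additive group\<close>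

text \<open>All levels of the tower live in one type, and the additive class \<open>group_add\<close> is the library's class of
  possibly noncommutative groups. The point \<open>i\<close> lies in the fibre \<open>i div p\<close> at position \<open>i mod p\<close>.\<close>

typedef nperm = "{f :: nat \<Rightarrow> nat. bij f}" morphisms ap Nperm
  by (rule exI[of _ id]) simp

lemma bij_ap: "bij (ap f)"
  using ap[of f] by simp

lemma ap_Nperm: "bij f \<Longrightarrow> ap (Nperm f) = f"
  by (simp add: Nperm_inverse)

instantiation nperm :: group_add
begin

definition "0 = Nperm id"
definition "f + g = Nperm (ap f \<circ> ap g)"
definition "- f = Nperm (Hilbert_Choice.inv (ap f))"
definition "f - g = f + - g" for f g :: nperm

lemma ap_plus_comp: "ap (f + g) = ap f \<circ> ap g"
  unfolding plus_nperm_def by (rule ap_Nperm) (metis bij_ap bij_comp)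

lemma ap_zero_id: "ap 0 = id"
  unfolding zero_nperm_def by (rule ap_Nperm) simp

lemma ap_uminus_inv: "ap (- f) = Hilbert_Choice.inv (ap f)"
  unfolding uminus_nperm_def by (rule ap_Nperm) (metis bij_ap bij_imp_bij_inv)

instance
proof
  fix f g h :: nperm
  show "f + g + h = f + (g + h)" by (metis ap_plus_comp ap_inject comp_assoc)
  show "0 + f = f" by (metis ap_plus_comp ap_zero_id ap_inject id_comp)
  show "f + 0 = f" by (metis ap_plus_comp ap_zero_id ap_inject comp_id)
  show "- f + f = 0"
    using bij_is_inj[OF bij_ap[of f]]
    by (metis ap_plus_comp ap_uminus_inv ap_zero_id ap_inject inv_o_cancel)
  show "f + - g = f - g" by (simp add: minus_nperm_def)
qed

end

lemma ap_plus [simp]: "ap (f + g) i = ap f (ap g i)"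
  and ap_zero [simp]: "ap 0 i = i"
  by (simp_all add: ap_plus_comp ap_zero_id)

lemma ap_minus_ap [simp]: "ap (- f) (ap f i) = i" "ap f (ap (- f) i) = i"
  using ap_plus[of "- f" f i] ap_plus[of f "- f" i] by (simp_all del: ap_plus)

lemma ap_diff [simp]: "ap (f - g) i = ap f (ap (- g) i)"
  by (simp add: diff_conv_add_uminus del: add_uminus_conv_diff)

lemma nperm_eqI: "(\<And>i. ap f i = ap g i) \<Longrightarrow> f = g"
  by (metis ap_inject ext)

lemma ap_inj: "ap f i = ap f k \<longleftrightarrow> i = k"
  by (metis ap_minus_ap(1))

lemma ap_minus_eq: "ap (- f) i = k \<longleftrightarrow> i = ap f k"
  by (metis ap_minus_ap)

text \<open>The symmetric group on \<open>{..<m}\<close>, as a subgroup of the permutations of all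
  naturals.\<close>

definition supp_below :: "nat \<Rightarrow> nperm set" where
  "supp_below m = {g. \<forall>i\<ge>m. ap g i = i}"

lemma supp_below_subgrp: "subgrp (supp_below m)"
  by (intro subgrpI) (auto simp: supp_below_def ap_minus_eq)

lemma supp_below_less:
  assumes "g \<in> supp_below m" shows "ap g i < m \<longleftrightarrow> i < m"
proof -
  have "ap g i \<ge> m \<longleftrightarrow> i \<ge> m"
  proof
    assume "ap g i \<ge> m"
    then have "ap g (ap g i) = ap g i" using assms by (auto simp: supp_below_def)
    then show "i \<ge> m" using \<open>ap g i \<ge> m\<close> ap_inj by metis
  qed (use assms in \<open>auto simp: supp_below_def\<close>)
  then show ?thesis by linarith
qed

lemma finite_supp_below: "finite (supp_below m)"
proof -
  have "inj_on (\<lambda>g. restrict (ap g) {..<m}) (supp_below m)"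
  proof (rule inj_onI, rule nperm_eqI)
    fix g h i assume *: "g \<in> supp_below m" "h \<in> supp_below m"
      "restrict (ap g) {..<m} = restrict (ap h) {..<m}"
    show "ap g i = ap h i"
    proof (cases "i < m")
      case True
      then show ?thesis using fun_cong[OF *(3), of i] by simp
    qed (use * in \<open>auto simp: supp_below_def\<close>)
  qed
  moreover have "(\<lambda>g. restrict (ap g) {..<m}) ` supp_below m \<subseteq> {..<m} \<rightarrow>\<^sub>E {..<m}"
    using supp_below_less by (auto split: if_splits)
  moreover have "finite ({..<m} \<rightarrow>\<^sub>E {..<m})" by (simp add: finite_PiE)
  ultimately show ?thesis by (metis finite_imageD finite_subset)
qed

locale prime_tower =
  fixes p :: nat
  assumes p: "Factorial_Ring.prime p"
begin

lemma p_pos: "p > 0" and p_gt_1: "p > 1"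
  using p prime_gt_1_nat by (auto simp: prime_gt_0_nat)

text \<open>Only the residues of \<open>v\<close> modulo \<open>p\<close> matter
  (\<open>shift_eq_iff\<close>); integer values make sums and negatives available without
  reduction.\<close>

definition shift_fun :: "(nat \<Rightarrow> int) \<Rightarrow> nat \<Rightarrow> nat" where
  "shift_fun v i = p * (i div p) + nat ((int (i mod p) + v (i div p)) mod int p)"

definition shift :: "(nat \<Rightarrow> int) \<Rightarrow> nperm" where "shift v = Nperm (shift_fun v)"

definition lift_fun :: "nperm \<Rightarrow> nat \<Rightarrow> nat" where
  "lift_fun q i = p * ap q (i div p) + i mod p"

definition lift :: "nperm \<Rightarrow> nperm" where "lift q = Nperm (lift_fun q)"

text \<open>The cut-off \<open>m\<close> keeps the support finite. \<open>shift\<close> and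
  \<open>lift\<close> get their bound from a \<open>v\<close> or \<open>q\<close> that is trivial
  beyond it.\<close>

definition scale_fun :: "nat \<Rightarrow> nat \<Rightarrow> nat \<Rightarrow> nat" where
  "scale_fun m a i = (if i div p < m then p * (i div p) + (a * (i mod p)) mod p else i)"

definition scale :: "nat \<Rightarrow> nat \<Rightarrow> nperm" where "scale m a = Nperm (scale_fun m a)"

lemma div_mod_pt: "x < p \<Longrightarrow> (p * w + x) div p = w" "x < p \<Longrightarrow> (p * w + x) mod p = x"
  using p_pos by simp_all

lemma nat_mod_less: "nat (z mod int p) < p"
  using p_pos by (simp add: nat_less_iff)

lemma shift_fun_div_mod: "shift_fun v i div p = i div p"
  "int (shift_fun v i mod p) = (int (i mod p) + v (i div p)) mod int p"
  unfolding shift_fun_def using nat_mod_less p_pos by (simp_all add: div_mod_pt)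

lemma pt_eqI: "i div p = k div p \<Longrightarrow> i mod p = k mod p \<Longrightarrow> i = k"
  by (metis div_mult_mod_eq)

lemma pt_eqI_int: "i div p = k div p \<Longrightarrow> int (i mod p) = int (k mod p) \<Longrightarrow> i = k"
  by (rule pt_eqI) auto

lemma shift_fun_comp: "shift_fun v (shift_fun w i) = shift_fun (\<lambda>x. v x + w x) i"
  by (rule pt_eqI_int) (simp_all only: shift_fun_div_mod, simp add: mod_simps add.assoc add.left_commute add.commute)

lemma shift_fun_0: "shift_fun (\<lambda>x. 0) i = i"
  by (rule pt_eqI_int) (simp_all only: shift_fun_div_mod, simp add: p_pos)

lemma bij_shift_fun: "bij (shift_fun v)"
  by (rule o_bij[of "shift_fun (\<lambda>x. - v x)"]) (auto simp: shift_fun_comp shift_fun_0 fun_eq_iff)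

lemma ap_shift: "ap (shift v) i = shift_fun v i"
  by (simp add: shift_def ap_Nperm bij_shift_fun)

lemma ap_shift_div [simp]: "ap (shift v) i div p = i div p"
  and ap_shift_mod: "int (ap (shift v) i mod p) = (int (i mod p) + v (i div p)) mod int p"
  by (simp_all add: ap_shift shift_fun_div_mod)

lemma lift_fun_div_mod: "lift_fun q i div p = ap q (i div p)" "lift_fun q i mod p = i mod p"
  unfolding lift_fun_def using p_pos by (simp_all add: div_mod_pt)

lemma lift_fun_comp: "lift_fun q (lift_fun r i) = lift_fun (q + r) i"
  by (rule pt_eqI) (simp_all only: lift_fun_div_mod ap_plus)

lemma lift_fun_0: "lift_fun 0 i = i"
  by (rule pt_eqI) (simp_all only: lift_fun_div_mod ap_zero)

lemma bij_lift_fun: "bij (lift_fun q)"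
  by (rule o_bij[of "lift_fun (- q)"]) (auto simp: lift_fun_comp lift_fun_0 fun_eq_iff)

lemma ap_lift: "ap (lift q) i = lift_fun q i"
  by (simp add: lift_def ap_Nperm bij_lift_fun)

lemma ap_lift_div [simp]: "ap (lift q) i div p = ap q (i div p)"
  and ap_lift_mod [simp]: "ap (lift q) i mod p = i mod p"
  by (simp_all add: ap_lift lift_fun_div_mod)

lemma scale_fun_div_mod: "scale_fun m a i div p = i div p"
  "scale_fun m a i mod p = (if i div p < m then (a * (i mod p)) mod p else i mod p)"
  unfolding scale_fun_def using p_pos by (simp_all add: div_mod_pt)

lemma scale_fun_comp: "scale_fun m a (scale_fun m b i) = scale_fun m (a * b) i"
  by (rule pt_eqI) (simp_all only: scale_fun_div_mod, simp add: mod_mult_right_eq, simp add: mult.assoc)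

lemma scale_fun_mod: "scale_fun m (a mod p) i = scale_fun m a i"
  by (rule pt_eqI) (simp_all only: scale_fun_div_mod, simp add: mod_simps)

lemma scale_fun_1: "scale_fun m 1 i = i"
  by (rule pt_eqI) (simp_all only: scale_fun_div_mod, simp)

lemma inverse_mod_p:
  assumes "a \<in> {1..<p}" obtains b where "b \<in> {1..<p}" "(a * b) mod p = 1"
proof -
  have "\<not> p dvd a" using assms nat_dvd_not_less by auto
  then have "coprime a p" using p prime_imp_coprime[of p a] by (simp add: coprime_commute)
  then obtain x y where xy: "a * x = p * y + 1" using coprime_bezout_strong[of a p] p_gt_1 by auto
  have "(a * (x mod p)) mod p = (p * y + 1) mod p" using xy by (simp add: mod_simps)
  also have "\<dots> = 1" using p_gt_1 by (simp only: mod_mult_self4 mod_less)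
  finally have 1: "(a * (x mod p)) mod p = 1" .
  then have "x mod p \<noteq> 0" by (metis mod_0 mult_0_right zero_neq_one)
  moreover have "x mod p < p" using p_pos by simp
  ultimately show thesis using that[of "x mod p"] 1 by (simp add: Suc_le_eq)
qed

lemma bij_scale_fun:
  assumes "a \<in> {1..<p}" shows "bij (scale_fun m a)"
proof -
  obtain b where b: "b \<in> {1..<p}" "(a * b) mod p = 1" by (rule inverse_mod_p[OF assms])
  have "scale_fun m (a * b) i = i" for i
    using b(2) scale_fun_mod[of m "a * b" i] scale_fun_1 by simp
  then show ?thesis
    by (intro o_bij[of "scale_fun m b"]) (auto simp: scale_fun_comp mult.commute fun_eq_iff)
qed

lemma ap_scale: "a \<in> {1..<p} \<Longrightarrow> ap (scale m a) i = scale_fun m a i"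
  by (simp only: scale_def ap_Nperm bij_scale_fun)

lemma ap_scale_div: "a \<in> {1..<p} \<Longrightarrow> ap (scale m a) i div p = i div p"
  and ap_scale_mod: "a \<in> {1..<p} \<Longrightarrow>
    ap (scale m a) i mod p = (if i div p < m then (a * (i mod p)) mod p else i mod p)"
  by (simp_all only: ap_scale scale_fun_div_mod)

lemma ap_scale_mod_int: "a \<in> {1..<p} \<Longrightarrow> int (ap (scale m a) i mod p) =
    (if i div p < m then (int a * int (i mod p)) mod int p else int (i mod p))"
  by (simp add: ap_scale_mod of_nat_mod)

section \<open>Relations between shifts, lifts and scalings\<close>

lemma shift_add: "shift v + shift w = shift (\<lambda>x. v x + w x)"
  by (rule nperm_eqI) (simp add: ap_shift shift_fun_comp)

lemma shift_0: "shift (\<lambda>x. 0) = 0"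
  by (rule nperm_eqI) (simp add: ap_shift shift_fun_0)

lemma shift_minus: "- shift v = shift (\<lambda>x. - v x)"
proof -
  have "shift v + shift (\<lambda>x. - v x) = 0" by (simp add: shift_add shift_0)
  then show ?thesis by (rule minus_unique)
qed

lemma shift_eq_iff: "shift v = shift w \<longleftrightarrow> (\<forall>x. v x mod int p = w x mod int p)"
proof
  assume eq: "shift v = shift w"
  show "\<forall>x. v x mod int p = w x mod int p"
  proof
    fix x
    have "int (ap (shift v) (p * x) mod p) = int (ap (shift w) (p * x) mod p)" using eq by simp
    then show "v x mod int p = w x mod int p" using p_pos by (simp add: ap_shift_mod)
  qed
next
  assume eq: "\<forall>x. v x mod int p = w x mod int p"
  show "shift v = shift w"
  proof (rule nperm_eqI, rule pt_eqI_int)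
    fix i
    show "int (ap (shift v) i mod p) = int (ap (shift w) i mod p)"
      unfolding ap_shift_mod using eq by (metis mod_add_right_eq)
  qed simp
qed

lemma lift_add: "lift (q + r) = lift q + lift r"
  by (rule nperm_eqI) (simp add: ap_lift lift_fun_comp)

lemma lift_0: "lift 0 = 0"
  by (rule nperm_eqI) (simp add: ap_lift lift_fun_0)

lemma lift_minus: "lift (- q) = - lift q"
  by (metis add.right_inverse lift_add lift_0 minus_unique)

lemma lift_diff: "lift (q - r) = lift q - lift r"
  by (metis diff_conv_add_uminus lift_add lift_minus)

lemma lift_eq_iff: "lift q = lift r \<longleftrightarrow> q = r"
proof
  assume eq: "lift q = lift r"
  show "q = r"
  proof (rule nperm_eqI)
    fix i
    have "ap (lift q) (p * i) div p = ap (lift r) (p * i) div p" using eq by simp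
    then show "ap q i = ap r i" using p_pos by simp
  qed
qed simp

lemma lift_conj_shift: "lift q + shift v - lift q = shift (\<lambda>x. v (ap (- q) x))"
proof (rule nperm_eqI, rule pt_eqI_int)
  fix i
  show "int (ap (lift q + shift v - lift q) i mod p) = int (ap (shift (\<lambda>x. v (ap (- q) x))) i mod p)"
    by (simp add: ap_shift_mod lift_minus[symmetric])
qed (simp add: lift_minus[symmetric])

lemma scale_mult: 
  assumes "a \<in> {1..<p}" "b \<in> {1..<p}" shows "(a * b) mod p \<in> {1..<p}"
    "scale m a + scale m b = scale m ((a * b) mod p)"
proof -
  have "\<not> p dvd a" "\<not> p dvd b" using assms nat_dvd_not_less by auto
  then have "\<not> p dvd a * b" using p by (simp add: prime_dvd_mult_iff)
  then show ab: "(a * b) mod p \<in> {1..<p}" using p_pos by (auto simp: dvd_eq_mod_eq_0 Suc_le_eq)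
  show "scale m a + scale m b = scale m ((a * b) mod p)"
    by (rule nperm_eqI) (simp only: ap_plus ap_scale assms ab scale_fun_comp scale_fun_mod)
qed

lemma scale_1: "scale m 1 = 0"
  by (rule nperm_eqI) (use p_gt_1 in \<open>simp add: ap_scale scale_fun_1[unfolded One_nat_def]\<close>)

lemma scale_minus:
  assumes "a \<in> {1..<p}" obtains b where "b \<in> {1..<p}" "- scale m a = scale m b" "(a * b) mod p = 1"
proof -
  obtain b where b: "b \<in> {1..<p}" "(a * b) mod p = 1" by (rule inverse_mod_p[OF assms])
  have "scale m a + scale m b = 0" using scale_mult(2)[OF assms b(1), of m] b scale_1 by simp
  then have "- scale m a = scale m b" by (rule minus_unique)
  then show thesis using that b by blast
qed

text \<open>One permutation changes positions and the other fibres, and \<open>q\<close> respects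
  the cut-off because it preserves the first \<open>m\<close> fibres.\<close>

lemma scale_lift_comm:
  assumes a: "a \<in> {1..<p}" and q: "q \<in> supp_below m"
  shows "scale m a + lift q = lift q + scale m a"
  by (rule nperm_eqI, rule pt_eqI)
    (simp_all add: ap_scale_div[OF a] ap_scale_mod[OF a] supp_below_less[OF q])

lemma scale_conj_shift:
  assumes a: "a \<in> {1..<p}" and v: "\<And>x. x \<ge> m \<Longrightarrow> v x = 0"
  shows "scale m a + shift v - scale m a = shift (\<lambda>x. int a * v x)"
proof -
  have "scale m a + shift v = shift (\<lambda>x. int a * v x) + scale m a"
  proof (rule nperm_eqI, rule pt_eqI_int)
    fix i
    show "int (ap (scale m a + shift v) i mod p) = int (ap (shift (\<lambda>x. int a * v x) + scale m a) i mod p)"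
    proof (cases "i div p < m")
      case True
      then show ?thesis
        by (simp only: ap_plus ap_scale_div[OF a] ap_scale_mod_int[OF a] ap_shift_div ap_shift_mod if_True
            mod_mult_right_eq mod_add_left_eq distrib_left)
    next
      case False
      then have "v (i div p) = 0" using v by simp
      then show ?thesis using False
        by (simp only: ap_plus ap_scale_div[OF a] ap_scale_mod_int[OF a] ap_shift_div ap_shift_mod if_False
            mult_zero_right add_0_right mod_mod_trivial)
    qed
  qed (simp add: ap_scale_div[OF a])
  then show ?thesis by simp
qed

end

section \<open>The tower of Sylow subgroups\<close>

context prime_tower
begin

definition Vn :: "nat \<Rightarrow> nperm set" where
  "Vn n = {shift v |v. \<forall>x\<ge>p ^ n. v x = 0}"

text \<open>The iterated wreath product of cyclic groups of order \<open>p\<close>. The new factor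
  acts on the lowest base \<open>p\<close> digit, so the previous group moves whole fibres, through
  \<open>lift\<close>.\<close>

primrec Pn :: "nat \<Rightarrow> nperm set" where
  "Pn 0 = {0}"
| "Pn (Suc n) = {v + q |v q. v \<in> Vn n \<and> q \<in> lift ` Pn n}"

definition Sn :: "nat \<Rightarrow> nperm set" where
  "Sn n = scale (p ^ n) ` {1..<p}"

text \<open>One factor for each base \<open>p\<close> digit, multiplying that digit by a unit modulo
  \<open>p\<close>. The unit is the same in all fibres, which is what lets the group normalise
  \<open>Pn\<close>.\<close>

primrec Hn :: "nat \<Rightarrow> nperm set" where
  "Hn 0 = {0}"
| "Hn (Suc n) = {h + s |h s. h \<in> lift ` Hn n \<and> s \<in> Sn n}"

section \<open>Supports, subgroup properties and orders\<close>

lemma div_less_power: "i div p < p ^ n \<longleftrightarrow> i < p ^ Suc n"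
  using p_pos by (simp add: div_less_iff_less_mult mult.commute)

lemma pt_less_power: "x < p \<Longrightarrow> p * w + x < p ^ Suc n \<longleftrightarrow> w < p ^ n"
  using div_less_power[of "p * w + x" n] div_mod_pt by simp

lemma pt0_less_power: "p * w < p ^ Suc n \<longleftrightarrow> w < p ^ n"
  using p_pos by simp

lemma supp_belowI: 
  assumes "\<And>i. i div p \<ge> p ^ n \<Longrightarrow> ap g i div p = i div p \<and> ap g i mod p = i mod p"
  shows "g \<in> supp_below (p ^ Suc n)"
proof -
  have "ap g i = i" if i: "i \<ge> p ^ Suc n" for i
  proof -
    have "i div p \<ge> p ^ n" using i div_less_power[of i n] by linarith
    then show ?thesis using assms pt_eqI by blast
  qed
  then show ?thesis by (simp add: supp_below_def)
qed

lemma shift_mod_0: "v (i div p) = 0 \<Longrightarrow> ap (shift v) i mod p = i mod p"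
  using ap_shift_mod[of v i] p_pos by simp

lemma Vn_supp: "Vn n \<subseteq> supp_below (p ^ Suc n)"
  unfolding Vn_def by (intro subsetI, elim CollectE exE conjE, hypsubst)
    (intro supp_belowI conjI ap_shift_div shift_mod_0, blast)

lemma lift_supp: "q \<in> supp_below (p ^ n) \<Longrightarrow> lift q \<in> supp_below (p ^ Suc n)"
  by (intro supp_belowI) (simp add: supp_below_def)

lemma Sn_supp: "Sn n \<subseteq> supp_below (p ^ Suc n)"
proof
  fix g assume "g \<in> Sn n"
  then obtain a where a: "a \<in> {1..<p}" "g = scale (p ^ n) a" by (auto simp: Sn_def)
  show "g \<in> supp_below (p ^ Suc n)"
    unfolding a(2) by (rule supp_belowI) (simp add: ap_scale_div[OF a(1)] ap_scale_mod[OF a(1)])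
qed

lemma Pn_supp: "Pn n \<subseteq> supp_below (p ^ n)"
proof (induction n)
  case (Suc n)
  show ?case
  proof
    fix g assume "g \<in> Pn (Suc n)"
    then obtain v q where vq: "v \<in> Vn n" "q \<in> Pn n" "g = v + lift q" by auto
    have "v \<in> supp_below (p ^ Suc n)" "lift q \<in> supp_below (p ^ Suc n)"
      using vq(1,2) Suc Vn_supp lift_supp by blast+
    then show "g \<in> supp_below (p ^ Suc n)"
      unfolding vq(3) by (rule subgrp_add[OF supp_below_subgrp])
  qed
qed (auto simp: supp_below_def)

lemma Hn_supp: "Hn n \<subseteq> supp_below (p ^ n)"
proof (induction n)
  case (Suc n)
  show ?case
  proof
    fix g assume "g \<in> Hn (Suc n)"
    then obtain h s where hs: "h \<in> Hn n" "s \<in> Sn n" "g = lift h + s" by auto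
    have "lift h \<in> supp_below (p ^ Suc n)" "s \<in> supp_below (p ^ Suc n)"
      using hs(1,2) Suc Sn_supp lift_supp by blast+
    then show "g \<in> supp_below (p ^ Suc n)"
      unfolding hs(3) by (rule subgrp_add[OF supp_below_subgrp])
  qed
qed (auto simp: supp_below_def)

lemma finite_Pn: "finite (Pn n)" and finite_Hn: "finite (Hn n)" and finite_Vn: "finite (Vn n)"
  by (rule finite_subset[OF Pn_supp finite_supp_below] finite_subset[OF Hn_supp finite_supp_below]
      finite_subset[OF Vn_supp finite_supp_below])+

lemma Vn_subgrp: "subgrp (Vn n)"
proof (rule subgrpI)
  show "0 \<in> Vn n" unfolding Vn_def by (rule CollectI, rule exI[of _ "\<lambda>x. 0"]) (simp add: shift_0)
next
  fix v w assume "v \<in> Vn n" "w \<in> Vn n"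
  then obtain f g where "v = shift f" "w = shift g" "\<forall>x\<ge>p ^ n. f x = 0" "\<forall>x\<ge>p ^ n. g x = 0"
    by (auto simp: Vn_def)
  then show "v + w \<in> Vn n"
    unfolding Vn_def by (intro CollectI exI[of _ "\<lambda>x. f x + g x"]) (simp add: shift_add)
next
  fix v assume "v \<in> Vn n"
  then obtain f where "v = shift f" "\<forall>x\<ge>p ^ n. f x = 0" by (auto simp: Vn_def)
  then show "- v \<in> Vn n"
    unfolding Vn_def by (intro CollectI exI[of _ "\<lambda>x. - f x"]) (simp add: shift_minus)
qed

lemma lift_image_subgrp: "subgrp A \<Longrightarrow> subgrp (lift ` A)"
  using lift_add by (intro subgrp_image) auto

lemma lift_conj_Vn:
  assumes "q \<in> supp_below (p ^ n)" "v \<in> Vn n" shows "lift q + v - lift q \<in> Vn n"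
proof -
  obtain f where f: "v = shift f" "\<forall>x\<ge>p ^ n. f x = 0" using assms by (auto simp: Vn_def)
  have "- q \<in> supp_below (p ^ n)" using subgrp_minus[OF supp_below_subgrp assms(1)] .
  then have "\<forall>x\<ge>p ^ n. f (ap (- q) x) = 0" using f(2) by (simp add: supp_below_def)
  then show ?thesis unfolding f(1) lift_conj_shift Vn_def by blast
qed

lemma Sn_subgrp: "subgrp (Sn n)"
proof (rule subgrpI)
  show "0 \<in> Sn n" unfolding Sn_def
    using p_gt_1 scale_1 by (intro image_eqI[of _ _ 1]) auto
  show "s + t \<in> Sn n" if "s \<in> Sn n" "t \<in> Sn n" for s t
  proof -
    obtain a b where ab: "a \<in> {1..<p}" "b \<in> {1..<p}" "s = scale (p ^ n) a" "t = scale (p ^ n) b"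
      using \<open>s \<in> Sn n\<close> \<open>t \<in> Sn n\<close> unfolding Sn_def by blast
    show ?thesis unfolding Sn_def ab(3,4) scale_mult(2)[OF ab(1,2)]
      by (rule imageI) (rule scale_mult(1)[OF ab(1,2)])
  qed
  show "- s \<in> Sn n" if "s \<in> Sn n" for s
  proof -
    obtain a where a: "a \<in> {1..<p}" "s = scale (p ^ n) a"
      using \<open>s \<in> Sn n\<close> unfolding Sn_def by blast
    obtain b where "b \<in> {1..<p}" "- scale (p ^ n) a = scale (p ^ n) b" by (rule scale_minus[OF a(1)])
    then show ?thesis using a by (auto simp: Sn_def)
  qed
qed

lemma Sn_lift_comm: "s \<in> Sn n \<Longrightarrow> q \<in> supp_below (p ^ n) \<Longrightarrow> s + lift q = lift q + s"
  unfolding Sn_def by (auto intro: scale_lift_comm)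

lemma Pn_subgrp: "subgrp (Pn n)"
proof (induction n)
  case (Suc n)
  have "conj_stable (lift ` Pn n) (Vn n)"
    using lift_conj_Vn Pn_supp by (intro conj_stableI) blast
  then show ?case using subgrp_semidirect[OF Vn_subgrp lift_image_subgrp[OF Suc]] by simp
qed (simp add: subgrp_zero)

lemma Hn_subgrp: "subgrp (Hn n)"
proof (induction n)
  case (Suc n)
  have "conj_stable (Sn n) (lift ` Hn n)"
  proof (rule conj_stableI)
    fix s h assume s: "s \<in> Sn n" "h \<in> lift ` Hn n"
    then have "s + h = h + s" using Sn_lift_comm Hn_supp by blast
    then show "s + h - s \<in> lift ` Hn n" using s(2) by simp
  qed
  then show ?case using subgrp_semidirect[OF lift_image_subgrp[OF Suc] Sn_subgrp] by simp
qed (simp add: subgrp_zero)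

lemma card_Vn: "card (Vn n) = p ^ (p ^ n)"
proof -
  define F where "F = {..<p ^ n} \<rightarrow>\<^sub>E {0..<int p}"
  \<comment> \<open>Reduced values, extended by zero beyond \<open>p ^ n\<close>, give every shift
    exactly one representative.\<close>
  define ext where "ext f = shift (\<lambda>x. if x < p ^ n then f x else 0)" for f :: "nat \<Rightarrow> int"
  have "inj_on ext F"
  proof (rule inj_onI, rule ext)
    fix f g x assume f: "f \<in> F" "g \<in> F" "ext f = ext g"
    show "f x = g x"
    proof (cases "x < p ^ n")
      case True
      have "f x \<in> {0..<int p}" "g x \<in> {0..<int p}" using f(1,2) True PiE_mem unfolding F_def by (metis lessThan_iff)+
      moreover have "f x mod int p = g x mod int p"
        using f(3)[unfolded ext_def shift_eq_iff, THEN spec, of x] True by simp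
      ultimately show ?thesis by simp
    next
      case False
      then have "f x = undefined" "g x = undefined" using f(1,2) PiE_arb unfolding F_def by (metis lessThan_iff)+
      then show ?thesis by simp
    qed
  qed
  moreover have "ext ` F = Vn n"
  proof (intro equalityI subsetI)
    fix v assume "v \<in> Vn n"
    then obtain f where f: "v = shift f" "\<forall>x\<ge>p ^ n. f x = 0" by (auto simp: Vn_def)
    define g where "g = restrict (\<lambda>x. f x mod int p) {..<p ^ n}"
    have "g \<in> F" using p_pos by (auto simp: g_def F_def)
    moreover have "v = ext g" unfolding f(1) ext_def shift_eq_iff g_def using f(2) by auto
    ultimately show "v \<in> ext ` F" by blast
  qed (auto simp: ext_def Vn_def)
  ultimately have "card (Vn n) = card F" by (metis card_image)
  then show ?thesis by (simp add: F_def card_PiE)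
qed

lemma Vn_lift_disjoint: "Vn n \<inter> lift ` A \<subseteq> {0}"
proof
  fix g assume g: "g \<in> Vn n \<inter> lift ` A"
  then obtain v q where vq: "g = shift v" "g = lift q" by (auto simp: Vn_def)
  have "ap g i = i" for i
    by (rule pt_eqI) (use vq ap_shift_div[of v i] ap_lift_mod[of q i] in simp_all)
  then have "g = 0" by (intro nperm_eqI) simp
  then show "g \<in> {0}" by simp
qed

lemma card_lift: "card (lift ` A) = card A"
  by (intro card_image inj_onI) (simp add: lift_eq_iff)

lemma card_Pn_Suc: "card (Pn (Suc n)) = p ^ (p ^ n) * card (Pn n)"
proof -
  have "Pn (Suc n) = (\<lambda>(a, b). a + b) ` (Vn n \<times> lift ` Pn n)" by auto
  moreover have "Vn n \<inter> lift ` Pn n = {0}"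
    using Vn_lift_disjoint subgrp_0[OF Vn_subgrp] subgrp_0[OF lift_image_subgrp[OF Pn_subgrp]] by blast
  ultimately show ?thesis
    using card_set_plus[OF Vn_subgrp lift_image_subgrp[OF Pn_subgrp], of n n] finite_Pn finite_Vn
    by (simp add: card_Vn card_lift)
qed

lemma card_Pn: "\<exists>a. card (Pn n) = p ^ a"
proof (induction n)
  case 0
  show ?case by (rule exI[of _ 0]) simp
next
  case (Suc n)
  then show ?case using card_Pn_Suc by (metis power_add)
qed

lemma coprime_card_Hn: "coprime (card (Hn n)) p"
proof (induction n)
  case (Suc n)
  have "Hn (Suc n) = (\<lambda>(a, b). a + b) ` (lift ` Hn n \<times> Sn n)" by auto
  then have "card (Hn (Suc n)) dvd card (lift ` Hn n) * card (Sn n)"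
    using card_set_plus[OF lift_image_subgrp[OF Hn_subgrp] Sn_subgrp, of n n] finite_Hn
    by (simp add: Sn_def)
  moreover have "coprime (card (Sn n)) p"
  proof -
    have "card (Sn n) \<le> p - 1" using card_image_le[of "{1..<p}" "scale (p ^ n)"] by (simp add: Sn_def)
    moreover have "card (Sn n) > 0" using p_gt_1 by (auto simp: Sn_def card_gt_0_iff)
    ultimately have "\<not> p dvd card (Sn n)" using p_gt_1 nat_dvd_not_less by auto
    then show ?thesis using p prime_imp_coprime[of p "card (Sn n)"] by (simp add: coprime_commute)
  qed
  then have "coprime (card (lift ` Hn n) * card (Sn n)) p"
    using Suc by (simp add: card_lift)
  ultimately show ?case using coprime_divisors dvd_refl by blast
qed simp

lemma Pn_trans: "x < p ^ n \<Longrightarrow> y < p ^ n \<Longrightarrow> \<exists>g\<in>Pn n. ap g x = y"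
proof (induction n arbitrary: x y)
  case (Suc n)
  obtain q where q: "q \<in> Pn n" "ap q (x div p) = y div p"
    using Suc.IH[of "x div p" "y div p"] Suc.prems div_less_power by blast
  define v where "v = shift (\<lambda>w. if w = y div p then int (y mod p) - int (x mod p) else 0)"
  have "v \<in> Vn n" using Suc.prems(2) div_less_power[of y n] by (auto simp: v_def Vn_def)
  moreover have "ap (v + lift q) x = y"
    by (rule pt_eqI_int) (simp_all only: ap_plus v_def ap_shift_div ap_shift_mod ap_lift_div ap_lift_mod q,
        simp add: zmod_int)
  ultimately show ?case using q(1) by (intro bexI[of _ "v + lift q"]) auto
qed simp

section \<open>The action of \<open>Hn\<close> on the tower, and the blocks\<close>

lemma Hn_SucE:
  assumes "h \<in> Hn (Suc n)"
  obtains k a where "k \<in> Hn n" "a \<in> {1..<p}" "h = lift k + scale (p ^ n) a"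
  using assms by (auto simp: Sn_def)

lemma Hn_0: "h \<in> Hn n \<Longrightarrow> ap h 0 = 0"
proof (induction n arbitrary: h)
  case (Suc n)
  obtain k a where k: "k \<in> Hn n" "a \<in> {1..<p}" "h = lift k + scale (p ^ n) a"
    by (rule Hn_SucE[OF Suc.prems])
  show ?case
    by (rule pt_eqI) (simp_all add: k(3) ap_scale_div[OF k(2)] ap_scale_mod[OF k(2)] Suc.IH[OF k(1)])
qed simp

lemma Hn_conj_lift:
  assumes k: "k \<in> Hn n" and a: "a \<in> {1..<p}" and q: "q \<in> supp_below (p ^ n)"
  shows "(lift k + scale (p ^ n) a) + lift q - (lift k + scale (p ^ n) a) = lift (k + q - k)"
proof -
  have "scale (p ^ n) a + lift q - scale (p ^ n) a = lift q"
    using scale_lift_comm[OF a q] by simp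
  then have "lift k + (scale (p ^ n) a + lift q - scale (p ^ n) a) - lift k = lift (k + q - k)"
    by (simp only: lift_add lift_diff)
  then show ?thesis by (simp add: group_simps del: add_uminus_conv_diff)
qed

lemma Hn_conj_shift:
  assumes k: "k \<in> Hn n" and a: "a \<in> {1..<p}" and v: "\<forall>x\<ge>p ^ n. v x = 0"
  shows "(lift k + scale (p ^ n) a) + shift v - (lift k + scale (p ^ n) a) =
    shift (\<lambda>x. int a * v (ap (- k) x))"
proof -
  have "scale (p ^ n) a + shift v - scale (p ^ n) a = shift (\<lambda>x. int a * v x)"
    using scale_conj_shift[OF a] v by simp
  then have "lift k + (scale (p ^ n) a + shift v - scale (p ^ n) a) - lift k =
    shift (\<lambda>x. int a * v (ap (- k) x))"
    by (simp only: lift_conj_shift)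
  then show ?thesis by (simp add: group_simps del: add_uminus_conv_diff)
qed

lemma Hn_Vn: "conj_stable (Hn (Suc n)) (Vn n)"
proof (rule conj_stableI)
  fix h v assume "h \<in> Hn (Suc n)" "v \<in> Vn n"
  then obtain f where f: "v = shift f" "\<forall>x\<ge>p ^ n. f x = 0" by (auto simp: Vn_def)
  obtain k a where ka: "k \<in> Hn n" "a \<in> {1..<p}" "h = lift k + scale (p ^ n) a"
    by (rule Hn_SucE[OF \<open>h \<in> Hn (Suc n)\<close>])
  note * = ka f
  have "- k \<in> supp_below (p ^ n)"
    using * Hn_supp subgrp_minus[OF supp_below_subgrp] by blast
  then have "\<forall>x\<ge>p ^ n. int a * f (ap (- k) x) = 0" using *(5) by (simp add: supp_below_def)
  then show "h + v - h \<in> Vn n"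
    unfolding *(3,4) Hn_conj_shift[OF *(1,2,5)] Vn_def by blast
qed

lemma Hn_Pn: "conj_stable (Hn n) (Pn n)"
proof (induction n)
  case (Suc n)
  show ?case
  proof (rule conj_stableI)
    fix h g assume h: "h \<in> Hn (Suc n)" and "g \<in> Pn (Suc n)"
    then obtain v q where vq: "v \<in> Vn n" "q \<in> Pn n" "g = v + lift q" by auto
    obtain k a where k: "k \<in> Hn n" "a \<in> {1..<p}" "h = lift k + scale (p ^ n) a"
      by (rule Hn_SucE[OF h])
    have "q \<in> supp_below (p ^ n)" using vq(2) Pn_supp by blast
    then have "h + lift q - h = lift (k + q - k)" unfolding k(3) by (rule Hn_conj_lift[OF k(1,2)])
    then have "h + lift q - h \<in> lift ` Pn n" using conj_stableD[OF Suc k(1) vq(2)] by simp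
    moreover have "h + v - h \<in> Vn n" using conj_stableD[OF Hn_Vn h vq(1)] .
    moreover have "h + g - h = (h + v - h) + (h + lift q - h)"
      unfolding vq(3) by (simp add: group_simps del: add_uminus_conv_diff)
    ultimately show "h + g - h \<in> Pn (Suc n)" by auto
  qed
qed (simp add: conj_stable_def)

text \<open>Scaling keeps each fibre and the lifted part acts on fibres, so induction removes one
  digit. With \<open>invariant_equiv_level\<close> this yields the assumption \<open>blocks\<close>
  of the wreath locale.\<close>

lemma Hn_level:
  "h \<in> Hn n \<Longrightarrow> i div p ^ j = k div p ^ j \<Longrightarrow> ap h i div p ^ j = ap h k div p ^ j"
proof (induction n arbitrary: h i k j)
  case (Suc n)
  obtain r a where r: "r \<in> Hn n" "a \<in> {1..<p}" "h = lift r + scale (p ^ n) a"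
    by (rule Hn_SucE[OF Suc.prems(1)])
  show ?case
  proof (cases j)
    case (Suc l)
    have "(i div p) div p ^ l = (k div p) div p ^ l"
      using Suc.prems(2) Suc by (simp add: div_mult2_eq)
    from Suc.IH[OF r(1) this] show ?thesis
      using Suc by (simp add: div_mult2_eq r(3) ap_scale_div[OF r(2)])
  qed (use Suc.prems in simp)
qed simp

text \<open>A relation identifying two points in different fibres identifies all points of a fibre,
  since the fibres can be shifted independently.\<close>

lemma invariant_equiv_level:
  assumes "\<And>i. i < p ^ n \<Longrightarrow> R i i"
    and "\<And>i k. i < p ^ n \<Longrightarrow> k < p ^ n \<Longrightarrow> R i k \<Longrightarrow> R k i"
    and "\<And>i k l. i < p ^ n \<Longrightarrow> k < p ^ n \<Longrightarrow> l < p ^ n \<Longrightarrow> R i k \<Longrightarrow> R k l \<Longrightarrow> R i l"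
    and "\<And>g i k. g \<in> Pn n \<Longrightarrow> i < p ^ n \<Longrightarrow> k < p ^ n \<Longrightarrow> R i k \<Longrightarrow> R (ap g i) (ap g k)"
  shows "\<exists>j\<le>n. \<forall>i<p ^ n. \<forall>k<p ^ n. R i k \<longleftrightarrow> i div p ^ j = k div p ^ j"
  using assms
proof (induction n arbitrary: R)
  case 0
  have "R 0 0" by (rule 0(1)) simp
  then show ?case by (intro exI[of _ 0]) simp
next
  case (Suc n)
  note refl = Suc.prems(1) and sym = Suc.prems(2) and trn = Suc.prems(3) and inv = Suc.prems(4)
  let ?m = "p ^ Suc n"
  have less: "p * w + x < ?m" if "w < p ^ n" "x < p" for w x using that pt_less_power by simp
  have shift_P: "shift v \<in> Pn (Suc n)" if "\<forall>x\<ge>p ^ n. v x = 0" for v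
  proof -
    have "shift v \<in> Vn n" using that by (auto simp: Vn_def)
    moreover have "0 \<in> lift ` Pn n" using subgrp_0[OF lift_image_subgrp[OF Pn_subgrp]] .
    ultimately have "shift v + 0 \<in> Pn (Suc n)" unfolding Pn.simps by blast
    then show ?thesis by simp
  qed
  have ap_Pn: "ap g i < ?m" if "g \<in> Pn (Suc n)" "i < ?m" for g i
    using that supp_below_less Pn_supp by blast
  \<comment> \<open>A shift in the fibre of \<open>k\<close> alone moves \<open>k\<close> anywhere
    in that fibre and fixes \<open>i\<close>, which lies in another one.\<close>
  have fibre_move: "R i (p * (k div p) + y)"
    if ik: "i < ?m" "k < ?m" "R i k" "i div p \<noteq> k div p" "y < p" for i k y
  proof -
    let ?v = "\<lambda>w. if w = k div p then int y - int (k mod p) else 0"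
    have g: "shift ?v \<in> Pn (Suc n)" using ik(2) div_less_power[of k n] by (intro shift_P) auto
    have "ap (shift ?v) i = i" by (rule pt_eqI[OF ap_shift_div shift_mod_0]) (use ik(4) in simp)
    moreover have "ap (shift ?v) k = p * (k div p) + y"
    proof (rule pt_eqI_int)
      have "(int (k mod p) + (int y - int (k mod p))) mod int p = int y" using ik(5) by simp
      then show "int (ap (shift ?v) k mod p) = int ((p * (k div p) + y) mod p)"
        by (simp only: ap_shift_mod div_mod_pt[OF ik(5)] simp_thms if_True)
    qed (simp only: ap_shift_div div_mod_pt[OF ik(5)])
    ultimately show ?thesis using inv[OF g ik(1,2,3)] by simp
  qed
  show ?case
  \<comment> \<open>A related pair in different fibres makes \<open>R\<close> come from a relation
    between fibres, and the level is one more than there. If distinct related points occur only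
    inside fibres, the level is 1; if there are none, it is 0.\<close>
  proof (cases "\<exists>i<?m. \<exists>k<?m. R i k \<and> i div p \<noteq> k div p")
    case True
    then obtain i k where ik: "i < ?m" "k < ?m" "R i k" "i div p \<noteq> k div p" by blast
    have one: "R k l" if l: "l < ?m" "l div p = k div p" for l
    proof -
      have "R i (p * (k div p) + l mod p)" using fibre_move[OF ik] p_pos by simp
      moreover have "p * (k div p) + l mod p = l" using l(2) by (metis mult_div_mod_eq)
      ultimately show ?thesis using trn[OF ik(2,1) l(1) sym[OF ik(1,2,3)]] by simp
    qed
    have fibre: "R s t" if st: "s < ?m" "t < ?m" "s div p = t div p" for s t
    proof -
      obtain g where g: "g \<in> Pn (Suc n)" "ap g s = k" using Pn_trans[OF st(1) ik(2)] by blast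
      have gm: "- g \<in> Pn (Suc n)" using subgrp_minus[OF Pn_subgrp g(1)] .
      obtain v q where vq: "v \<in> Vn n" "q \<in> Pn n" "g = v + lift q" using g(1) by auto
      have "ap g t div p = ap g s div p" using vq st(3) by (auto simp: Vn_def)
      then have "R k (ap g t)" using one ap_Pn[OF g(1) st(2)] g(2) by simp
      then have "R (ap (- g) k) (ap (- g) (ap g t))" using inv[OF gm ik(2) ap_Pn[OF g(1) st(2)]] by blast
      then show ?thesis using g(2) by (metis ap_minus_ap(1))
    qed
    \<comment> \<open>The relation induced on fibres, tested on the points at position 0.\<close>
    define R' where "R' w x \<longleftrightarrow> R (p * w) (p * x)" for w x
    have R': "R s t \<longleftrightarrow> R' (s div p) (t div p)" if st: "s < ?m" "t < ?m" for s t
    proof -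
      have d: "p * (s div p) < ?m" "p * (t div p) < ?m"
        using st div_less_power pt0_less_power by blast+
      have e: "R s (p * (s div p))" "R t (p * (t div p))"
        using fibre[OF st(1) d(1)] fibre[OF st(2) d(2)] p_pos by auto
      show ?thesis unfolding R'_def
      proof
        assume "R s t"
        then have "R s (p * (t div p))" using trn[OF st d(2)] e by blast
        then show "R (p * (s div p)) (p * (t div p))"
          using trn[OF d(1) st(1) d(2)] sym[OF st(1) d(1) e(1)] by blast
      next
        assume "R (p * (s div p)) (p * (t div p))"
        then have "R s (p * (t div p))" using trn[OF st(1) d] e by blast
        then show "R s t" using trn[OF st(1) d(2) st(2)] sym[OF st(2) d(2) e(2)] by blast
      qed
    qed
    have "\<exists>j\<le>n. \<forall>i<p ^ n. \<forall>k<p ^ n. R' i k \<longleftrightarrow> i div p ^ j = k div p ^ j"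
    proof (rule Suc.IH)
      show "R' i i" if "i < p ^ n" for i unfolding R'_def using that refl pt0_less_power by blast
      show "R' k i" if "i < p ^ n" "k < p ^ n" "R' i k" for i k
        using that sym pt0_less_power unfolding R'_def by blast
      show "R' i l" if "i < p ^ n" "k < p ^ n" "l < p ^ n" "R' i k" "R' k l" for i k l
        using that trn pt0_less_power unfolding R'_def by blast
      show "R' (ap q i) (ap q k)" if q: "q \<in> Pn n" and ik: "i < p ^ n" "k < p ^ n" "R' i k" for q i k
      proof -
        have "0 + lift q \<in> Pn (Suc n)" using q subgrp_0[OF Vn_subgrp] unfolding Pn.simps by blast
        then have g: "lift q \<in> Pn (Suc n)" by simp
        have pik: "p * i < ?m" "p * k < ?m" using ik pt0_less_power by blast+
        have "R (ap (lift q) (p * i)) (ap (lift q) (p * k))"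
          using inv[OF g pik] ik(3) by (simp add: R'_def)
        moreover have "ap (lift q) (p * w) = p * ap q w" for w
          by (rule pt_eqI) (use p_pos in simp_all)
        ultimately show ?thesis by (simp add: R'_def)
      qed
    qed
    then obtain j where j: "j \<le> n" "\<forall>i<p ^ n. \<forall>k<p ^ n. R' i k \<longleftrightarrow> i div p ^ j = k div p ^ j"
      by blast
    have "R i k \<longleftrightarrow> i div p ^ Suc j = k div p ^ Suc j" if "i < ?m" "k < ?m" for i k
      using R'[OF that] j(2) that div_less_power by (simp add: div_mult2_eq)
    then show ?thesis using j(1) by (intro exI[of _ "Suc j"]) auto
  next
    case False
    then have same: "i div p = k div p" if "i < ?m" "k < ?m" "R i k" for i k using that by blast
    show ?thesis
    proof (cases "\<exists>i<?m. \<exists>k<?m. R i k \<and> i \<noteq> k")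
      case True
      then obtain i k where ik: "i < ?m" "k < ?m" "R i k" "i \<noteq> k" by blast
      have dv: "i div p = k div p" using same ik by blast
      \<comment> \<open>Shifting the fibre translates the related pair, so any two points at
        distance \<open>e\<close> are related. As \<open>e\<close> is prime to \<open>p\<close>,
        such steps connect the whole fibre.\<close>
      define e where "e = int (k mod p) - int (i mod p)"
      have "i mod p \<noteq> k mod p" using ik(4) dv pt_eqI by blast
      then have "\<not> int p dvd e"
        unfolding e_def by (metis mod_eq_dvd_iff mod_mod_trivial of_nat_eq_iff zmod_int)
      then have cop: "coprime e (int p)"
        using p prime_imp_coprime[of "int p" e] by (auto intro: coprime_imp_coprime)
      have step: "R (p * (i div p) + nat (z mod int p)) (p * (i div p) + nat ((z + e) mod int p))" for z
      proof -
        let ?v = "\<lambda>w. if w = i div p then z - int (i mod p) else 0"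
        have g: "shift ?v \<in> Pn (Suc n)" using ik(1) div_less_power[of i n] by (intro shift_P) auto
        have "ap (shift ?v) i = p * (i div p) + nat (z mod int p)"
          by (rule pt_eqI_int) (use p_pos in \<open>simp_all add: ap_shift_mod div_mod_pt nat_mod_less\<close>)
        moreover have "ap (shift ?v) k = p * (i div p) + nat ((z + e) mod int p)"
          by (rule pt_eqI_int)
            (use p_pos dv in \<open>simp_all add: ap_shift_mod div_mod_pt nat_mod_less e_def algebra_simps\<close>)
        ultimately show ?thesis using inv[OF g ik(1,2,3)] by simp
      qed
      have wi: "i div p < p ^ n" using ik(1) div_less_power by blast
      have steps: "R (p * (i div p) + nat (z mod int p)) (p * (i div p) + nat ((z + int t * e) mod int p))"
        for z t
      proof (induction t)
        case 0
        show ?case using refl less[OF wi] nat_mod_less by simp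
      next
        case (Suc t)
        have "R (p * (i div p) + nat (z mod int p)) (p * (i div p) + nat ((z + int t * e + e) mod int p))"
          by (rule trn[OF less less less Suc.IH step]) (use wi nat_mod_less in auto)
        then show ?case by (simp add: algebra_simps)
      qed
      obtain u s where us: "u * e + s * int p = 1" using bezout_int[of e "int p"] cop by auto
      have i_all: "R (p * (i div p) + x) (p * (i div p) + y)" if xy: "x < p" "y < p" for x y
      proof -
        \<comment> \<open>The number of steps of size \<open>e\<close> leading from \<open>x\<close>
          to \<open>y\<close>; \<open>u\<close> inverts \<open>e\<close> modulo
          \<open>p\<close>.\<close>
        define t where "t = nat ((u * (int y - int x)) mod int p)"
        have "(int x + int t * e) mod int p = (int x + u * (int y - int x) * e) mod int p"
        proof -
          have "int t = (u * (int y - int x)) mod int p" unfolding t_def using p_pos by simp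
          then show ?thesis by (metis mod_add_right_eq mod_mult_left_eq)
        qed
        also have "u * (int y - int x) * e = (int y - int x) * (1 - s * int p)"
        proof -
          have "u * e = 1 - s * int p" using us by linarith
          moreover have "u * (int y - int x) * e = (int y - int x) * (u * e)" by (simp add: ac_simps)
          ultimately show ?thesis by simp
        qed
        also have "(int x + (int y - int x) * (1 - s * int p)) mod int p =
            (int y - (int y - int x) * s * int p) mod int p" by (simp add: algebra_simps)
        also have "\<dots> = int y mod int p"
          using mod_mult_self1[of "int y" "- ((int y - int x) * s)" "int p"] by simp
        also have "\<dots> = int y" using xy by simp
        finally show ?thesis using steps[of "int x" t] xy by simp
      qed
      have "R s t" if st: "s < ?m" "t < ?m" "s div p = t div p" for s t
      proof -
        obtain g where g: "g \<in> Pn (Suc n)" "ap g s = i" using Pn_trans[OF st(1) ik(1)] by blast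
        have gm: "- g \<in> Pn (Suc n)" using subgrp_minus[OF Pn_subgrp g(1)] .
        obtain v q where vq: "v \<in> Vn n" "q \<in> Pn n" "g = v + lift q" using g(1) by auto
        have "ap g t div p = ap g s div p" using vq st(3) by (auto simp: Vn_def)
        then have "ap g t = p * (i div p) + ap g t mod p" using g(2) by (metis mult_div_mod_eq)
        moreover have "i = p * (i div p) + i mod p" by simp
        ultimately have "R i (ap g t)" using i_all[of "i mod p" "ap g t mod p"] p_pos by (metis mod_less_divisor)
        then have "R (ap (- g) i) (ap (- g) (ap g t))" using inv[OF gm ik(1) ap_Pn[OF g(1) st(2)]] by blast
        then show ?thesis using g(2) by (metis ap_minus_ap(1))
      qed
      then have "\<forall>s<?m. \<forall>t<?m. R s t \<longleftrightarrow> s div p ^ 1 = t div p ^ 1" using same by (metis power_one_right)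
      then show ?thesis by (intro exI[of _ 1] conjI) simp_all
    next
      case False
      then have "\<forall>s<?m. \<forall>t<?m. R s t \<longleftrightarrow> s = t" using refl by metis
      then show ?thesis by (intro exI[of _ 0] conjI) simp_all
    qed
  qed
qed

end

text \<open>The induction hypothesis speaks of \<open>Pn n\<close> and \<open>Hn n\<close>, whereas
  the wreath step sees the lifted copy of \<open>Pn n\<close> with the larger group
  \<open>Hn (Suc n)\<close> acting through \<open>Hn n\<close>. This lemma bridges the two.\<close>

lemma stable_complements_iso:
  fixes f :: "'a::group_add \<Rightarrow> 'b::group_add"
  assumes G: "subgrp G" and f: "inj_on f G" "\<And>x y. x \<in> G \<Longrightarrow> y \<in> G \<Longrightarrow> f (x + y) = f x + f y"
    and act: "\<And>g x. g \<in> G \<Longrightarrow> x \<in> S \<Longrightarrow> act' (f g) x = act g x"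
    and H: "\<And>h. h \<in> H' \<Longrightarrow> \<exists>k\<in>H. \<forall>g\<in>G. k + g - k \<in> G \<and> h + f g - h = f (k + g - k)"
    and sc: "stable_complements G H act S"
  shows "stable_complements (f ` G) H' act' S"
  unfolding stable_complements_def
proof (intro allI impI)
  fix N' C' assume N': "subgrp N'" "N' \<subseteq> f ` G" "conj_stable (f ` G) N'"
    and C': "complements (f ` G) N' C'"
  have f_minus: "f (- x) = - f x" if "x \<in> G" for x
  proof -
    have "f 0 + f 0 = f 0 + 0" using f(2)[of 0 0] subgrp_0[OF G] by simp
    then have "f 0 = 0" by (rule add_left_imp_eq)
    then have "f x + f (- x) = 0" using f(2)[OF that subgrp_minus[OF G that]] by simp
    then show ?thesis by (metis minus_unique)
  qed
  have f0: "f 0 = 0" using f_minus[OF subgrp_0[OF G]] f(2)[of 0 0] subgrp_0[OF G]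
    by (metis add.right_inverse add.right_neutral add_left_imp_eq)
  have f_conj: "f (a + b - a) = f a + f b - f a" if "a \<in> G" "b \<in> G" for a b
    using that f(2) f_minus subgrp_add[OF G] subgrp_minus[OF G] by (simp add: diff_conv_add_uminus del: add_uminus_conv_diff)
  define pull where "pull A = {g \<in> G. f g \<in> A}" for A
  have pull_image: "f ` pull A = A" if "A \<subseteq> f ` G" for A using that by (auto simp: pull_def)
  have pull_subgrp: "subgrp (pull A)" if "subgrp A" for A
    using that G f(2) f_minus f0 unfolding subgrp_def pull_def by auto
  have C'G: "C' \<subseteq> f ` G" using complements_subset[OF C'] .
  have "complements G (pull N') (pull C')"
    unfolding complements_def
  proof (intro conjI ballI)
    show "subgrp (pull C')" using pull_subgrp complements_subgrp[OF C'] by blast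
    show "pull C' \<subseteq> G" by (auto simp: pull_def)
    have "g = 0" if "g \<in> pull N'" "g \<in> pull C'" for g
    proof -
      have "f g = 0" using complements_Int[OF C'] that by (auto simp: pull_def)
      then show "g = 0" using f0 inj_onD[OF f(1), of g 0] that subgrp_0[OF G] by (auto simp: pull_def)
    qed
    then show "pull N' \<inter> pull C' = {0}"
      using subgrp_0[OF pull_subgrp[OF N'(1)]] subgrp_0[OF pull_subgrp[OF complements_subgrp[OF C']]] by blast
    fix g assume g: "g \<in> G"
    obtain x c where xc: "x \<in> N'" "c \<in> C'" "f g = x + c"
      by (rule complements_decomp[OF C' imageI[OF g]])
    obtain y d where yd: "y \<in> G" "x = f y" "d \<in> G" "c = f d" using xc N'(2) C'G by blast
    have "f g = f (y + d)" using f(2) yd xc by simp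
    then have "g = y + d" using inj_onD[OF f(1)] g subgrp_add[OF G yd(1,3)] by blast
    then show "\<exists>x\<in>pull N'. \<exists>c\<in>pull C'. g = x + c" using xc yd unfolding pull_def by blast
  qed
  moreover have "conj_stable G (pull N')"
  proof (rule conj_stableI)
    fix a b assume "a \<in> G" "b \<in> pull N'"
    then show "a + b - a \<in> pull N'"
      using f_conj[of a b] conj_stableD[OF N'(3) imageI, of a "f b"] subgrp_add[OF G] subgrp_diff[OF G]
      by (simp add: pull_def)
  qed
  moreover have "pull N' \<subseteq> G" by (auto simp: pull_def)
  ultimately obtain D where D: "complements G (pull N') D" "conj_stable H D"
    "\<And>x. x \<in> S \<Longrightarrow> \<exists>y\<in>S. card (orb act D y) \<le> card (orb act (pull C') x)"
    using stable_complementsD[OF sc pull_subgrp[OF N'(1)]] by metis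
  have DG: "D \<subseteq> G" using complements_subset[OF D(1)] .
  have orb: "orb act' (f ` A) x = orb act A x" if "A \<subseteq> G" "x \<in> S" for A x
    using that act by (auto simp: orb_def image_image intro!: image_cong)
  have "complements (f ` G) N' (f ` D)"
    unfolding complements_def
  proof (intro conjI ballI)
    show "subgrp (f ` D)"
      using f(2) DG by (intro subgrp_image complements_subgrp[OF D(1)]) blast
    show "f ` D \<subseteq> f ` G" using DG by blast
    show "N' \<inter> f ` D = {0}"
    proof (intro equalityI subsetI)
      fix z assume "z \<in> N' \<inter> f ` D"
      then obtain d where d: "d \<in> D" "z = f d" "d \<in> pull N'" using DG by (auto simp: pull_def)
      then have "d = 0" using complements_Int[OF D(1)] by blast
      then show "z \<in> {0}" using d f0 by simp
    next
      fix z :: 'b assume "z \<in> {0}"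
      moreover have "f 0 \<in> f ` D" using subgrp_0[OF complements_subgrp[OF D(1)]] by (rule imageI)
      ultimately show "z \<in> N' \<inter> f ` D" using subgrp_0[OF N'(1)] f0 by simp
    qed
    fix z assume "z \<in> f ` G"
    then obtain g where g: "g \<in> G" "z = f g" by blast
    obtain x c where xc: "x \<in> pull N'" "c \<in> D" "g = x + c" by (rule complements_decomp[OF D(1) g(1)])
    then have "z = f x + f c" using f(2) DG g by (auto simp: pull_def)
    then show "\<exists>x\<in>N'. \<exists>c\<in>f ` D. z = x + c" using xc by (auto simp: pull_def)
  qed
  moreover have "conj_stable H' (f ` D)"
  proof (rule conj_stableI)
    fix h z assume h: "h \<in> H'" and "z \<in> f ` D"
    then obtain d where d: "d \<in> D" "z = f d" by blast
    obtain k where k: "k \<in> H" "\<forall>g\<in>G. k + g - k \<in> G \<and> h + f g - h = f (k + g - k)" using H[OF h] by blast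
    then show "h + z - h \<in> f ` D" using conj_stableD[OF D(2) k(1) d(1)] d DG by auto
  qed
  moreover have "\<exists>y\<in>S. card (orb act' (f ` D) y) \<le> card (orb act' C' x)" if x: "x \<in> S" for x
  proof -
    have "orb act' C' x = orb act (pull C') x"
      using orb[of "pull C'" x] pull_image[OF C'G] x by (auto simp: pull_def)
    then show ?thesis using D(3)[OF x] orb[OF DG] by simp
  qed
  ultimately show "\<exists>D'. complements (f ` G) N' D' \<and> conj_stable H' D' \<and>
      (\<forall>x\<in>S. \<exists>y\<in>S. card (orb act' D' y) \<le> card (orb act' C' x))" by blast
qed

section \<open>The tower as an instance of the wreath construction\<close>

context prime_tower
begin

text \<open>Both this action on fibres and the coordinate \<open>co\<close> are read off at the zero
  position \<open>p * w\<close> of the fibre \<open>w\<close>.\<close>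

definition act :: "nperm \<Rightarrow> nat \<Rightarrow> nat" where "act g w = ap g (p * w) div p"

definition co :: "nperm \<Rightarrow> nat \<Rightarrow> int" where "co g w = int (ap g (p * w) mod p)"

lemma act_lift: "act (lift q) w = ap q w"
  using p_pos by (simp add: act_def)

lemma act_h: "a \<in> {1..<p} \<Longrightarrow> act (lift k + scale m a) w = ap k w"
  using p_pos by (simp add: act_def ap_scale_div)

lemma co_shift: "co (shift v) w = v w mod int p"
  using p_pos unfolding co_def ap_shift_mod by simp

lemma Pn_less: "g \<in> Pn n \<Longrightarrow> ap g i < p ^ n \<longleftrightarrow> i < p ^ n"
  using supp_below_less Pn_supp by blast

lemma Hn_less: "g \<in> Hn n \<Longrightarrow> ap g i < p ^ n \<longleftrightarrow> i < p ^ n"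
  using supp_below_less Hn_supp by blast

lemma acts_lift_Pn: "acts act (lift ` Pn n) {..<p ^ n}"
proof (rule actsI)
  show "subgrp (lift ` Pn n)" by (rule lift_image_subgrp[OF Pn_subgrp])
  show "act 0 w = w" for w using act_lift[of 0 w] by (simp add: lift_0)
  fix g w assume "g \<in> lift ` Pn n"
  then obtain q where q: "q \<in> Pn n" "g = lift q" by blast
  show "act g w \<in> {..<p ^ n}" if "w \<in> {..<p ^ n}" using that Pn_less[OF q(1)] by (simp add: q(2) act_lift)
  fix h assume "h \<in> lift ` Pn n"
  then obtain r where r: "h = lift r" by blast
  show "act (g + h) w = act g (act h w)" unfolding q(2) r lift_add[symmetric] act_lift by simp
qed

lemma acts_Hn: "acts act (Hn (Suc n)) {..<p ^ n}"
proof (rule actsI)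
  show "subgrp (Hn (Suc n))" by (rule Hn_subgrp)
  show "act 0 w = w" for w using act_lift[of 0 w] by (simp add: lift_0)
  fix g w assume g: "g \<in> Hn (Suc n)"
  obtain k a where k: "k \<in> Hn n" "a \<in> {1..<p}" "g = lift k + scale (p ^ n) a" by (rule Hn_SucE[OF g])
  show "act g w \<in> {..<p ^ n}" if "w \<in> {..<p ^ n}"
    using that Hn_less[OF k(1)] unfolding k(3) act_h[OF k(2)] by simp
  fix h assume h: "h \<in> Hn (Suc n)"
  obtain l b where l: "l \<in> Hn n" "b \<in> {1..<p}" "h = lift l + scale (p ^ n) b" by (rule Hn_SucE[OF h])
  have "ap (g + h) (p * w) div p = ap k (ap l w)"
    unfolding k(3) l(3) using p_pos by (simp add: ap_scale_div[OF k(2)] ap_scale_div[OF l(2)])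
  then show "act (g + h) w = act g (act h w)"
    unfolding k(3) l(3) act_h[OF k(2)] act_h[OF l(2)] by (simp add: act_def)
qed

lemma Hn_conj_lift_image:
  assumes h: "h \<in> Hn (Suc n)"
  shows "\<exists>k\<in>Hn n. (\<forall>w. act h w = ap k w) \<and>
    (\<forall>q\<in>Pn n. k + q - k \<in> Pn n \<and> h + lift q - h = lift (k + q - k))"
proof -
  obtain k a where k: "k \<in> Hn n" "a \<in> {1..<p}" "h = lift k + scale (p ^ n) a" by (rule Hn_SucE[OF h])
  have "k + q - k \<in> Pn n" if "q \<in> Pn n" for q using conj_stableD[OF Hn_Pn k(1) that] .
  moreover have "h + lift q - h = lift (k + q - k)" if "q \<in> Pn n" for q
    unfolding k(3) by (rule Hn_conj_lift[OF k(1,2)]) (use that Pn_supp in blast)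
  ultimately show ?thesis using k(1) act_h[OF k(2)] k(3) by blast
qed

text \<open>As \<open>B\<close> is normalised by the lifted \<open>Pn n\<close>, lying in the same
  \<open>B\<close>-orbit is an invariant equivalence relation. It is therefore one of the levels,
  which \<open>Hn\<close> preserves whether or not it normalises \<open>B\<close>.\<close>

lemma blocks_Hn:
  assumes B: "subgrp B" "B \<subseteq> lift ` Pn n" "conj_stable (lift ` Pn n) B"
    and x: "x < p ^ n" and y: "y \<in> orb act B x" and h: "h \<in> Hn (Suc n)"
  shows "act h y \<in> orb act B (act h x)"
proof -
  note actP = acts_lift_Pn[of n]
  have actB: "acts act B {..<p ^ n}" by (rule acts_subset[OF actP B(1,2)])
  have "\<exists>j\<le>n. \<forall>i<p ^ n. \<forall>k<p ^ n. k \<in> orb act B i \<longleftrightarrow> i div p ^ j = k div p ^ j"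
  proof (rule invariant_equiv_level)
    show "i \<in> orb act B i" if "i < p ^ n" for i using orb_self[OF actB, of i] that by simp
    show "i \<in> orb act B k" if "i < p ^ n" "k \<in> orb act B i" for i k
      using orb_sym[OF actB, of i k] that by simp
    show "l \<in> orb act B i" if "i < p ^ n" "k \<in> orb act B i" "l \<in> orb act B k" for i k l
      using orb_trans[OF actB, of i k l] that by simp
    fix g i k assume g: "g \<in> Pn n" and i: "i < p ^ n" and "k \<in> orb act B i"
    then obtain b where b: "b \<in> B" "k = act b i" by (auto simp: orb_def)
    have lg: "lift g \<in> lift ` Pn n" "b \<in> lift ` Pn n" "i \<in> {..<p ^ n}" using g b B i by auto
    have cB: "lift g + b - lift g \<in> B" using conj_stableD[OF B(3) lg(1) b(1)] .
    then have cP: "lift g + b - lift g \<in> lift ` Pn n" using B by blast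
    have "act (lift g + b - lift g) (act (lift g) i) = act (lift g + b - lift g + lift g) i"
      by (rule acts_add[OF actP cP lg(1,3), symmetric])
    also have "\<dots> = act (lift g) (act b i)"
      using acts_add[OF actP lg] by simp
    finally show "ap g k \<in> orb act B (ap g i)"
      using cB b(2) unfolding act_lift orb_def by force
  qed
  then obtain j where j: "\<forall>i<p ^ n. \<forall>k<p ^ n. k \<in> orb act B i \<longleftrightarrow> i div p ^ j = k div p ^ j" by blast
  obtain k where k: "k \<in> Hn n" "\<forall>w. act h w = ap k w" using Hn_conj_lift_image[OF h] by blast
  have y': "y < p ^ n" using orb_subset[OF actB, of x] x y by auto
  have "x div p ^ j = y div p ^ j" using j x y y' by blast
  then have "ap k x div p ^ j = ap k y div p ^ j" by (rule Hn_level[OF k(1)])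
  then show ?thesis using j k(2) Hn_less[OF k(1)] x y' by simp
qed

text \<open>The base point is 0, fixed by every scaling, and the section picks position 0 in each
  fibre, so that \<open>co\<close> measures how far a shift leaves the section.\<close>

lemma wreath_points_tower:
  "wreath_points p (Vn n) (lift ` Pn n) (Hn (Suc n)) {..<p ^ n} act co 0
    {..<p ^ Suc n} ap (\<lambda>i. i div p) (\<lambda>w. p * w)"
proof
  show "Factorial_Ring.prime p" by (rule p)
  show "subgrp (Vn n)" "finite (Vn n)" by (rule Vn_subgrp, rule finite_Vn)
  show "\<exists>b. card (Vn n) = p ^ b" using card_Vn by blast
  show "subgrp (lift ` Pn n)" by (rule lift_image_subgrp[OF Pn_subgrp])
  show "finite (lift ` Pn n)" using finite_Pn by blast
  show "\<exists>a. card (lift ` Pn n) = p ^ a" unfolding card_lift by (rule card_Pn)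
  show "subgrp (Hn (Suc n))" "finite (Hn (Suc n))" by (rule Hn_subgrp, rule finite_Hn)
  show "coprime (card (Hn (Suc n))) p" by (rule coprime_card_Hn)
  show "v + w = w + v" if v: "v \<in> Vn n" and w: "w \<in> Vn n" for v w
  proof -
    obtain f where "v = shift f" using v unfolding Vn_def by blast
    moreover obtain g where "w = shift g" using w unfolding Vn_def by blast
    ultimately show ?thesis by (simp add: shift_add add.commute)
  qed
  show "conj_stable (lift ` Pn n) (Vn n)"
    using lift_conj_Vn Pn_supp by (intro conj_stableI) blast
  show "conj_stable (Hn (Suc n)) (Vn n)" by (rule Hn_Vn)
  show "conj_stable (Hn (Suc n)) (lift ` Pn n)"
  proof (rule conj_stableI)
    fix h q assume h: "h \<in> Hn (Suc n)" and "q \<in> lift ` Pn n"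
    then obtain r where "r \<in> Pn n" "q = lift r" by blast
    then show "h + q - h \<in> lift ` Pn n" using Hn_conj_lift_image[OF h] by auto
  qed
  show "Vn n \<inter> lift ` Pn n = {0}"
    using Vn_lift_disjoint subgrp_0[OF Vn_subgrp] subgrp_0[OF lift_image_subgrp[OF Pn_subgrp]] by blast
  show "finite {..<p ^ n}" "(0::nat) \<in> {..<p ^ n}" using p_pos by auto
  show "acts act (lift ` Pn n) {..<p ^ n}" "acts act (Hn (Suc n)) {..<p ^ n}"
    by (rule acts_lift_Pn, rule acts_Hn)
  show "act h (act q x) = act (h + q - h) (act h x)"
    if h: "h \<in> Hn (Suc n)" and q: "q \<in> lift ` Pn n" for h q x
  proof -
    obtain k where k: "k \<in> Hn n" "\<forall>w. act h w = ap k w"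
      "\<forall>q\<in>Pn n. k + q - k \<in> Pn n \<and> h + lift q - h = lift (k + q - k)"
      using Hn_conj_lift_image[OF h] by blast
    obtain r where r: "r \<in> Pn n" "q = lift r" using q by blast
    then have "h + q - h = lift (k + r - k)" using k(3) by blast
    then show ?thesis unfolding r(2) by (simp only: k(2) act_lift) simp
  qed
  show "\<exists>q\<in>lift ` Pn n. act q x = y" if "x \<in> {..<p ^ n}" "y \<in> {..<p ^ n}" for x y
    using Pn_trans[of x n y] that by (auto simp: act_lift)
  show "q = 0" if q: "q \<in> lift ` Pn n" and fixed: "\<And>x. x \<in> {..<p ^ n} \<Longrightarrow> act q x = x" for q
  proof -
    obtain r where r: "r \<in> Pn n" "q = lift r" using q by blast
    have "ap r i = i" for i
    proof (cases "i < p ^ n")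
      case True
      then show ?thesis using fixed[of i] r(2) by (simp add: act_lift)
    next
      case False
      moreover have "r \<in> supp_below (p ^ n)" using r(1) Pn_supp by blast
      ultimately show ?thesis by (simp add: supp_below_def)
    qed
    then have "r = 0" by (intro nperm_eqI) simp
    then show "q = 0" using r(2) lift_0 by simp
  qed
  show "act h 0 = 0" if "h \<in> Hn (Suc n)" for h
    using Hn_0[OF that] by (simp add: act_def)
  show "act h y \<in> orb act B (act h x)"
    if "subgrp B" "B \<subseteq> lift ` Pn n" "conj_stable (lift ` Pn n) B" "x \<in> {..<p ^ n}"
      "y \<in> orb act B x" "h \<in> Hn (Suc n)" for B x y h
    using blocks_Hn that by blast
  show "co (v + w) x = (co v x + co w x) mod int p" if v: "v \<in> Vn n" and w: "w \<in> Vn n" for v w x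
  proof -
    obtain f where "v = shift f" using v unfolding Vn_def by blast
    moreover obtain g where "w = shift g" using w unfolding Vn_def by blast
    ultimately show ?thesis by (simp add: shift_add co_shift mod_simps)
  qed
  show "\<exists>v\<in>Vn n. \<forall>x\<in>{..<p ^ n}. co v x = f x mod int p" for f
  proof -
    let ?f = "\<lambda>x. if x < p ^ n then f x else 0"
    have "shift ?f \<in> Vn n" unfolding Vn_def by (intro CollectI exI[of _ ?f]) simp
    then show ?thesis by (intro bexI[of _ "shift ?f"]) (simp_all add: co_shift)
  qed
  show "v = 0" if v: "v \<in> Vn n" and zero: "\<And>x. x \<in> {..<p ^ n} \<Longrightarrow> co v x = 0" for v
  proof -
    obtain f where f: "v = shift f" "\<forall>x\<ge>p ^ n. f x = 0" using v unfolding Vn_def by blast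
    have "f x mod int p = 0" for x
    proof (cases "x < p ^ n")
      case True
      then show ?thesis using zero[of x] f(1) by (simp add: co_shift)
    qed (simp add: f(2))
    then have "shift f = shift (\<lambda>x. 0)" unfolding shift_eq_iff by simp
    then show "v = 0" using f(1) shift_0 by simp
  qed
  show "co (q + v - q) (act q x) = co v x" if q: "q \<in> lift ` Pn n" and v: "v \<in> Vn n" for q v x
  proof -
    obtain r where r: "q = lift r" using q by blast
    obtain f where f: "v = shift f" using v unfolding Vn_def by blast
    show ?thesis unfolding r f lift_conj_shift co_shift act_lift by simp
  qed
  show "\<exists>a. \<forall>v\<in>Vn n. \<forall>x\<in>{..<p ^ n}. co (h + v - h) (act h x) = a * co v x mod int p"
    if h: "h \<in> Hn (Suc n)" for h
  proof -
    obtain k a where k: "k \<in> Hn n" "a \<in> {1..<p}" "h = lift k + scale (p ^ n) a" by (rule Hn_SucE[OF h])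
    have "co (h + v - h) (act h x) = int a * co v x mod int p" if v: "v \<in> Vn n" for v x
    proof -
      obtain f where f: "v = shift f" "\<forall>x\<ge>p ^ n. f x = 0" using v by (auto simp: Vn_def)
      have "co (h + v - h) (act h x) = (int a * f x) mod int p"
        unfolding k(3) f(1) Hn_conj_shift[OF k(1,2) f(2)] co_shift act_h[OF k(2)] by simp
      then show ?thesis unfolding f(1) co_shift by (simp add: mod_simps)
    qed
    then show ?thesis by blast
  qed
  show "z div p \<in> {..<p ^ n}" if "z \<in> {..<p ^ Suc n}" for z
    using that div_less_power by auto
  show "p * x \<in> {..<p ^ Suc n}" if "x \<in> {..<p ^ n}" for x
    using that pt0_less_power by auto
  show "ap (v + q) z div p = act q (z div p)" if q: "q \<in> lift ` Pn n" and v: "v \<in> Vn n" for q v z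
  proof -
    obtain r where r: "q = lift r" using q by blast
    obtain f where f: "v = shift f" using v unfolding Vn_def by blast
    show ?thesis unfolding r f act_lift by simp
  qed
  show "ap (v + q) (p * x) = p * act q x"
    if q: "q \<in> lift ` Pn n" and v: "v \<in> Vn n" and 0: "co v (act q x) = 0" for q v x
  proof -
    obtain r where r: "q = lift r" using q by blast
    obtain f where f: "v = shift f" using v unfolding Vn_def by blast
    have z: "f (ap r x) mod int p = 0" using 0 unfolding f r act_lift co_shift .
    show ?thesis
      unfolding r f act_lift
      by (rule pt_eqI_int) (use p_pos z in \<open>simp_all add: ap_shift_mod\<close>)
  qed
qed

theorem stable_complements_tower: "stable_complements (Pn n) (Hn n) ap {..<p ^ n}"
proof (induction n)
  case 0
  show ?case
    unfolding stable_complements_def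
  proof (intro allI impI)
    fix N C assume "complements (Pn 0) N C"
    moreover from this have "C = {0}"
      using complements_subset subgrp_0[OF complements_subgrp] by fastforce
    ultimately show "\<exists>C'. complements (Pn 0) N C' \<and> conj_stable (Hn 0) C' \<and>
        (\<forall>x\<in>{..<p ^ 0}. \<exists>y\<in>{..<p ^ 0}. card (orb ap C' y) \<le> card (orb ap C x))"
      by (intro exI[of _ C]) (auto simp: conj_stable_def)
  qed
next
  case (Suc n)
  interpret wreath_points p "Vn n" "lift ` Pn n" "Hn (Suc n)" "{..<p ^ n}" act co 0
    "{..<p ^ Suc n}" ap "\<lambda>i. i div p" "\<lambda>w. p * w" by (rule wreath_points_tower)
  have "stable_complements (lift ` Pn n) (Hn (Suc n)) act {..<p ^ n}"
  proof (rule stable_complements_iso[OF Pn_subgrp _ _ _ _ Suc])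
    show "inj_on lift (Pn n)" by (intro inj_onI) (simp add: lift_eq_iff)
    show "\<exists>k\<in>Hn n. \<forall>g\<in>Pn n. k + g - k \<in> Pn n \<and> h + lift g - h = lift (k + g - k)"
      if "h \<in> Hn (Suc n)" for h using Hn_conj_lift_image[OF that] by blast
  qed (simp_all add: lift_add act_lift)
  then have "stable_complements P (Hn (Suc n)) ap {..<p ^ Suc n}"
    by (rule stable_complements_wreath)
  moreover have "P = Pn (Suc n)" by (simp add: P_def)
  ultimately show ?case by simp
qed

end

section \<open>Sylow conjugacy and the normaliser\<close>

text \<open>\<open>A\<close> acts by translation on the cosets of \<open>B\<close>, whose number
  \<open>k\<close> is prime to \<open>p\<close>. A fixed coset \<open>s + B\<close> says that
  \<open>A\<close> lies in the conjugate of \<open>B\<close> by \<open>s\<close>, and the orders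
  agree.\<close>

lemma sylow_conjugate:
  fixes S A B :: "'a::group_add set"
  assumes p: "Factorial_Ring.prime p" and S: "subgrp S" "finite S" "card S = p ^ a * k" "\<not> p dvd k"
    and A: "subgrp A" "A \<subseteq> S" "card A = p ^ a" and B: "subgrp B" "B \<subseteq> S" "card B = p ^ a"
  shows "\<exists>g\<in>S. (\<lambda>b. g + b - g) ` B = A"
proof -
  define cos where "cos = (\<lambda>s. (+) s ` B) ` S"
  define ac :: "'a \<Rightarrow> 'a set \<Rightarrow> 'a set" where "ac a Y = (+) a ` Y" for a Y
  have ac_coset: "ac a ((+) s ` B) = (+) (a + s) ` B" for a s
    by (simp add: ac_def image_image add.assoc)
  have act: "acts ac A cos"
  proof (rule actsI[OF A(1)])
    show "ac g Y \<in> cos" if "g \<in> A" "Y \<in> cos" for g Y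
      using that A(2) subgrp_add[OF S(1)] by (auto simp: cos_def ac_coset)
    show "ac 0 Y = Y" for Y by (simp add: ac_def)
    show "ac (g + h) Y = ac g (ac h Y)" for g h Y by (simp add: ac_def image_image add.assoc)
  qed
  have "card cos * p ^ a = k * p ^ a"
    using card_cosets[OF B(1) S(1) B(2) S(2)] S(3) B(3) unfolding cos_def by (metis mult.commute)
  then have "card cos = k" using p prime_gt_0_nat by simp
  moreover have fin: "finite A" "finite cos" using A S finite_subset by (auto simp: cos_def)
  ultimately have "card {Y \<in> cos. \<forall>g\<in>A. ac g Y = Y} mod p \<noteq> 0"
    using p_group_fixed_points[OF p act fin(2,1) A(3)] S(4) by (simp add: mod_eq_0_iff_dvd)
  then have "{Y \<in> cos. \<forall>g\<in>A. ac g Y = Y} \<noteq> {}" by (metis card.empty mod_0)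
  then obtain s where s: "s \<in> S" "\<forall>g\<in>A. ac g ((+) s ` B) = (+) s ` B" by (auto simp: cos_def)
  have "A \<subseteq> (\<lambda>b. s + b - s) ` B"
  proof
    fix g assume g: "g \<in> A"
    then have "(+) (g + s) ` B = (+) s ` B" using s(2) ac_coset by simp
    then have "- s + (g + s) \<in> B" using coset_eq_iff[OF B(1)] by simp
    moreover have "g = s + (- s + (g + s)) - s" by (simp add: group_simps del: add_uminus_conv_diff)
    ultimately show "g \<in> (\<lambda>b. s + b - s) ` B" by blast
  qed
  moreover have "card ((\<lambda>b. s + b - s) ` B) \<le> card A"
    using A B S finite_subset by (metis card_image_le)
  ultimately have "A = (\<lambda>b. s + b - s) ` B"
    using finite_subset[OF B(2) S(2)] by (intro card_seteq finite_imageI)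
  then show ?thesis using s(1) by blast
qed

section \<open>The order of \<open>Pn\<close> and the normaliser of \<open>Pn\<close>\<close>

context prime_tower
begin

text \<open>Legendre's recursion. Among the factors from \<open>p * m + 1\<close> to
  \<open>p * Suc m\<close> only the last is divisible by \<open>p\<close>, and it contributes one
  more than \<open>Suc m\<close> does.\<close>

lemma multiplicity_fact_mult: "multiplicity p (fact (p * m) :: nat) = m + multiplicity p (fact m :: nat)"
proof (induction m)
  case (Suc m)
  have pe: "prime_elem p" using p by simp
  have step: "multiplicity p (fact (p * m + r) :: nat) = multiplicity p (fact (p * m) :: nat)"
    if "r < p" for r
    using that
  proof (induction r)
    case (Suc r)
    have "\<not> p dvd p * m + Suc r" using Suc.prems by (simp add: dvd_add_right_iff nat_dvd_not_less del: add_Suc_right)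
    then have "multiplicity p (p * m + Suc r) = 0" by (rule not_dvd_imp_multiplicity_0)
    moreover have "(fact (p * m + Suc r) :: nat) = (p * m + Suc r) * fact (p * m + r)" by simp
    ultimately show ?case
      using Suc prime_elem_multiplicity_mult_distrib[OF pe, of "p * m + Suc r" "fact (p * m + r)"]
      by (simp del: fact_Suc)
  qed simp
  have "p * Suc m = Suc (p * m + (p - 1))" using p_pos by simp
  then have "(fact (p * Suc m) :: nat) = (p * Suc m) * fact (p * m + (p - 1))"
    by (metis fact_Suc of_nat_id)
  moreover have "multiplicity p (p * Suc m * fact (p * m + (p - 1))) =
      multiplicity p (p * Suc m) + multiplicity p (fact (p * m + (p - 1)) :: nat)"
    by (rule prime_elem_multiplicity_mult_distrib[OF pe]) (use p_pos in auto)
  ultimately have "multiplicity p (fact (p * Suc m) :: nat) =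
      multiplicity p (p * Suc m) + multiplicity p (fact (p * m + (p - 1)) :: nat)" by simp
  also have "\<dots> = multiplicity p (p * Suc m) + multiplicity p (fact (p * m) :: nat)"
    using step[of "p - 1"] p_pos by simp
  also have "multiplicity p (p * Suc m) = Suc (multiplicity p (Suc m))"
    using p_gt_1 by (intro multiplicity_times_same) auto
  also have "multiplicity p (fact (Suc m) :: nat) = multiplicity p (Suc m) + multiplicity p (fact m :: nat)"
    using prime_elem_multiplicity_mult_distrib[OF pe, of "Suc m" "fact m :: nat"] by simp
  ultimately show ?case using Suc by simp
qed simp

lemma card_Pn_sylow: "card (Pn n) = p ^ multiplicity p (fact (p ^ n) :: nat)"
proof (induction n)
  case (Suc n)
  then show ?case
    using card_Pn_Suc[of n] multiplicity_fact_mult[of "p ^ n"] by (simp add: power_add)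
qed simp

lemma Vn_subset_Pn: "Vn n \<subseteq> Pn (Suc n)"
proof
  fix v assume "v \<in> Vn n"
  then have "v + 0 \<in> Pn (Suc n)"
    using subgrp_0[OF lift_image_subgrp[OF Pn_subgrp]] unfolding Pn.simps by blast
  then show "v \<in> Pn (Suc n)" by simp
qed

lemma lift_Pn_subset: "lift ` Pn n \<subseteq> Pn (Suc n)"
proof
  fix q assume "q \<in> lift ` Pn n"
  then have "0 + q \<in> Pn (Suc n)" using subgrp_0[OF Vn_subgrp] unfolding Pn.simps by blast
  then show "q \<in> Pn (Suc n)" by simp
qed

lemma lift_Hn_subset: "lift ` Hn n \<subseteq> Hn (Suc n)"
proof
  fix q assume "q \<in> lift ` Hn n"
  then have "q + 0 \<in> Hn (Suc n)" using subgrp_0[OF Sn_subgrp] unfolding Hn.simps by blast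
  then show "q \<in> Hn (Suc n)" by simp
qed

lemma Pn_Suc_div:
  assumes "y \<in> Pn (Suc n)"
  obtains f r where "y = shift f + lift r" "r \<in> Pn n" "\<forall>x\<ge>p ^ n. f x = 0"
  using assms by (auto simp: Vn_def)

text \<open>Lying in a common fibre after applying \<open>g\<close> is an invariant equivalence
  relation, so it has some level \<open>j\<close>. The class of 0 is the preimage of one fibre and
  has \<open>p\<close> points, which forces \<open>j = 1\<close>.\<close>

lemma normaliser_level:
  assumes g: "g \<in> supp_below (p ^ Suc n)" and norm: "\<And>x. x \<in> Pn (Suc n) \<Longrightarrow> g + x - g \<in> Pn (Suc n)"
    and i: "i < p ^ Suc n" and k: "k < p ^ Suc n"
  shows "ap g i div p = ap g k div p \<longleftrightarrow> i div p = k div p"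
proof -
  let ?m = "p ^ Suc n"
  have "\<exists>j\<le>Suc n. \<forall>i<?m. \<forall>k<?m. ap g i div p = ap g k div p \<longleftrightarrow> i div p ^ j = k div p ^ j"
  proof (rule invariant_equiv_level)
    fix x i k assume x: "x \<in> Pn (Suc n)" and eq: "ap g i div p = ap g k div p"
    obtain f r where fr: "g + x - g = shift f + lift r" by (rule Pn_Suc_div[OF norm[OF x]])
    have "ap g (ap x i) = ap (g + x - g) (ap g i)" for i by simp
    then show "ap g (ap x i) div p = ap g (ap x k) div p" unfolding fr using eq by simp
  qed auto
  then obtain j where j: "j \<le> Suc n"
    "\<forall>i<?m. \<forall>k<?m. ap g i div p = ap g k div p \<longleftrightarrow> i div p ^ j = k div p ^ j" by blast
  let ?w = "ap g 0 div p"
  have m0: "0 < ?m" using p_pos by simp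
  have w: "?w < p ^ n" using supp_below_less[OF g, of 0] m0 div_less_power by blast
  have "{i. i < ?m \<and> ap g i div p = ?w} = {..<p ^ j}"
  proof -
    have le: "p ^ j \<le> ?m" using j(1) p_pos by (intro power_increasing) auto
    have "i < ?m \<and> ap g i div p = ?w \<longleftrightarrow> i < p ^ j" for i
    proof (cases "i < ?m")
      case True
      then have "ap g i div p = ?w \<longleftrightarrow> i div p ^ j = 0" using j(2) m0 by force
      then show ?thesis using True p_pos by (simp add: div_eq_0_iff)
    qed (use le in auto)
    then show ?thesis by auto
  qed
  moreover have "ap g ` {i. i < ?m \<and> ap g i div p = ?w} = {p * ?w..<p * ?w + p}"
  proof (intro equalityI subsetI)
    fix y assume "y \<in> ap g ` {i. i < ?m \<and> ap g i div p = ?w}"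
    then have "y div p = ?w" by auto
    then have "y = p * ?w + y mod p" by (metis mult_div_mod_eq)
    moreover have "y mod p < p" using p_pos by simp
    ultimately show "y \<in> {p * ?w..<p * ?w + p}" by (metis atLeastLessThan_iff le_add1 nat_add_left_cancel_less)
  next
    fix y assume y: "y \<in> {p * ?w..<p * ?w + p}"
    then obtain t where t: "y = p * ?w + t" "t < p" by (metis atLeastLessThan_iff le_Suc_ex nat_add_left_cancel_less)
    have "y < ?m" using pt_less_power[OF t(2)] w t(1) by blast
    then have "ap (- g) y < ?m" using supp_below_less[OF subgrp_minus[OF supp_below_subgrp g]] by blast
    moreover have "ap g (ap (- g) y) div p = ?w" using t div_mod_pt by simp
    ultimately show "y \<in> ap g ` {i. i < ?m \<and> ap g i div p = ?w}"
      by (intro image_eqI[of _ _ "ap (- g) y"]) auto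
  qed
  ultimately have "card (ap g ` {..<p ^ j}) = p" by simp
  moreover have "card (ap g ` {..<p ^ j}) = p ^ j" by (simp add: card_image inj_on_def ap_inj)
  ultimately have "p ^ j = p ^ 1" by simp
  then have "j = 1" using p_gt_1 by (simp only: power_inject_exp)
  then show ?thesis using j(2) i k by simp
qed

text \<open>Since fibres go to fibres, \<open>g\<close> induces a permutation \<open>b\<close> of
  the fibres. Conjugating lifts by \<open>g\<close> and looking at fibres only shows that
  \<open>b\<close> normalises \<open>Pn n\<close>, which makes induction possible.\<close>

lemma normaliser_quotient:
  assumes g: "g \<in> supp_below (p ^ Suc n)" and norm: "\<And>x. x \<in> Pn (Suc n) \<Longrightarrow> g + x - g \<in> Pn (Suc n)"
  obtains b where "b \<in> supp_below (p ^ n)" "\<And>i. ap g i div p = ap b (i div p)"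
    "\<And>q. q \<in> Pn n \<Longrightarrow> b + q - b \<in> Pn n"
proof -
  have level: "ap g i div p = ap g k div p \<longleftrightarrow> i div p = k div p"
    if "i < p ^ Suc n" "k < p ^ Suc n" for i k
    by (rule normaliser_level[OF g norm that])
  define f where "f w = ap g (p * w) div p" for w
  have beyond: "f w = w" if "w \<ge> p ^ n" for w
  proof -
    have "p * w \<ge> p ^ Suc n" using that by simp
    then have "ap g (p * w) = p * w" using g by (simp only: supp_below_def mem_Collect_eq)
    then show ?thesis using p_pos by (simp add: f_def)
  qed
  have less: "f w < p ^ n" if "w < p ^ n" for w
  proof -
    have "ap g (p * w) < p ^ Suc n" using supp_below_less[OF g] pt0_less_power that by blast
    then show ?thesis unfolding f_def using div_less_power by blast
  qed
  have "inj_on f {..<p ^ n}"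
  proof (rule inj_onI)
    fix w x assume "w \<in> {..<p ^ n}" "x \<in> {..<p ^ n}" "f w = f x"
    then have "p * w div p = p * x div p"
      using level[of "p * w" "p * x"] pt0_less_power unfolding f_def by blast
    then show "w = x" using p_pos by simp
  qed
  then have "f ` {..<p ^ n} = {..<p ^ n}" using less by (intro endo_inj_surj) auto
  then have "f permutes {..<p ^ n}"
    using \<open>inj_on f {..<p ^ n}\<close> beyond by (intro bij_imp_permutes) (auto simp: bij_betw_def not_less)
  then have bij: "bij f" by (rule permutes_bij)
  define b where "b = Nperm f"
  have ap_b: "ap b = f" unfolding b_def by (rule ap_Nperm[OF bij])
  have g_div: "ap g i div p = ap b (i div p)" for i
  proof (cases "i < p ^ Suc n")
    case True
    then have "p * (i div p) < p ^ Suc n" using div_less_power pt0_less_power by blast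
    then have "ap g i div p = ap g (p * (i div p)) div p" using level[OF True] p_pos by simp
    then show ?thesis by (simp add: ap_b f_def)
  next
    case False
    then have "ap g i = i" using g by (simp add: supp_below_def)
    moreover have "i div p \<ge> p ^ n" using False div_less_power[of i n] by linarith
    ultimately show ?thesis using beyond ap_b by simp
  qed
  have b_supp: "b \<in> supp_below (p ^ n)" using beyond by (simp add: supp_below_def ap_b)
  have b_norm: "b + q - b \<in> Pn n" if q: "q \<in> Pn n" for q
  proof -
    have "g + lift q - g \<in> Pn (Suc n)" using norm lift_Pn_subset q by blast
    then obtain e r where er: "g + lift q - g = shift e + lift r" "r \<in> Pn n"
      by (rule Pn_Suc_div)
    have "b + q - b = r"
    proof (rule nperm_eqI)
      fix w
      have k: "ap (- g) (p * w) div p = ap (- b) w"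
      proof -
        have "w = ap g (ap (- g) (p * w)) div p" using p_pos by simp
        also have "\<dots> = ap b (ap (- g) (p * w) div p)" by (rule g_div)
        finally show ?thesis by (metis ap_minus_ap(1))
      qed
      have "ap r w = ap (shift e + lift r) (p * w) div p" using p_pos by simp
      also have "\<dots> = ap (g + lift q - g) (p * w) div p" using er by simp
      also have "\<dots> = ap (b + q - b) w" by (simp add: g_div k)
      finally show "ap (b + q - b) w = ap r w" by simp
    qed
    then show ?thesis using er by simp
  qed
  show thesis by (rule that[OF b_supp g_div b_norm])
qed

lemma shift_of_fibre_preserving:
  assumes "y \<in> Pn (Suc n)" "\<And>i. ap y i div p = i div p"
  obtains f where "y = shift f" "\<forall>x\<ge>p ^ n. f x = 0"
proof -
  obtain f r where fr: "y = shift f + lift r" "\<forall>x\<ge>p ^ n. f x = 0" by (rule Pn_Suc_div[OF assms(1)])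
  have "ap r w = w" for w
    using assms(2)[of "p * w"] p_pos unfolding fr(1) by simp
  then have "r = 0" by (intro nperm_eqI) simp
  then show thesis using that fr lift_0 by simp
qed

text \<open>Conjugation by \<open>g\<close> takes the shift by 1 in all fibres to some shift
  \<open>f\<close>, so on the fibre \<open>w\<close> the map is affine with slope
  \<open>f w\<close>. Removing the constant terms by a shift leaves multiplications, and normalising
  the lifts makes the slopes equal.\<close>

lemma normaliser_fibrewise:
  assumes g: "g \<in> supp_below (p ^ Suc n)" and norm: "\<And>x. x \<in> Pn (Suc n) \<Longrightarrow> g + x - g \<in> Pn (Suc n)"
    and fib: "\<And>i. ap g i div p = i div p"
  shows "\<exists>v\<in>Vn n. \<exists>s\<in>Sn n. g = v + s"
proof -
  define pos where "pos w x = int (ap g (p * w + x) mod p)" for w x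
  let ?one = "\<lambda>w. if w < p ^ n then 1 else 0 :: int"
  have one: "shift ?one \<in> Vn n" unfolding Vn_def by (intro CollectI exI[of _ ?one]) simp
  have ap_gm: "ap (- g) i div p = i div p" for i using fib[of "ap (- g) i"] by simp
  have "shift ?one \<in> Pn (Suc n)" using one Vn_subset_Pn by blast
  from shift_of_fibre_preserving[OF norm[OF this]] obtain f where f: "g + shift ?one - g = shift f"
    by (metis ap_diff ap_gm ap_plus ap_shift_div fib)
  have step: "pos w (Suc x) = (pos w x + f w) mod int p" if w: "w < p ^ n" and x: "Suc x < p" for w x
  proof -
    have x': "x < p" using x by simp
    have "ap (shift ?one) (p * w + x) = p * w + Suc x"
      by (rule pt_eqI_int) (use w x x' div_mod_pt[OF x, of w] div_mod_pt[OF x', of w] in \<open>simp_all only: ap_shift_div ap_shift_mod, simp_all\<close>)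
    then have "ap g (p * w + Suc x) = ap (g + shift ?one - g) (ap g (p * w + x))" by simp
    then have "pos w (Suc x) = int (ap (shift f) (ap g (p * w + x)) mod p)" unfolding f pos_def by simp
    then show ?thesis unfolding ap_shift_mod fib pos_def using div_mod_pt[OF x', of w] by simp
  qed
  have lin: "pos w x = (pos w 0 + int x * f w) mod int p" if w: "w < p ^ n" and x: "x < p" for w x
    using x
  proof (induction x)
    case 0
    then show ?case by (simp add: pos_def zmod_int)
  next
    case (Suc x)
    then have "pos w (Suc x) = ((pos w 0 + int x * f w) mod int p + f w) mod int p"
      using step[OF w, of x] by simp
    then show ?case by (simp add: mod_simps algebra_simps)
  qed
  \<comment> \<open>The images of the positions 0, that is the constant terms; \<open>t\<close> is
    \<open>g\<close> with them removed.\<close>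
  define c where "c w = (if w < p ^ n then pos w 0 else 0)" for w
  have cV: "shift c \<in> Vn n" unfolding Vn_def by (intro CollectI exI[of _ c]) (simp add: c_def)
  define t where "t = - shift c + g"
  have gt: "g = shift c + t" by (simp add: t_def add.assoc[symmetric])
  have mc: "- shift c \<in> Pn (Suc n)"
    using cV Vn_subset_Pn subgrp_minus[OF Vn_subgrp] by blast
  have t_norm: "t + x - t \<in> Pn (Suc n)" if x: "x \<in> Pn (Suc n)" for x
  proof -
    have "- shift c + (g + x - g) - - shift c \<in> Pn (Suc n)"
      using conj_stableD[OF conj_stable_self[OF Pn_subgrp] mc norm[OF x]] .
    then show ?thesis unfolding t_def by (simp add: group_simps del: add_uminus_conv_diff)
  qed
  have t_div: "ap t i div p = i div p" for i
    unfolding t_def using fib by (simp add: shift_minus)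
  have t_mod: "int (ap t (p * w + x) mod p) = (int x * f w) mod int p" if w: "w < p ^ n" and x: "x < p" for w x
  proof -
    have "int (ap t (p * w + x) mod p) = (pos w x + - c w) mod int p"
      unfolding t_def ap_plus shift_minus ap_shift_mod fib pos_def using div_mod_pt[OF x, of w] by simp
    also have "\<dots> = ((pos w 0 + int x * f w) mod int p - pos w 0) mod int p"
      using lin[OF w x] w by (simp add: c_def)
    finally show ?thesis by (simp add: mod_simps)
  qed
  have m0: "(0::nat) < p ^ n" using p_pos by simp
  \<comment> \<open>\<open>q\<close> carries the fibre 0 to \<open>w\<close>. Comparing both sides
    at position 0 shows that \<open>e w\<close> vanishes modulo \<open>p\<close>, and at position 1
    that the slopes agree.\<close>
  have f_const: "f w mod int p = f 0 mod int p" if w: "w < p ^ n" for w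
  proof -
    obtain q where q: "q \<in> Pn n" "ap q 0 = w" using Pn_trans[OF m0 w] by blast
    have "t + lift q - t \<in> Pn (Suc n)" using t_norm lift_Pn_subset q by blast
    then obtain e r where er: "t + lift q - t = shift e + lift r" by (rule Pn_Suc_div)
    have eq: "t + lift q = shift e + lift r + t"
      unfolding er[symmetric] by simp
    have lift_pt: "ap (lift s) (p * u + x) = p * ap s u + x" if "x < p" for s u x
      by (rule pt_eqI) (use div_mod_pt[OF that] in simp_all)
    have key: "(int x * f w) mod int p = (int x * f 0 + e w) mod int p" if x: "x < p" for x
    proof -
      have ti: "ap t x div p = 0" "ap t x div p = x div p" using t_div[of x] x by auto
      have "ap (t + lift q) x = ap (shift e + lift r + t) x" using eq by simp
      moreover have "ap (t + lift q) x = ap t (p * w + x)" using lift_pt[OF x, of q 0] q(2) by simp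
      ultimately have tw: "ap t (p * w + x) = ap (shift e) (ap (lift r) (ap t x))" by simp
      have "ap r 0 = w"
        using arg_cong[OF tw, of "\<lambda>i. i div p"] t_div div_mod_pt[OF x] ti by simp
      then have "int (ap t (p * w + x) mod p) = (int (ap t x mod p) + e w) mod int p"
        unfolding tw ap_shift_mod using ti by simp
      then show ?thesis using t_mod[OF w x] t_mod[OF m0 x] by (simp add: mod_simps)
    qed
    have "e w mod int p = 0" using key[of 0] p_pos by simp
    then show ?thesis using key[of 1] p_gt_1 by (metis mod_add_right_eq add.right_neutral mult_1 of_nat_1)
  qed
  define a where "a = nat (f 0 mod int p)"
  have a: "int a = f 0 mod int p" unfolding a_def using p_pos by simp
  \<comment> \<open>Slope 0 would send the positions 0 and 1 of the fibre 0 to one point.\<close>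
  have "a \<noteq> 0"
  proof
    assume "a = 0"
    then have "int (ap t 1 mod p) = int (ap t 0 mod p)"
      using t_mod[OF m0, of 1] t_mod[OF m0, of 0] a p_gt_1 by simp
    moreover have "ap t 1 div p = ap t 0 div p" using t_div[of 1] t_div[of 0] p_gt_1 by simp
    ultimately have "ap t 1 = ap t 0" by (rule pt_eqI_int[rotated])
    then show False by (simp add: ap_inj)
  qed
  moreover have "a < p" unfolding a_def by (rule nat_mod_less)
  ultimately have ap: "a \<in> {1..<p}" by simp
  have "t = scale (p ^ n) a"
  proof (rule nperm_eqI, rule pt_eqI_int)
    fix i
    show "int (ap t i mod p) = int (ap (scale (p ^ n) a) i mod p)"
    proof (cases "i div p < p ^ n")
      case True
      have x: "i mod p < p" using p_pos by simp
      have "int (ap t i mod p) = (int (i mod p) * f (i div p)) mod int p"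
        using t_mod[OF True x] by simp
      also have "\<dots> = (int (i mod p) * (f (i div p) mod int p)) mod int p" by (simp only: mod_mult_right_eq)
      also have "\<dots> = (int (i mod p) * int a) mod int p" using f_const[OF True] a by simp
      finally show ?thesis using True by (simp only: ap_scale_mod_int[OF ap] if_True mult.commute)
    next
      case False
      then have "i \<ge> p ^ Suc n" using div_less_power[of i n] by linarith
      moreover have "t \<in> supp_below (p ^ Suc n)"
        unfolding t_def using mc Pn_supp g subgrp_add[OF supp_below_subgrp] by blast
      ultimately have "ap t i = i" by (simp only: supp_below_def mem_Collect_eq)
      then show ?thesis using False by (simp only: ap_scale_mod_int[OF ap] if_False)
    qed
  qed (simp add: t_div ap_scale_div[OF ap])
  then have "t \<in> Sn n" using ap by (simp add: Sn_def)
  then show ?thesis using gt cV by blast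
qed

text \<open>The induced permutation of fibres factors by induction, and what remains fixes each
  fibre and is a shift times a scaling. Hence the normaliser is the product of \<open>Pn n\<close>
  and \<open>Hn n\<close>.\<close>

lemma normaliser_Pn:
  assumes "g \<in> supp_below (p ^ n)" "\<And>x. x \<in> Pn n \<Longrightarrow> g + x - g \<in> Pn n"
  shows "\<exists>x\<in>Pn n. \<exists>h\<in>Hn n. g = x + h"
  using assms
proof (induction n arbitrary: g)
  case 0
  have "ap g i = i" for i
    using 0(1) supp_below_less[OF 0(1), of 0] by (cases "i = 0") (auto simp: supp_below_def)
  then have "g = 0" by (intro nperm_eqI) simp
  then show ?case by simp
next
  case (Suc n)
  obtain b where b: "b \<in> supp_below (p ^ n)" "\<And>i. ap g i div p = ap b (i div p)"
    "\<And>q. q \<in> Pn n \<Longrightarrow> b + q - b \<in> Pn n"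
    using normaliser_quotient[OF Suc.prems] by blast
  obtain q h where qh: "q \<in> Pn n" "h \<in> Hn n" "b = q + h" using Suc.IH[OF b(1,3)] by blast
  have qP: "lift q \<in> Pn (Suc n)" and hH: "lift h \<in> Hn (Suc n)"
    using qh lift_Pn_subset lift_Hn_subset by blast+
  \<comment> \<open>The part of \<open>g\<close> that fixes every fibre. It still normalises
    \<open>Pn (Suc n)\<close>, because both lifted factors of \<open>b\<close> do.\<close>
  define u where "u = - lift b + g"
  have gu: "g = lift b + u" by (simp add: u_def add.assoc[symmetric])
  have u_div: "ap u i div p = i div p" for i
    unfolding u_def lift_minus[symmetric] by (simp add: b(2))
  have u_supp: "u \<in> supp_below (p ^ Suc n)"
    unfolding u_def
    using lift_supp[OF b(1)] Suc.prems(1) subgrp_add[OF supp_below_subgrp] subgrp_minus[OF supp_below_subgrp]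
    by blast
  have u_norm: "u + x - u \<in> Pn (Suc n)" if x: "x \<in> Pn (Suc n)" for x
  proof -
    have "- lift q + (g + x - g) + lift q \<in> Pn (Suc n)"
      by (rule conj_stableD'[OF conj_stable_self[OF Pn_subgrp] Pn_subgrp qP Suc.prems(2)[OF x]])
    then have "- lift h + (- lift q + (g + x - g) + lift q) + lift h \<in> Pn (Suc n)"
      by (rule conj_stableD'[OF Hn_Pn Hn_subgrp hH])
    then show ?thesis
      unfolding u_def qh(3) lift_add by (simp add: group_simps del: add_uminus_conv_diff)
  qed
  obtain v s where vs: "v \<in> Vn n" "s \<in> Sn n" "u = v + s"
    using normaliser_fibrewise[OF u_supp u_norm u_div] by blast
  \<comment> \<open>The shift \<open>v\<close> is moved to the left of \<open>lift h\<close>, so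
    that the factors from \<open>Pn\<close> stand together.\<close>
  let ?v = "lift h + v - lift h"
  have "?v \<in> Pn (Suc n)" using conj_stableD[OF Hn_Vn hH vs(1)] Vn_subset_Pn by blast
  then have "lift q + ?v \<in> Pn (Suc n)" using subgrp_add[OF Pn_subgrp qP] by blast
  moreover have "lift h + s \<in> Hn (Suc n)" using qh vs by auto
  moreover have "g = (lift q + ?v) + (lift h + s)"
    unfolding gu qh(3) vs(3) lift_add by (simp add: group_simps del: add_uminus_conv_diff)
  ultimately show ?case by blast
qed

end

section \<open>Transfer to the symmetric group\<close>

text \<open>The isomorphism is left open because it is needed twice: as \<open>to_sym\<close> to
  locate the given Sylow subgroup, and then composed with a conjugation that takes
  \<open>Pn n\<close> onto it.\<close>

locale group_transfer = group G for G (structure) +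
  fixes S :: "'c::group_add set" and \<phi> :: "'c \<Rightarrow> 'a"
  assumes S: "subgrp S" "finite S" and bij: "bij_betw \<phi> S (carrier G)"
    and hom: "x \<in> S \<Longrightarrow> y \<in> S \<Longrightarrow> \<phi> (x + y) = \<phi> x \<otimes> \<phi> y"
begin

lemma in_carrier: "x \<in> S \<Longrightarrow> \<phi> x \<in> carrier G"
  using bij by (auto simp: bij_betw_def)

lemma inj: "inj_on \<phi> S"
  using bij by (auto simp: bij_betw_def)

lemma eq_iff: "x \<in> S \<Longrightarrow> y \<in> S \<Longrightarrow> \<phi> x = \<phi> y \<longleftrightarrow> x = y"
  using inj by (auto dest: inj_onD)

lemma carrierE:
  assumes "g \<in> carrier G" obtains x where "x \<in> S" "g = \<phi> x"
  using assms bij by (auto simp: bij_betw_def)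

lemma closed: "0 \<in> S" "x \<in> S \<Longrightarrow> y \<in> S \<Longrightarrow> x + y \<in> S" "x \<in> S \<Longrightarrow> - x \<in> S"
    "x \<in> S \<Longrightarrow> y \<in> S \<Longrightarrow> x - y \<in> S"
  using S(1) by (auto intro: subgrp_0 subgrp_add subgrp_minus subgrp_diff)

lemma phi_0: "\<phi> 0 = \<one>"
proof -
  have "\<phi> 0 \<otimes> \<phi> 0 = \<phi> 0" using hom[of 0 0] closed by simp
  then show ?thesis using in_carrier closed(1) by (simp add: l_cancel_one')
qed

lemma phi_minus: "x \<in> S \<Longrightarrow> \<phi> (- x) = inv (\<phi> x)"
proof -
  assume x: "x \<in> S"
  have "\<phi> (- x) \<otimes> \<phi> x = \<one>" using hom[of "- x" x] closed x phi_0 by simp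
  then show ?thesis using inv_equality in_carrier closed x by simp
qed

lemma phi_conj: "x \<in> S \<Longrightarrow> y \<in> S \<Longrightarrow> \<phi> (x + y - x) = \<phi> x \<otimes> \<phi> y \<otimes> inv (\<phi> x)"
  using hom[of "x + y" "- x"] hom[of x y] closed phi_minus by simp

lemma subgroup_image:
  assumes "subgrp A" "A \<subseteq> S" shows "subgroup (\<phi> ` A) G"
proof (rule subgroupI)
  show "\<phi> ` A \<subseteq> carrier G" "\<phi> ` A \<noteq> {}"
    using assms in_carrier subgrp_0 by blast+
  show "inv x \<in> \<phi> ` A" if "x \<in> \<phi> ` A" for x
    using that assms subgrp_minus[OF assms(1)] by (auto simp: phi_minus[symmetric] subset_iff)
  show "x \<otimes> y \<in> \<phi> ` A" if "x \<in> \<phi> ` A" "y \<in> \<phi> ` A" for x y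
    using that assms subgrp_add[OF assms(1)] by (auto simp: hom[symmetric] subset_iff)
qed

definition "pull A = {x \<in> S. \<phi> x \<in> A}"

lemma pull_subset: "pull A \<subseteq> S"
  by (auto simp: pull_def)

lemma pull_subgrp: "subgroup A G \<Longrightarrow> subgrp (pull A)"
  by (rule subgrpI)
    (auto simp: pull_def closed phi_0 phi_minus hom subgroup.one_closed subgroup.m_closed
      subgroup.m_inv_closed)

lemma pull_image: "A \<subseteq> carrier G \<Longrightarrow> \<phi> ` pull A = A"
  by (force simp: pull_def elim: carrierE)

lemma coset_conj:
  assumes g: "g \<in> S" and A: "A \<subseteq> S"
  shows "\<phi> g <# \<phi> ` A #> inv (\<phi> g) = \<phi> ` (\<lambda>a. g + a - g) ` A"
proof -
  have "\<phi> g <# \<phi> ` A #> inv (\<phi> g) = (\<lambda>a. \<phi> g \<otimes> \<phi> a \<otimes> inv (\<phi> g)) ` A"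
    by (auto simp: l_coset_def r_coset_def)
  also have "\<dots> = (\<lambda>a. \<phi> (g + a - g)) ` A"
    using phi_conj[OF g] A by (intro image_cong) auto
  finally show ?thesis by (simp add: image_image)
qed

lemma conj_image_eq:
  assumes "conj_stable K A" "subgrp K" "g \<in> K" shows "(\<lambda>a. g + a - g) ` A = A"
proof (intro equalityI subsetI)
  fix a assume "a \<in> A"
  then have "- g + a + g \<in> A" by (rule conj_stableD'[OF assms])
  moreover have "a = g + (- g + a + g) - g" by (simp add: group_simps del: add_uminus_conv_diff)
  ultimately show "a \<in> (\<lambda>a. g + a - g) ` A" by blast
qed (use conj_stableD[OF assms(1,3)] in auto)

lemma normalizer_image:
  assumes "A \<subseteq> S"
  shows "normalizer G (\<phi> ` A) = \<phi> ` {g \<in> S. (\<lambda>a. g + a - g) ` A = A}"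
proof -
  have sub: "\<phi> ` A \<subseteq> carrier G" using assms in_carrier by blast
  have iff: "\<phi> g <# \<phi> ` A #> inv (\<phi> g) = \<phi> ` A \<longleftrightarrow> (\<lambda>a. g + a - g) ` A = A" if g: "g \<in> S" for g
  proof -
    have "(\<lambda>a. g + a - g) ` A \<subseteq> S" using g assms closed by blast
    then show ?thesis
      unfolding coset_conj[OF g assms] using inj_on_image_eq_iff[OF inj _ assms] by blast
  qed
  have "normalizer G (\<phi> ` A) = {x \<in> carrier G. x <# \<phi> ` A #> inv x = \<phi> ` A}"
    using sub by (simp add: normalizer_def stabilizer_def)
  also have "\<dots> = \<phi> ` {g \<in> S. (\<lambda>a. g + a - g) ` A = A}"
  proof (intro equalityI subsetI)
    fix x assume x: "x \<in> {x \<in> carrier G. x <# \<phi> ` A #> inv x = \<phi> ` A}"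
    then obtain g where g: "g \<in> S" "x = \<phi> g" using carrierE by blast
    then show "x \<in> \<phi> ` {g \<in> S. (\<lambda>a. g + a - g) ` A = A}" using x iff by blast
  next
    fix x assume "x \<in> \<phi> ` {g \<in> S. (\<lambda>a. g + a - g) ` A = A}"
    then show "x \<in> {x \<in> carrier G. x <# \<phi> ` A #> inv x = \<phi> ` A}" using in_carrier iff by auto
  qed
  finally show ?thesis .
qed

text \<open>The normaliser is the product of \<open>P\<close> and \<open>H\<close>, so the index of
  \<open>H\<close> in it times \<open>card (P \<inter> H)\<close> equals \<open>p ^ a\<close>; the
  index is a power of \<open>p\<close>.\<close>

lemma hall_transfer:
  fixes p :: nat
  assumes p: "Factorial_Ring.prime p" and P: "subgrp P" "P \<subseteq> S" "card P = p ^ a"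
    and H: "subgrp H" "H \<subseteq> S" "coprime (card H) p" and HP: "conj_stable H P"
    and norm: "\<And>g. g \<in> S \<Longrightarrow> (\<And>x. x \<in> P \<Longrightarrow> g + x - g \<in> P) \<Longrightarrow> \<exists>x\<in>P. \<exists>h\<in>H. g = x + h"
  shows "hall_p'_subgroup (G\<lparr>carrier := normalizer G (\<phi> ` P)\<rparr>) p (\<phi> ` H)"
proof -
  define L where "L = normalizer G (\<phi> ` P)"
  define PH where "PH = (\<lambda>(x, h). x + h) ` (P \<times> H)"
  have PS: "\<phi> ` P \<subseteq> carrier G" using P in_carrier by blast
  have L: "subgroup L G" unfolding L_def by (rule normalizer_imp_subgroup[OF PS])
  interpret L: group "G\<lparr>carrier := L\<rparr>" by (rule subgroup.subgroup_is_group[OF L is_group])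
  have PH_S: "PH \<subseteq> S" using P H closed(2) by (auto simp: PH_def)
  have L_eq: "L = \<phi> ` PH"
  proof -
    have "{g \<in> S. (\<lambda>a. g + a - g) ` P = P} = PH"
    proof (intro equalityI subsetI)
      fix g assume "g \<in> {g \<in> S. (\<lambda>a. g + a - g) ` P = P}"
      then have "g \<in> S" "\<And>x. x \<in> P \<Longrightarrow> g + x - g \<in> P" by auto
      then show "g \<in> PH" using norm unfolding PH_def by force
    next
      fix g assume "g \<in> PH"
      then obtain x h where xh: "x \<in> P" "h \<in> H" "g = x + h" by (auto simp: PH_def)
      have "(\<lambda>a. g + a - g) ` P = (\<lambda>a. x + a - x) ` (\<lambda>a. h + a - h) ` P"
        unfolding xh(3) by (simp add: image_image group_simps del: add_uminus_conv_diff)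
      also have "\<dots> = P"
        using conj_image_eq[OF HP H(1) xh(2)] conj_image_eq[OF conj_stable_self[OF P(1)] P(1) xh(1)] by simp
      finally show "g \<in> {g \<in> S. (\<lambda>a. g + a - g) ` P = P}" using \<open>g \<in> PH\<close> PH_S by blast
    qed
    then show ?thesis unfolding L_def normalizer_image[OF P(2)] by simp
  qed
  have fin: "finite P" "finite H" using P H S finite_subset by auto
  have HL: "\<phi> ` H \<subseteq> L"
    unfolding L_eq PH_def using subgrp_0[OF P(1)] by force
  have sub: "subgroup (\<phi> ` H) (G\<lparr>carrier := L\<rparr>)"
    by (rule subgroup_incl[OF subgroup_image[OF H(1,2)] L HL])
  have cH: "card (\<phi> ` H) = card H" and cL: "card L = card PH"
    using inj H PH_S by (auto simp: L_eq intro!: card_image intro: inj_on_subset)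
  have "card (rcosets\<^bsub>G\<lparr>carrier := L\<rparr>\<^esub> (\<phi> ` H)) * card H = card PH"
    using L.lagrange[OF sub] cH cL by (simp add: order_def)
  moreover have "p ^ a * card H = card PH * card (P \<inter> H)"
    using card_set_plus[OF P(1) H(1) fin] P(3) by (simp add: PH_def)
  ultimately have "p ^ a * card H = card (rcosets\<^bsub>G\<lparr>carrier := L\<rparr>\<^esub> (\<phi> ` H)) * card (P \<inter> H) * card H"
    by (metis mult.assoc mult.commute)
  moreover have "card H > 0" using fin subgrp_0[OF H(1)] card_gt_0_iff by blast
  ultimately have "p ^ a = card (rcosets\<^bsub>G\<lparr>carrier := L\<rparr>\<^esub> (\<phi> ` H)) * card (P \<inter> H)" by simp
  then have "\<exists>k. card (rcosets\<^bsub>G\<lparr>carrier := L\<rparr>\<^esub> (\<phi> ` H)) = p ^ k"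
    using p_power_dvdE[OF p] by (metis dvd_triv_left)
  moreover have "finite L" using PH_S S finite_subset by (auto simp: L_eq)
  ultimately show ?thesis
    unfolding hall_p'_subgroup_def using sub cH H(3) by (simp add: L_def)
qed

lemma complements_image:
  assumes P: "subgrp P" "P \<subseteq> S" and N: "N \<subseteq> P" and C: "complements P N C"
  shows "is_complement (G\<lparr>carrier := \<phi> ` P\<rparr>) (\<phi> ` N) (\<phi> ` C)"
proof -
  have CP: "C \<subseteq> P" using complements_subset[OF C] .
  have "subgroup (\<phi> ` C) (G\<lparr>carrier := \<phi> ` P\<rparr>)"
    using subgroup_image[OF complements_subgrp[OF C]] subgroup_image[OF P] CP P(2)
    by (intro subgroup_incl) auto
  moreover have "\<phi> ` N <#> \<phi> ` C = \<phi> ` P"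
  proof -
    have "\<phi> ` N <#> \<phi> ` C = (\<lambda>(x, c). \<phi> x \<otimes> \<phi> c) ` (N \<times> C)"
      by (auto simp: set_mult_def)
    also have "\<dots> = (\<lambda>(x, c). \<phi> (x + c)) ` (N \<times> C)"
      using N CP P(2) hom by (intro image_cong) (auto simp: subset_eq)
    also have "\<dots> = \<phi> ` ((\<lambda>(x, c). x + c) ` (N \<times> C))" by (simp add: image_image case_prod_unfold)
    also have "(\<lambda>(x, c). x + c) ` (N \<times> C) = P"
    proof (intro equalityI subsetI)
      fix g assume "g \<in> P"
      then obtain x c where "x \<in> N" "c \<in> C" "g = x + c" by (rule complements_decomp[OF C])
      then show "g \<in> (\<lambda>(x, c). x + c) ` (N \<times> C)" by force
    qed (use N CP subgrp_add[OF P(1)] in auto)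
    finally show ?thesis .
  qed
  moreover have "\<phi> ` N \<inter> \<phi> ` C = {\<one>}"
  proof -
    have "\<phi> ` N \<inter> \<phi> ` C = \<phi> ` (N \<inter> C)"
      using inj_on_image_Int[OF inj, of N C] N CP P(2) by blast
    then show ?thesis using C phi_0 by (simp add: complements_def)
  qed
  ultimately show ?thesis by (simp add: is_complement_def set_mult_def)
qed

lemma complements_pull:
  assumes P: "subgrp P" "P \<subseteq> S" and N: "N \<subseteq> \<phi> ` P"
    and C: "is_complement (G\<lparr>carrier := \<phi> ` P\<rparr>) N C"
  shows "complements P (pull N) (pull C)"
proof -
  have sub: "subgroup C (G\<lparr>carrier := \<phi> ` P\<rparr>)" and mult: "N <#> C = \<phi> ` P" and int: "N \<inter> C = {\<one>}"
    using C by (auto simp: is_complement_def set_mult_def)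
  have CG: "subgroup C G" by (rule incl_subgroup[OF subgroup_image[OF P] sub])
  have CP: "C \<subseteq> \<phi> ` P" using subgroup.subset[OF sub] by simp
  show ?thesis
    unfolding complements_def
  proof (intro conjI ballI)
    show "subgrp (pull C)" using pull_subgrp[OF CG] .
    show "pull C \<subseteq> P"
    proof
      fix x assume "x \<in> pull C"
      then obtain y where "y \<in> P" "\<phi> x = \<phi> y" "x \<in> S" using CP by (auto simp: pull_def)
      then show "x \<in> P" using eq_iff P(2) by blast
    qed
    show "pull N \<inter> pull C = {0}"
    proof (intro equalityI subsetI)
      fix x assume "x \<in> pull N \<inter> pull C"
      then have "x \<in> S" "\<phi> x = \<phi> 0" using int phi_0 by (auto simp: pull_def)
      then show "x \<in> {0}" using eq_iff closed(1) by blast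
    next
      fix x :: 'c assume "x \<in> {0}"
      then show "x \<in> pull N \<inter> pull C" using int closed(1) phi_0 by (auto simp: pull_def)
    qed
    fix g assume g: "g \<in> P"
    then have "\<phi> g \<in> N <#> C" using mult by blast
    then obtain n c where nc: "n \<in> N" "c \<in> C" "\<phi> g = n \<otimes> c" by (auto simp: set_mult_def)
    then obtain x y where xy: "x \<in> S" "y \<in> S" "n = \<phi> x" "c = \<phi> y" using N CP P(2) by blast
    then have "\<phi> g = \<phi> (x + y)" using nc hom by simp
    then have "g = x + y" using eq_iff closed(2) xy g P(2) by blast
    then show "\<exists>x\<in>pull N. \<exists>c\<in>pull C. g = x + c" using xy nc by (auto simp: pull_def)
  qed
qed

lemma invariant_complement_transfer:
  assumes P: "subgrp P" "P \<subseteq> S" and H: "subgrp H" "H \<subseteq> S"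
    and ex: "\<And>N C. subgrp N \<Longrightarrow> N \<subseteq> P \<Longrightarrow> conj_stable P N \<Longrightarrow> complements P N C \<Longrightarrow>
      \<exists>C'. complements P N C' \<and> conj_stable H C'"
    and N: "N \<lhd> G\<lparr>carrier := \<phi> ` P\<rparr>" and C: "is_complement (G\<lparr>carrier := \<phi> ` P\<rparr>) N C"
  shows "\<exists>C. is_complement (G\<lparr>carrier := \<phi> ` P\<rparr>) N C \<and> conj_invariant G (\<phi> ` H) C"
proof -
  have PG: "subgroup (\<phi> ` P) G" by (rule subgroup_image[OF P])
  interpret P: group "G\<lparr>carrier := \<phi> ` P\<rparr>" by (rule subgroup.subgroup_is_group[OF PG is_group])
  have N1: "subgroup N (G\<lparr>carrier := \<phi> ` P\<rparr>)"
    and N2: "\<And>x n. x \<in> P \<Longrightarrow> n \<in> N \<Longrightarrow> \<phi> x \<otimes> n \<otimes> inv (\<phi> x) \<in> N"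
    using N PG unfolding P.normal_inv_iff by auto
  have NG: "subgroup N G" by (rule incl_subgroup[OF PG N1])
  have NP: "N \<subseteq> \<phi> ` P" using subgroup.subset[OF N1] by simp
  have pN: "pull N \<subseteq> P"
  proof
    fix x assume "x \<in> pull N"
    then obtain y where "y \<in> P" "\<phi> x = \<phi> y" "x \<in> S" using NP by (auto simp: pull_def)
    then show "x \<in> P" using eq_iff P(2) by blast
  qed
  have "conj_stable P (pull N)"
  proof (rule conj_stableI)
    fix x n assume x: "x \<in> P" and n: "n \<in> pull N"
    then have "x \<in> S" "n \<in> S" "\<phi> n \<in> N" using P(2) by (auto simp: pull_def)
    then show "x + n - x \<in> pull N"
      using phi_conj[of x n] N2[OF x, of "\<phi> n"] closed(2,4) by (simp add: pull_def)
  qed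
  then obtain C' where C': "complements P (pull N) C'" "conj_stable H C'"
    using ex[OF pull_subgrp[OF NG] pN _ complements_pull[OF P NP C]] by blast
  have C'S: "C' \<subseteq> S" using complements_subset[OF C'(1)] P(2) by blast
  have "is_complement (G\<lparr>carrier := \<phi> ` P\<rparr>) (\<phi> ` pull N) (\<phi> ` C')"
    by (rule complements_image[OF P pN C'(1)])
  moreover have "\<phi> ` pull N = N" using pull_image subgroup.subset[OF NG] by blast
  moreover have "conj_invariant G (\<phi> ` H) (\<phi> ` C')"
    unfolding conj_invariant_def using coset_conj[OF _ C'S] conj_image_eq[OF C'(2) H(1)] H(2) by auto
  ultimately show ?thesis by auto
qed

end

text \<open>\<open>sym_group m\<close> permutes \<open>{1..m}\<close> and fixes 0, while the tower
  lives on \<open>{..<m}\<close>; hence the shift by one.\<close>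

definition to_sym :: "nperm \<Rightarrow> nat \<Rightarrow> nat" where
  "to_sym g j = (if j = 0 then 0 else Suc (ap g (j - 1)))"

lemma to_sym_add: "to_sym (g + h) = to_sym g \<circ> to_sym h"
  by (auto simp: to_sym_def)

lemma to_sym_permutes:
  assumes "g \<in> supp_below m" shows "to_sym g permutes {1..m}"
  unfolding permutes_def
proof (intro conjI allI impI)
  fix j assume "j \<notin> {1..m}"
  then have "j = 0 \<or> j - 1 \<ge> m" by auto
  then show "to_sym g j = j" using assms by (auto simp: to_sym_def supp_below_def)
next
  fix y
  show "\<exists>!j. to_sym g j = y"
  proof (cases y)
    case 0
    then show ?thesis by (auto simp: to_sym_def intro!: ex1I[of _ 0] split: if_splits)
  next
    case (Suc k)
    show ?thesis
    proof (rule ex1I[of _ "Suc (ap (- g) k)"])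
      show "to_sym g (Suc (ap (- g) k)) = y" using Suc by (simp add: to_sym_def)
      show "j = Suc (ap (- g) k)" if "to_sym g j = y" for j
        using that Suc by (cases j) (auto simp: to_sym_def)
    qed
  qed
qed

lemma to_sym_bij: "bij_betw to_sym (supp_below m) (carrier (sym_group m))"
  unfolding bij_betw_def
proof (intro conjI equalityI subsetI)
  show "inj_on to_sym (supp_below m)"
  proof (rule inj_onI, rule nperm_eqI)
    fix g h i assume "to_sym g = to_sym h"
    then have "to_sym g (Suc i) = to_sym h (Suc i)" by simp
    then show "ap g i = ap h i" by (simp add: to_sym_def)
  qed
  show "x \<in> carrier (sym_group m)" if "x \<in> to_sym ` supp_below m" for x
    using that to_sym_permutes by (auto simp: sym_group_carrier)
  fix s assume "s \<in> carrier (sym_group m)"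
  then have s: "s permutes {1..m}" by (simp add: sym_group_carrier)
  have s0: "s 0 = 0" using permutes_not_in[OF s, of 0] by simp
  have pos: "s (Suc i) > 0" for i
    using s0 permutes_inj[OF s] by (metis injD nat.distinct(1) neq0_conv)
  define f where "f i = s (Suc i) - 1" for i
  have Suc_f: "Suc (f i) = s (Suc i)" for i using pos[of i] by (simp add: f_def)
  have "bij f"
  proof (rule bijI)
    show "inj f"
      by (rule injI) (metis Suc_f Suc_inject permutes_inj[OF s] injD)
    show "surj f"
    proof (rule surjI[of f "\<lambda>k. (Hilbert_Choice.inv s (Suc k)) - 1"])
      fix k
      let ?j = "Hilbert_Choice.inv s (Suc k)"
      have j: "s ?j = Suc k" by (rule permutes_inverses(1)[OF s])
      then have "?j \<noteq> 0" using s0 by (metis nat.distinct(1))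
      then have "s (Suc (?j - 1)) = Suc k" using j by simp
      then show "f (?j - 1) = k" by (simp add: f_def)
    qed
  qed
  then have ap_f: "ap (Nperm f) = f" by (rule ap_Nperm)
  have "Nperm f \<in> supp_below m"
    using permutes_not_in[OF s] by (simp add: supp_below_def ap_f f_def)
  moreover have "to_sym (Nperm f) = s"
  proof
    fix j show "to_sym (Nperm f) j = s j"
      by (cases j) (simp_all add: to_sym_def ap_f s0 Suc_f)
  qed
  ultimately show "s \<in> to_sym ` supp_below m" by blast
qed

lemma card_supp_below: "card (supp_below m) = fact m"
  using bij_betw_same_card[OF to_sym_bij] sym_group_card_carrier by simp

theorem theorem1p5:
  fixes p n :: nat and P :: "(nat \<Rightarrow> nat) set"
  assumes "Factorial_Ring.prime p" and "n \<ge> 1"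
    and "sylow_subgroup (sym_group (p ^ n)) p P"
  shows "\<exists>H. hall_p'_subgroup
               ((sym_group (p ^ n))\<lparr>carrier := normalizer (sym_group (p ^ n)) P\<rparr>) p H \<and>
             (\<forall>N. N \<lhd> (sym_group (p ^ n))\<lparr>carrier := P\<rparr> \<longrightarrow>
                  (\<exists>C. is_complement ((sym_group (p ^ n))\<lparr>carrier := P\<rparr>) N C) \<longrightarrow>
                  (\<exists>C. is_complement ((sym_group (p ^ n))\<lparr>carrier := P\<rparr>) N C \<and>
                       conj_invariant (sym_group (p ^ n)) H C))"
proof -
  interpret prime_tower p by unfold_locales (rule assms(1))
  let ?G = "sym_group (p ^ n)" and ?S = "supp_below (p ^ n)"
  interpret T: group_transfer ?G ?S to_sym
    using sym_group_is_group supp_below_subgrp finite_supp_below to_sym_bij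
    by (auto simp: group_transfer_def group_transfer_axioms_def to_sym_add sym_group_mult)
  let ?e = "multiplicity p (fact (p ^ n) :: nat)"
  have P: "subgroup P ?G" "card P = p ^ ?e"
    using assms(3) by (auto simp: sylow_subgroup_def order_def sym_group_card_carrier)
  have P_image: "to_sym ` T.pull P = P" using T.pull_image subgroup.subset[OF P(1)] by blast
  have "card (T.pull P) = p ^ ?e"
    using card_image[OF inj_on_subset[OF T.inj T.pull_subset], of P] P_image P(2) by simp
  moreover obtain k where k: "(fact (p ^ n) :: nat) = p ^ ?e * k" "\<not> p dvd k"
    using multiplicity_decompose'[of "fact (p ^ n) :: nat" p] p_gt_1 by auto
  moreover have "card ?S = p ^ ?e * k" using k(1) card_supp_below by simp
  \<comment> \<open>The model \<open>Pn n\<close> and the given Sylow subgroup have the same full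
    \<open>p\<close>-power order, so they are conjugate.\<close>
  ultimately obtain g where g: "g \<in> ?S" "(\<lambda>b. g + b - g) ` Pn n = T.pull P"
    using sylow_conjugate[OF p supp_below_subgrp finite_supp_below _ k(2) T.pull_subgrp[OF P(1)]
        T.pull_subset _ Pn_subgrp Pn_supp card_Pn_sylow] by blast
  \<comment> \<open>Building the conjugation into the isomorphism makes the image of
    \<open>Pn n\<close> equal to \<open>P\<close> itself, so that \<open>Hn n\<close> is carried to
    a subgroup of the normaliser of \<open>P\<close>.\<close>
  define \<phi> where "\<phi> x = to_sym (g + x - g)" for x
  have conj_S: "g + x - g \<in> ?S" if "x \<in> ?S" for x using T.closed g that by blast
  interpret C: group_transfer ?G ?S \<phi>
  proof
    have "bij_betw (\<lambda>x. g + x - g) ?S ?S"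
    proof (rule bij_betwI[where g = "\<lambda>x. - g + x + g"])
      show "(\<lambda>x. - g + x + g) \<in> ?S \<rightarrow> ?S" using T.closed g by auto
    qed (use conj_S in \<open>auto simp: group_simps simp del: add_uminus_conv_diff\<close>)
    then show "bij_betw \<phi> ?S (carrier ?G)"
      using bij_betw_trans[OF _ to_sym_bij] by (simp add: \<phi>_def[abs_def] comp_def)
    show "\<phi> (x + y) = \<phi> x \<otimes>\<^bsub>?G\<^esub> \<phi> y" if "x \<in> ?S" "y \<in> ?S" for x y
    proof -
      have "g + (x + y) - g = (g + x - g) + (g + y - g)"
        by (simp add: group_simps del: add_uminus_conv_diff)
      then show ?thesis using T.hom conj_S that by (simp add: \<phi>_def)
    qed
  qed (rule supp_below_subgrp, rule finite_supp_below)
  have \<phi>_P: "\<phi> ` Pn n = P"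
    using P_image unfolding g(2)[symmetric] by (simp add: \<phi>_def[abs_def] image_image)
  have ex: "\<exists>C'. complements (Pn n) N C' \<and> conj_stable (Hn n) C'"
    if "subgrp N" "N \<subseteq> Pn n" "conj_stable (Pn n) N" "complements (Pn n) N C" for N C
    by (rule stable_complementsD[OF stable_complements_tower that]) (intro exI conjI)
  show ?thesis
  proof (rule exI[of _ "\<phi> ` Hn n"], intro conjI allI impI)
    show "hall_p'_subgroup (?G\<lparr>carrier := normalizer ?G P\<rparr>) p (\<phi> ` Hn n)"
      using C.hall_transfer[OF p Pn_subgrp Pn_supp card_Pn_sylow Hn_subgrp Hn_supp coprime_card_Hn
          Hn_Pn normaliser_Pn] \<phi>_P by simp
    fix N assume N: "N \<lhd> ?G\<lparr>carrier := P\<rparr>" and "\<exists>C. is_complement (?G\<lparr>carrier := P\<rparr>) N C"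
    then obtain C where C: "is_complement (?G\<lparr>carrier := P\<rparr>) N C" by blast
    show "\<exists>C. is_complement (?G\<lparr>carrier := P\<rparr>) N C \<and> conj_invariant ?G (\<phi> ` Hn n) C"
      by (rule C.invariant_complement_transfer[OF Pn_subgrp Pn_supp Hn_subgrp Hn_supp ex, unfolded \<phi>_P,
            OF _ _ _ _ N C])
  qed
qed

end
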